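(* Let $\mathcal{H}$ be a complex separable infinite-dimensional Hilbert space and $T$ a bounded linear operator on $\mathcal{H}$ whose eigenvectors associated to unimodular eigenvalues are parametrized by a $\mathbb{T}$-eigenvector field $E$ which is $\mu$-spanning and $\alpha$-H\"olderian for some $\alpha\in(0,1]$. Let $m$ be the Gaussian measure associated to $E$ and let $\mathcal{X},\mathcal{Y}$ be the function spaces with norms $\|\cdot\|_{\mathcal{X}},\|\cdot\|_{\mathcal{Y}}$ described in the context. Then there exists a positive constant $C'(E)$ such that for all $f\in\mathcal{X}$ and $g\in\mathcal{Y}$, $$|\mathcal{I}_n(f,g)|\le \frac{C'(E)}{n^{\alpha}}\,\|f\|_{\mathcal{X}}\,\|g\|_{\mathcal{Y}}$$ for every positive integer $n$.
   Context: The inner product $\langle u,v\rangle$ of $\mathcal{H}$ is linear in $v$ and conjugate-linear in $u$; $\mathcal{B}$ is the Borel $\sigma$-algebra. $\mathbb{T}$ is the unit circle and $\mu$ the normalized Lebesgue measure $d\theta/2\pi$ on it. A $\mathbb{T}$-eigenvector field for $T$ is a bounded map $E:\mathbb{T}\to\mathcal{H}$ with $TE(\lambda)=\lambda E(\lambda)$ for all $\lambda\in\mathbb{T}$; it is $\mu$-spanning if for every $\mu$-measurable $A\subset\mathbb{T}$ with $\mu(A)=1$, the vectors $E(\lambda)$, $\lambda\in A$, span a dense subspace of $\mathcal{H}$; it is $\alpha$-H\"olderian if there is $C(E)>0$ with $\|E(e^{i\theta})-E(e^{i\theta'})\|\le C(E)|\theta-\theta'|^{\alpha}$ for all $\theta,\theta'\in[0,2\pi)$.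 Let $K:L^2(\mathbb{T},\mu)\to\mathcal{H}$, $Kf=\int_{\mathbb{T}}f(\lambda)E(\lambda)\,d\mu(\lambda)$, and $R=KK^*$, so $\langle Rx,y\rangle=\int_{\mathbb{T}}\langle x,E(\lambda)\rangle\overline{\langle y,E(\lambda)\rangle}\,d\mu(\lambda)$. The Gaussian measure $m$ is the unique Borel probability measure on $\mathcal{H}$ such that each $\langle x,\cdot\rangle$ has complex symmetric Gaussian distribution (either a.s. zero, or real and imaginary parts independent centered Gaussians with equal variance) and $\int\langle x,z\rangle\overline{\langle y,z\rangle}\,dm(z)=\langle Rx,y\rangle$ for all $x,y$. Correlations: $\mathcal{I}_n(f,g)=\int f(T^nx)g(x)\,dm(x)-\int f\,dm\int g\,dm$. Let $(e_j)_{j\ge1}$ be an orthonormal basis of eigenvectors of $R$, $Re_j=2\sigma_j^2e_j$, where $\sigma_j^2=\int(\mathfrak{Re}\langle e_j,z\rangle)^2dm(z)$. Let $\mathbb{Z}^*=\mathbb{Z}\setminus\{0\}$, $\mathfrak{e}_\ell=e_\ell$, $\mathfrak{e}_{-\ell}=ie_\ell$, $\sigma_{-\ell}=\sigma_\ell$ for $\ell\ge1$. $L^2_{\mathbb{R}}$ denotes real-valued functions in $L^2(\mathcal{H},\mathcal{B},m)$; $\mathcal{G}$ is the closed span in $L^2_{\mathbb{R}}$ of $\mathfrak{Re}\langle\mathfrak{e}_k,\cdot\rangle$, $k\in\mathbb{Z}^*$; $\mathcal{G}^k$ is the span of products $g_1\cdots g_k$ with $g_i\in\mathcal{G}$ ($\mathcal{G}^0=$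 constants). The Wick transform of $f\in\mathcal{G}^k$ ($k\ge1$) is $:f:=f-P_kf$, $P_k$ the orthogonal projection onto the closed span of $\mathcal{G}^0,\dots,\mathcal{G}^{k-1}$ ($:c:=c$ for constants); $:\mathcal{G}^k:$ is the closure of $\{:f:\,;f\in\mathcal{G}^k\}$. These spaces are mutually orthogonal with $L^2_{\mathbb{R}}=\bigoplus_{k\ge0}:\mathcal{G}^k:$; for $f\in L^2_{\mathbb{R}}$ let $f_k$ be its orthogonal projection onto $:\mathcal{G}^k:$. Set $\alpha^{(k)}_{i_1,\dots,i_k}=\langle f,:\mathfrak{Re}\langle\mathfrak{e}_{i_1},\cdot\rangle\cdots\mathfrak{Re}\langle\mathfrak{e}_{i_k},\cdot\rangle:\rangle_{L^2(m)}/(k!\,\sigma_{i_1}^2\cdots\sigma_{i_k}^2)$ for $(i_1,\dots,i_k)\in(\mathbb{Z}^* )^k$ (so $f_k=\sum_{(i_1,\dots,i_k)}\alpha^{(k)}_{i_1,\dots,i_k}:\mathfrak{Re}\langle\mathfrak{e}_{i_1},\cdot\rangle\cdots\mathfrak{Re}\langle\mathfrak{e}_{i_k},\cdot\rangle:$), and $\mathcal{B}_{f_k}(x^{(1)},\dots,x^{(k)})=\sum_{(i_1,\dots,i_k)\in(\mathbb{Z}^* )^k}\alpha^{(k)}_{i_1,\dots,i_k}x^{(1)}_{i_1}\cdots x^{(k)}_{i_k}$ for $x^{(j)}\in\ell_2(\mathbb{Z}^*,\mathbb{R})$; $\mathcal{B}_{f_k}$ is bounded if this is well defined and $|\mathcal{B}_{f_k}(x^{(1)},\dots,x^{(k)})|\le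 C\prod_j\|x^{(j)}\|_2$, with $\|\mathcal{B}_{f_k}\|$ the supremum over unit vectors. $\mathcal{X}$ is the space of $f\in L^2_{\mathbb{R}}$ with all $\mathcal{B}_{f_k}$ bounded and $\sum_{k\ge0}\|\mathcal{B}_{f_k}\|^2<\infty$, normed by $\|f\|_{\mathcal{X}}=(\|f\|^2_{L^2(m)}+\sum_k\|\mathcal{B}_{f_k}\|^2)^{1/2}$; $\mathcal{Y}\subset\mathcal{X}$ is the space of $g$ with all $\mathcal{B}_{g_k}$ bounded and $\sup_k k!\|\mathcal{B}_{g_k}\|<\infty$, normed by $\|g\|_{\mathcal{Y}}=\|g\|_{L^2(m)}+\sup_{k\ge0}k!\|\mathcal{B}_{g_k}\|$. *)

theory Defs
  imports "HOL-Analysis.Analysis" "HOL-Probability.Probability"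
begin

text \<open>A complex Hilbert space H is encoded as a real Hilbert space (type class real_inner,
complete_space) together with a complex structure J (multiplication by i).
The real inner product is the real part of the complex one.\<close>

definition complex_structure :: "('h::real_inner \<Rightarrow> 'h) \<Rightarrow> bool" where
  "complex_structure J \<longleftrightarrow> linear J \<and> (\<forall>x. J (J x) = - x) \<and> (\<forall>x y. inner (J x) (J y) = inner x y)"

definition cscale :: "('h::real_vector \<Rightarrow> 'h) \<Rightarrow> complex \<Rightarrow> 'h \<Rightarrow> 'h" where
  "cscale J a x = Re a *\<^sub>R x + Im a *\<^sub>R J x"

text \<open>complex inner product, conjugate-linear in the first, linear in the second argument\<close>
definition cinner :: "('h::real_inner \<Rightarrow> 'h) \<Rightarrow> 'h \<Rightarrow> 'h \<Rightarrow> complex" where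
  "cinner J u v = Complex (inner u v) (- inner u (J v))"

definition cspan :: "('h::real_vector \<Rightarrow> 'h) \<Rightarrow> 'h set \<Rightarrow> 'h set" where
  "cspan J S = {y. \<exists>n (c::nat \<Rightarrow> complex) v. (\<forall>i<n. v i \<in> S) \<and> y = (\<Sum>i<n. cscale J (c i) (v i))}"

definition separable_type :: "'a::metric_space itself \<Rightarrow> bool" where
  "separable_type _ \<longleftrightarrow> (\<exists>D::'a set. countable D \<and> closure D = UNIV)"

definition infinite_dim :: "'a::real_vector itself \<Rightarrow> bool" where
  "infinite_dim _ \<longleftrightarrow> \<not> (\<exists>S::'a set. finite S \<and> span S = UNIV)"

definition circ_integral :: "(complex \<Rightarrow> complex) \<Rightarrow> complex" where
  "circ_integral F = (\<integral>\<theta>. F (cis \<theta>) \<partial>(lebesgue_on {0..<2*pi})) / complex_of_real (2*pi)"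

definition circ_full :: "complex set \<Rightarrow> bool" where
  "circ_full A \<longleftrightarrow> A \<subseteq> sphere 0 1 \<and>
     {\<theta>\<in>{0..<2*pi}. cis \<theta> \<in> A} \<in> sets lebesgue \<and>
     emeasure lebesgue {\<theta>\<in>{0..<2*pi}. cis \<theta> \<in> A} = ennreal (2*pi)"

definition T_eigenvector_field :: "('h::real_inner \<Rightarrow> 'h) \<Rightarrow> ('h \<Rightarrow> 'h) \<Rightarrow> (complex \<Rightarrow> 'h) \<Rightarrow> bool" where
  "T_eigenvector_field J T E \<longleftrightarrow>
     (\<exists>M. \<forall>l\<in>sphere 0 1. norm (E l) \<le> M) \<and>
     (\<forall>l\<in>sphere 0 1. T (E l) = cscale J l (E l))"

definition mu_spanning :: "('h::real_inner \<Rightarrow> 'h) \<Rightarrow> (complex \<Rightarrow> 'h) \<Rightarrow> bool" where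
  "mu_spanning J E \<longleftrightarrow> (\<forall>A. circ_full A \<longrightarrow> closure (cspan J (E ` A)) = UNIV)"

definition holderian :: "real \<Rightarrow> (complex \<Rightarrow> 'h::real_normed_vector) \<Rightarrow> bool" where
  "holderian \<alpha> E \<longleftrightarrow> (\<exists>C>0. \<forall>\<theta>\<in>{0..<2*pi}. \<forall>\<theta>'\<in>{0..<2*pi}.
      norm (E (cis \<theta>) - E (cis \<theta>')) \<le> C * \<bar>\<theta> - \<theta>'\<bar> powr \<alpha>)"

text \<open>The bilinear form of R = K K^*: the value of the inner product of R x and y\<close>
definition R_form :: "('h::real_inner \<Rightarrow> 'h) \<Rightarrow> (complex \<Rightarrow> 'h) \<Rightarrow> 'h \<Rightarrow> 'h \<Rightarrow> complex" where
  "R_form J E x y = circ_integral (\<lambda>l. cinner J x (E l) * cnj (cinner J y (E l)))"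

definition complex_symmetric_gaussian :: "'h measure \<Rightarrow> ('h \<Rightarrow> complex) \<Rightarrow> bool" where
  "complex_symmetric_gaussian m X \<longleftrightarrow>
     (AE z in m. X z = 0) \<or>
     (\<exists>\<sigma>>0. distributed m lborel (\<lambda>z. Re (X z)) (normal_density 0 \<sigma>) \<and>
            distributed m lborel (\<lambda>z. Im (X z)) (normal_density 0 \<sigma>) \<and>
            prob_space.indep_var m borel (\<lambda>z. Re (X z)) borel (\<lambda>z. Im (X z)))"

definition gaussian_measure :: "('h::{real_inner,complete_space} \<Rightarrow> 'h) \<Rightarrow> (complex \<Rightarrow> 'h) \<Rightarrow> 'h measure \<Rightarrow> bool" where
  "gaussian_measure J E m \<longleftrightarrow>
     sets m = sets borel \<and> prob_space m \<and>
     (\<forall>x. complex_symmetric_gaussian m (\<lambda>z. cinner J x z)) \<and>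
     (\<forall>x y. integrable m (\<lambda>z. cinner J x z * cnj (cinner J y z)) \<and>
            (\<integral>z. cinner J x z * cnj (cinner J y z) \<partial>m) = R_form J E x y)"

definition R_eigenbasis :: "('h::real_inner \<Rightarrow> 'h) \<Rightarrow> (complex \<Rightarrow> 'h) \<Rightarrow> (nat \<Rightarrow> 'h) \<Rightarrow> bool" where
  "R_eigenbasis J E e \<longleftrightarrow>
     (\<forall>i\<ge>1. \<forall>j\<ge>1. cinner J (e i) (e j) = (if i = j then 1 else 0)) \<and>
     closure (cspan J (e ` {1..})) = UNIV \<and>
     (\<forall>j\<ge>1. \<exists>c::real. \<forall>y. R_form J E (e j) y = complex_of_real c * cinner J (e j) y)"

definition correlation :: "'h measure \<Rightarrow> ('h \<Rightarrow> 'h) \<Rightarrow> nat \<Rightarrow> ('h \<Rightarrow> real) \<Rightarrow> ('h \<Rightarrow> real) \<Rightarrow> real" where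
  "correlation m T n f g = (\<integral>x. f ((T ^^ n) x) * g x \<partial>m) - (\<integral>x. f x \<partial>m) * (\<integral>x. g x \<partial>m)"

definition L2R :: "'h measure \<Rightarrow> ('h \<Rightarrow> real) set" where
  "L2R m = {f. f \<in> borel_measurable m \<and> integrable m (\<lambda>x. (f x)\<^sup>2)}"

definition L2inner :: "'h measure \<Rightarrow> ('h \<Rightarrow> real) \<Rightarrow> ('h \<Rightarrow> real) \<Rightarrow> real" where
  "L2inner m f g = (\<integral>x. f x * g x \<partial>m)"

definition L2norm :: "'h measure \<Rightarrow> ('h \<Rightarrow> real) \<Rightarrow> real" where
  "L2norm m f = sqrt (\<integral>x. (f x)\<^sup>2 \<partial>m)"

definition L2closure :: "'h measure \<Rightarrow> ('h \<Rightarrow> real) set \<Rightarrow> ('h \<Rightarrow> real) set" where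
  "L2closure m S = {f\<in>L2R m. \<forall>\<epsilon>>0. \<exists>g\<in>S. L2norm m (\<lambda>x. f x - g x) < \<epsilon>}"

definition fspan :: "('h \<Rightarrow> real) set \<Rightarrow> ('h \<Rightarrow> real) set" where
  "fspan S = {h. \<exists>n (c::nat \<Rightarrow> real) g. (\<forall>i<n. g i \<in> S) \<and> h = (\<lambda>x. \<Sum>i<n. c i * g i x)}"

definition L2proj :: "'h measure \<Rightarrow> ('h \<Rightarrow> real) set \<Rightarrow> ('h \<Rightarrow> real) \<Rightarrow> ('h \<Rightarrow> real)" where
  "L2proj m V f = (SOME p. p \<in> V \<and> (\<forall>v\<in>V. L2inner m (\<lambda>x. f x - p x) v = 0))"

definition frak_e :: "('h \<Rightarrow> 'h) \<Rightarrow> (nat \<Rightarrow> 'h) \<Rightarrow> int \<Rightarrow> 'h" where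
  "frak_e J e k = (if k > 0 then e (nat k) else J (e (nat (- k))))"

definition gvar :: "('h::real_inner \<Rightarrow> 'h) \<Rightarrow> (nat \<Rightarrow> 'h) \<Rightarrow> int \<Rightarrow> 'h \<Rightarrow> real" where
  "gvar J e k z = Re (cinner J (frak_e J e k) z)"

definition sigma2 :: "('h::real_inner \<Rightarrow> 'h) \<Rightarrow> (nat \<Rightarrow> 'h) \<Rightarrow> 'h measure \<Rightarrow> int \<Rightarrow> real" where
  "sigma2 J e m k = (\<integral>z. (Re (cinner J (e (nat \<bar>k\<bar>)) z))\<^sup>2 \<partial>m)"

definition Gspace :: "('h::real_inner \<Rightarrow> 'h) \<Rightarrow> (nat \<Rightarrow> 'h) \<Rightarrow> 'h measure \<Rightarrow> ('h \<Rightarrow> real) set" where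
  "Gspace J e m = L2closure m (fspan {gvar J e k | k. k \<noteq> 0})"

definition Gpow :: "('h::real_inner \<Rightarrow> 'h) \<Rightarrow> (nat \<Rightarrow> 'h) \<Rightarrow> 'h measure \<Rightarrow> nat \<Rightarrow> ('h \<Rightarrow> real) set" where
  "Gpow J e m k = fspan {(\<lambda>x. \<Prod>i<k. g i x) | g. \<forall>i<k. g i \<in> Gspace J e m}"

definition Glower :: "('h::real_inner \<Rightarrow> 'h) \<Rightarrow> (nat \<Rightarrow> 'h) \<Rightarrow> 'h measure \<Rightarrow> nat \<Rightarrow> ('h \<Rightarrow> real) set" where
  "Glower J e m k = L2closure m (fspan (\<Union>j<k. Gpow J e m j))"

text \<open>Wick transform of f in G^k (for k = 0 the projection is onto the null functions)\<close>
definition wick :: "('h::real_inner \<Rightarrow> 'h) \<Rightarrow> (nat \<Rightarrow> 'h) \<Rightarrow> 'h measure \<Rightarrow> nat \<Rightarrow> ('h \<Rightarrow> real) \<Rightarrow> ('h \<Rightarrow> real)" where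
  "wick J e m k f = (if k = 0 then f else (\<lambda>x. f x - L2proj m (Glower J e m k) f x))"

definition idx :: "nat \<Rightarrow> int list set" where
  "idx k = {is. length is = k \<and> 0 \<notin> set is}"

definition alpha_coef :: "('h::real_inner \<Rightarrow> 'h) \<Rightarrow> (nat \<Rightarrow> 'h) \<Rightarrow> 'h measure \<Rightarrow> ('h \<Rightarrow> real) \<Rightarrow> int list \<Rightarrow> real" where
  "alpha_coef J e m f is =
     L2inner m f (wick J e m (length is) (\<lambda>z. \<Prod>j<length is. gvar J e (is ! j) z))
       / (fact (length is) * (\<Prod>j<length is. sigma2 J e m (is ! j)))"

text \<open>l2(Z*, R): functions on int vanishing at 0 and square summable\<close>
definition l2Z :: "(int \<Rightarrow> real) set" where
  "l2Z = {x. x 0 = 0 \<and> (\<lambda>i. (x i)\<^sup>2) summable_on UNIV}"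

definition l2Z_norm :: "(int \<Rightarrow> real) \<Rightarrow> real" where
  "l2Z_norm x = sqrt (\<Sum>\<^sub>\<infinity>i. (x i)\<^sup>2)"

definition Bterm :: "('h::real_inner \<Rightarrow> 'h) \<Rightarrow> (nat \<Rightarrow> 'h) \<Rightarrow> 'h measure \<Rightarrow> ('h \<Rightarrow> real) \<Rightarrow> nat \<Rightarrow> (nat \<Rightarrow> int \<Rightarrow> real) \<Rightarrow> int list \<Rightarrow> real" where
  "Bterm J e m f k x is = alpha_coef J e m f is * (\<Prod>j<k. x j (is ! j))"

definition Bform :: "('h::real_inner \<Rightarrow> 'h) \<Rightarrow> (nat \<Rightarrow> 'h) \<Rightarrow> 'h measure \<Rightarrow> ('h \<Rightarrow> real) \<Rightarrow> nat \<Rightarrow> (nat \<Rightarrow> int \<Rightarrow> real) \<Rightarrow> real" where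
  "Bform J e m f k x = (\<Sum>\<^sub>\<infinity>is\<in>idx k. Bterm J e m f k x is)"

definition Bbounded :: "('h::real_inner \<Rightarrow> 'h) \<Rightarrow> (nat \<Rightarrow> 'h) \<Rightarrow> 'h measure \<Rightarrow> ('h \<Rightarrow> real) \<Rightarrow> nat \<Rightarrow> bool" where
  "Bbounded J e m f k \<longleftrightarrow> (\<exists>C. \<forall>x. (\<forall>j<k. x j \<in> l2Z) \<longrightarrow>
      Bterm J e m f k x summable_on idx k \<and>
      \<bar>Bform J e m f k x\<bar> \<le> C * (\<Prod>j<k. l2Z_norm (x j)))"

definition Bnorm :: "('h::real_inner \<Rightarrow> 'h) \<Rightarrow> (nat \<Rightarrow> 'h) \<Rightarrow> 'h measure \<Rightarrow> ('h \<Rightarrow> real) \<Rightarrow> nat \<Rightarrow> real" where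
  "Bnorm J e m f k = (SUP x\<in>{x. \<forall>j<k. x j \<in> l2Z \<and> l2Z_norm (x j) = 1}. \<bar>Bform J e m f k x\<bar>)"

definition Xspace :: "('h::real_inner \<Rightarrow> 'h) \<Rightarrow> (nat \<Rightarrow> 'h) \<Rightarrow> 'h measure \<Rightarrow> ('h \<Rightarrow> real) set" where
  "Xspace J e m = {f\<in>L2R m. (\<forall>k. Bbounded J e m f k) \<and> summable (\<lambda>k. (Bnorm J e m f k)\<^sup>2)}"

definition Xnorm :: "('h::real_inner \<Rightarrow> 'h) \<Rightarrow> (nat \<Rightarrow> 'h) \<Rightarrow> 'h measure \<Rightarrow> ('h \<Rightarrow> real) \<Rightarrow> real" where
  "Xnorm J e m f = sqrt ((L2norm m f)\<^sup>2 + (\<Sum>k. (Bnorm J e m f k)\<^sup>2))"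

definition Yspace :: "('h::real_inner \<Rightarrow> 'h) \<Rightarrow> (nat \<Rightarrow> 'h) \<Rightarrow> 'h measure \<Rightarrow> ('h \<Rightarrow> real) set" where
  "Yspace J e m = {g\<in>L2R m. (\<forall>k. Bbounded J e m g k) \<and> bdd_above (range (\<lambda>k. fact k * Bnorm J e m g k))}"

definition Ynorm :: "('h::real_inner \<Rightarrow> 'h) \<Rightarrow> (nat \<Rightarrow> 'h) \<Rightarrow> 'h measure \<Rightarrow> ('h \<Rightarrow> real) \<Rightarrow> real" where
  "Ynorm J e m g = L2norm m g + (SUP k. fact k * Bnorm J e m g k)"

end

theory Submission
  imports Defs
begin

text \<open>Let \<open>f\<^sub>k\<close>, \<open>g\<^sub>k\<close> be the components of \<open>f\<close>, \<open>g\<close> in the \<open>k\<close>-th chaos. By Wick's formula the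
correlation of \<open>f\<^sub>k \<circ> T\<^sup>n\<close> with \<open>g\<^sub>k\<close> is \<open>k!\<close> times the pairing of the coefficient tensors through the
\<open>k\<close>-th tensor power of the covariance \<open>C\<^sub>n\<close> between \<open>z\<close> and \<open>T\<^sup>n z\<close>. Now \<open>C\<^sub>n\<close> is the \<open>n\<close>-th Fourier coefficient of
\<open>\<lambda> \<mapsto> E(\<lambda>) \<otimes> E(\<lambda>)\<^sup>*\<close>; subtracting the value at the left end of each of the \<open>n\<close> arcs of length \<open>2\<pi>/n\<close> does
not change it, so by the Hoelder condition its nuclear norm is at most \<open>\<rho> = c n\<^sup>-\<^sup>\<alpha>\<close>. Expanding \<open>C\<^sub>n\<close> into
rank-one operators bounds the \<open>k\<close>-th term by \<open>k! \<rho>\<^sup>k\<close> times the norms of the two multilinear forms. If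
\<open>\<rho> \<le> 1/2\<close>, summing over \<open>k \<ge> 1\<close> gives a multiple of \<open>\<rho>\<close>; otherwise the invariance of the Gaussian measure
under \<open>T\<close> gives a bound that is already smaller than a multiple of \<open>\<rho>\<close>.\<close>

section \<open>Wick calculus in Gaussian spaces\<close>

text \<open>The objects of the statement are given abstractly, while the estimate needs formulas.
  The Wick transform is a projection selected by choice and thus fixed only up to null sets; it is
  identified with the explicit polynomial obtained by averaging the product of the factors X + i X'
  over an independent copy X'. The same description yields orthogonality of the degrees and Wick's
  formula, because contractions inside the product cancel (i^2 = -1). Convergence of the chaos
  expansion and invariance of \<open>m\<close> both rest on uniqueness of a finite measure with
  given characteristic function on a separable Hilbert space, which is reduced to the line one
  functional at a time. No infinite tensors or vector-valued integrals occur: f and g are cut off in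
  degree and index, the covariance is approximated by Riemann sums of finite rank, and limits are
  taken in scalar inequalities whose bounds do not depend on the cut-off. The Hoelder condition on
  [0, 2 pi) permits a jump of E at the point 1; sampling at left end points keeps every arc clear of
  it. The k! of Wick's formula would ruin the series in k; the weight k! in \<open>Ynorm\<close> is
  there to absorb it.\<close>

definition wlists :: "'a set \<Rightarrow> nat \<Rightarrow> 'a list set" where
  "wlists F k = {xs. set xs \<subseteq> F \<and> length xs = k}"

lemma wlists_0 [simp]: "wlists F 0 = {[]}"
  by (auto simp: wlists_def)

lemma finite_wlists: "finite F \<Longrightarrow> finite (wlists F k)"
  unfolding wlists_def by (rule finite_lists_length_eq)

lemma wlists_length: "xs \<in> wlists F k \<Longrightarrow> length xs = k"
  by (simp add: wlists_def)

lemma wlists_mono: "F \<subseteq> G \<Longrightarrow> wlists F k \<subseteq> wlists G k"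
  by (auto simp: wlists_def)

lemma sum_wlists_Suc:
  fixes h :: "'a list \<Rightarrow> 'b::comm_monoid_add"
  assumes "finite F"
  shows "(\<Sum>xs\<in>wlists F (Suc k). h xs) = (\<Sum>x\<in>F. \<Sum>xs\<in>wlists F k. h (x # xs))"
proof -
  have eq: "wlists F (Suc k) = (\<lambda>(x, xs). x # xs) ` (F \<times> wlists F k)"
    by (auto simp: wlists_def length_Suc_conv image_iff)
  show ?thesis
    unfolding eq
    by (subst sum.reindex)
       (auto simp: inj_on_def sum.cartesian_product assms intro!: sum.cong)
qed

lemma prod_sum_wlists:
  fixes h :: "nat \<Rightarrow> 'a \<Rightarrow> 'b::comm_semiring_1"
  assumes "finite F"
  shows "(\<Prod>l<k. \<Sum>x\<in>F. h l x) = (\<Sum>xs\<in>wlists F k. \<Prod>l<k. h l (xs ! l))"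
proof (induction k arbitrary: h)
  case (Suc k)
  have "(\<Prod>l<Suc k. \<Sum>x\<in>F. h l x) = (\<Sum>x\<in>F. h 0 x) * (\<Prod>l<k. \<Sum>x\<in>F. h (Suc l) x)"
    by (rule prod.lessThan_Suc_shift)
  also have "\<dots> = (\<Sum>x\<in>F. \<Sum>xs\<in>wlists F k. h 0 x * (\<Prod>l<k. h (Suc l) (xs ! l)))"
    by (simp add: Suc.IH sum_product)
  also have "\<dots> = (\<Sum>xs\<in>wlists F (Suc k). \<Prod>l<Suc k. h l (xs ! l))"
    by (simp add: sum_wlists_Suc assms prod.lessThan_Suc_shift del: prod.lessThan_Suc)
  finally show ?case .
qed simp

text \<open>Each of the k+1 positions of a list may be the one deleted, and \<open>H\<close> sees
  the rest only as a multiset, so every position contributes the same amount. Iterated, this count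
  produces the k! in Wick's formula.\<close>

lemma sum_wlists_remove_one:
  fixes H :: "'a \<Rightarrow> 'a multiset \<Rightarrow> real"
  assumes "finite F"
  shows "(\<Sum>j\<in>wlists F (Suc k). \<Sum>c\<in>#mset j. H c (mset j - {#c#}))
       = real (Suc k) * (\<Sum>c\<in>F. \<Sum>j\<in>wlists F k. H c (mset j))"
proof (induction k arbitrary: H)
  case 0
  then show ?case by (simp add: sum_wlists_Suc assms)
next
  case (Suc k)
  have 1: "(\<Sum>c\<in>#mset (d # j). H c (mset (d # j) - {#c#}))
     = H d (mset j) + (\<Sum>c\<in>#mset j. H c (add_mset d (mset j - {#c#})))" for d j
  proof -
    have "image_mset (\<lambda>c. H c (add_mset d (mset j) - {#c#})) (mset j)
        = image_mset (\<lambda>c. H c (add_mset d (mset j - {#c#}))) (mset j)"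
      by (rule image_mset_cong) (metis diff_union_swap2)
    then show ?thesis by simp
  qed
  have "(\<Sum>j\<in>wlists F (Suc (Suc k)). \<Sum>c\<in>#mset j. H c (mset j - {#c#}))
      = (\<Sum>d\<in>F. \<Sum>j\<in>wlists F (Suc k). H d (mset j))
       + (\<Sum>d\<in>F. \<Sum>j\<in>wlists F (Suc k). \<Sum>c\<in>#mset j. H c (add_mset d (mset j - {#c#})))"
    by (simp only: sum_wlists_Suc[OF assms, of _ "Suc k"] 1 sum.distrib)
  also have "(\<Sum>d\<in>F. \<Sum>j\<in>wlists F (Suc k). \<Sum>c\<in>#mset j. H c (add_mset d (mset j - {#c#})))
     = (\<Sum>d\<in>F. real (Suc k) * (\<Sum>c\<in>F. \<Sum>j\<in>wlists F k. H c (add_mset d (mset j))))"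
    by (simp only: Suc.IH[of "\<lambda>c M. H c (add_mset _ M)"])
  also have "\<dots> = real (Suc k) * (\<Sum>c\<in>F. \<Sum>d\<in>F. \<Sum>j\<in>wlists F k. H c (add_mset d (mset j)))"
    by (subst sum_distrib_left[symmetric], subst sum.swap) simp
  also have "(\<Sum>c\<in>F. \<Sum>d\<in>F. \<Sum>j\<in>wlists F k. H c (add_mset d (mset j)))
     = (\<Sum>c\<in>F. \<Sum>j\<in>wlists F (Suc k). H c (mset j))"
    by (simp add: sum_wlists_Suc assms)
  finally show ?case by (simp add: algebra_simps)
qed

section \<open>Random variables with all moments\<close>

text \<open>Asking for all moments at once gives a class closed under products as well as sums, so
  that integrability of Gaussian polynomials never has to be tracked exponent by exponent.\<close>

definition fin_moments :: "'a measure \<Rightarrow> ('a \<Rightarrow> real) \<Rightarrow> bool" where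
  "fin_moments M f \<longleftrightarrow> f \<in> borel_measurable M \<and> (\<forall>n. integrable M (\<lambda>x. \<bar>f x\<bar> ^ n))"

lemma fin_moments_measurable: "fin_moments M f \<Longrightarrow> f \<in> borel_measurable M"
  by (simp add: fin_moments_def)

lemma fin_moments_power_integrable:
  assumes "fin_moments M f" shows "integrable M (\<lambda>x. f x ^ n)"
proof (rule Bochner_Integration.integrable_bound)
  show "integrable M (\<lambda>x. \<bar>f x\<bar> ^ n)" using assms by (simp add: fin_moments_def)
  show "(\<lambda>x. f x ^ n) \<in> borel_measurable M"
    using assms by (auto simp: fin_moments_def)
qed (simp add: power_abs)

lemma fin_moments_integrable: "fin_moments M f \<Longrightarrow> integrable M f"
  using fin_moments_power_integrable[of M f 1] by simp

lemma fin_moments_mult: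
  assumes "fin_moments M f" "fin_moments M g"
  shows "fin_moments M (\<lambda>x. f x * g x)"
  unfolding fin_moments_def
proof (intro conjI allI)
  have [measurable]: "f \<in> borel_measurable M" "g \<in> borel_measurable M"
    using assms by (auto simp: fin_moments_def)
  show "(\<lambda>x. f x * g x) \<in> borel_measurable M" by measurable
  fix n
  show "integrable M (\<lambda>x. \<bar>f x * g x\<bar> ^ n)"
  proof (rule Bochner_Integration.integrable_bound)
    show "integrable M (\<lambda>x. \<bar>f x\<bar> ^ (2*n) + \<bar>g x\<bar> ^ (2*n))"
      using assms by (simp add: fin_moments_def)
    have "\<bar>f x * g x\<bar> ^ n \<le> \<bar>f x\<bar> ^ (2*n) + \<bar>g x\<bar> ^ (2*n)" for x
    proof -
      have "0 \<le> (\<bar>f x\<bar>^n - \<bar>g x\<bar>^n)\<^sup>2" by simp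
      moreover have "(\<bar>f x\<bar>^n - \<bar>g x\<bar>^n)\<^sup>2 = \<bar>f x\<bar> ^ (2*n) + \<bar>g x\<bar> ^ (2*n) - 2 * \<bar>f x * g x\<bar> ^ n"
        by (simp add: power2_diff power_mult_distrib abs_mult power_mult[symmetric] mult.commute)
      moreover have "0 \<le> \<bar>f x * g x\<bar> ^ n" by simp
      ultimately show ?thesis by linarith
    qed
    then show "AE x in M. norm (\<bar>f x * g x\<bar> ^ n) \<le> norm (\<bar>f x\<bar> ^ (2*n) + \<bar>g x\<bar> ^ (2*n))"
      by (intro AE_I2) simp
  qed measurable
qed

lemma fin_moments_add:
  assumes "fin_moments M f" "fin_moments M g"
  shows "fin_moments M (\<lambda>x. f x + g x)"
  unfolding fin_moments_def
proof (intro conjI allI)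
  have [measurable]: "f \<in> borel_measurable M" "g \<in> borel_measurable M"
    using assms by (auto simp: fin_moments_def)
  show "(\<lambda>x. f x + g x) \<in> borel_measurable M" by measurable
  fix n
  show "integrable M (\<lambda>x. \<bar>f x + g x\<bar> ^ n)"
  proof (rule Bochner_Integration.integrable_bound)
    show "integrable M (\<lambda>x. 2^n * (\<bar>f x\<bar> ^ n + \<bar>g x\<bar> ^ n))"
      using assms by (simp add: fin_moments_def)
    have "\<bar>f x + g x\<bar> ^ n \<le> 2^n * (\<bar>f x\<bar> ^ n + \<bar>g x\<bar> ^ n)" for x
    proof -
      have "\<bar>f x + g x\<bar> ^ n \<le> (2 * max \<bar>f x\<bar> \<bar>g x\<bar>) ^ n"
        by (intro power_mono) auto
      also have "\<dots> = 2^n * (max \<bar>f x\<bar> \<bar>g x\<bar>) ^ n" by (simp add: power_mult_distrib)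
      also have "(max \<bar>f x\<bar> \<bar>g x\<bar>) ^ n \<le> \<bar>f x\<bar> ^ n + \<bar>g x\<bar> ^ n"
        by (cases "\<bar>f x\<bar> \<le> \<bar>g x\<bar>") (auto simp: max_def)
      finally show ?thesis by simp
    qed
    then show "AE x in M. norm (\<bar>f x + g x\<bar> ^ n) \<le> norm (2^n * (\<bar>f x\<bar> ^ n + \<bar>g x\<bar> ^ n))"
      by (intro AE_I2) simp
  qed measurable
qed

lemma fin_moments_cmult:
  assumes "fin_moments M f" shows "fin_moments M (\<lambda>x. c * f x)"
  using assms by (auto simp: fin_moments_def abs_mult power_mult_distrib)

lemma (in finite_measure) fin_moments_const: "fin_moments M (\<lambda>x. c)"
  by (auto simp: fin_moments_def)

lemma (in finite_measure) fin_moments_power: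
  assumes "fin_moments M f" shows "fin_moments M (\<lambda>x. f x ^ n)"
  by (induction n) (auto simp: fin_moments_const intro: fin_moments_mult[OF assms])

definition mprod :: "('a \<Rightarrow> real) multiset \<Rightarrow> 'a \<Rightarrow> real" where
  "mprod B x = (\<Prod>b\<in>#B. b x)"

lemma mprod_empty [simp]: "mprod {#} = (\<lambda>x. 1)"
  by (simp add: mprod_def fun_eq_iff)

lemma mprod_add [simp]: "mprod (add_mset b B) = (\<lambda>x. b x * mprod B x)"
  by (simp add: mprod_def fun_eq_iff)

lemma (in finite_measure) fin_moments_mprod:
  assumes "\<And>b. b \<in># B \<Longrightarrow> fin_moments M b" shows "fin_moments M (mprod B)"
  using assms by (induction B) (auto simp: fin_moments_const intro!: fin_moments_mult)

lemma DERIV_sum_mset: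
  fixes f :: "'b \<Rightarrow> real \<Rightarrow> real"
  assumes "\<And>b. b \<in># B \<Longrightarrow> DERIV (f b) x :> f' b"
  shows "DERIV (\<lambda>t. \<Sum>b\<in>#B. f b t) x :> (\<Sum>b\<in>#B. f' b)"
  using assms by (induction B) (auto intro!: DERIV_add)

text \<open>The integral is a polynomial in t by the binomial formula, so no differentiation under
  the integral sign is involved. This is the tool for polarisation: one factor Y of a power is
  exchanged for a factor Z.\<close>

lemma (in finite_measure) DERIV_moment:
  assumes "fin_moments M Y" "fin_moments M Z" "fin_moments M R"
  shows "DERIV (\<lambda>t. \<integral>x. (Y x + t * Z x) ^ p * R x \<partial>M) 0 :> real p * (\<integral>x. Y x ^ (p - 1) * (Z x * R x) \<partial>M)"
proof -
  define c where "c k = real (p choose k) * (\<integral>x. Y x ^ (p - k) * (Z x ^ k * R x) \<partial>M)" for k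
  have int: "integrable M (\<lambda>x. Y x ^ (p - k) * (Z x ^ k * R x))" for k
    by (intro fin_moments_integrable fin_moments_mult fin_moments_power assms)
  have eq: "(\<integral>x. (Y x + t * Z x) ^ p * R x \<partial>M) = (\<Sum>k\<le>p. c k * t ^ k)" for t
  proof -
    have "(Y x + t * Z x) ^ p * R x = (\<Sum>k\<le>p. real (p choose k) * t ^ k * (Y x ^ (p - k) * (Z x ^ k * R x)))" for x
      by (subst add.commute, subst binomial_ring)
         (simp add: sum_distrib_right sum_distrib_left power_mult_distrib mult_ac)
    then have "(\<integral>x. (Y x + t * Z x) ^ p * R x \<partial>M)
      = (\<integral>x. (\<Sum>k\<le>p. real (p choose k) * t ^ k * (Y x ^ (p - k) * (Z x ^ k * R x))) \<partial>M)"
      by simp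
    also have "\<dots> = (\<Sum>k\<le>p. real (p choose k) * t ^ k * (\<integral>x. Y x ^ (p - k) * (Z x ^ k * R x) \<partial>M))"
      by (subst Bochner_Integration.integral_sum) (auto intro!: int)
    finally show ?thesis by (simp add: c_def mult_ac)
  qed
  have "DERIV (\<lambda>t. \<Sum>k\<le>p. c k * t ^ k) 0 :> (\<Sum>k\<le>p. c k * (real k * 0 ^ (k - 1)))"
    by (auto intro!: derivative_eq_intros sum.cong)
  \<comment> \<open>At \<open>k = 0\<close> the factor \<open>real k\<close> vanishes, at
    \<open>k = 1\<close> the power is \<open>0 ^ 0 = 1\<close>, and all further powers are
    zero.\<close>
  also have "(\<Sum>k\<le>p. c k * (real k * 0 ^ (k - 1))) = (\<Sum>k\<le>p. if k = 1 then c k else 0)"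
    by (rule sum.cong) (auto simp: power_0_left)
  also have "\<dots> = real p * (\<integral>x. Y x ^ (p - 1) * (Z x * R x) \<partial>M)"
    by (cases p) (auto simp: c_def)
  finally show ?thesis by (simp only: eq)
qed

section \<open>Gaussian spaces and Isserlis' formula\<close>

text \<open>Joint Gaussianity is encoded by closure under linear combinations together with the
  characteristic function at the single point 1; \<open>V_scale\<close> supplies the other points.
  Variance 0 is allowed, as in the degenerate case of
  \<open>complex_symmetric_gaussian\<close>.\<close>

locale gaussian_space = prob_space M for M :: "'a measure" +
  fixes V :: "('a \<Rightarrow> real) set"
  assumes V_meas: "X \<in> V \<Longrightarrow> X \<in> borel_measurable M"
    and V_sq: "X \<in> V \<Longrightarrow> integrable M (\<lambda>x. (X x)\<^sup>2)"
    and V_char: "X \<in> V \<Longrightarrow> (\<integral>x. iexp (X x) \<partial>M) = exp (- complex_of_real (\<integral>x. (X x)\<^sup>2 \<partial>M) / 2)"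
    and V_add: "X \<in> V \<Longrightarrow> Y \<in> V \<Longrightarrow> (\<lambda>x. X x + Y x) \<in> V"
    and V_scale: "X \<in> V \<Longrightarrow> (\<lambda>x. c * X x) \<in> V"
begin

definition Q :: "('a \<Rightarrow> real) \<Rightarrow> ('a \<Rightarrow> real) \<Rightarrow> real" where
  "Q X Y = (\<integral>x. X x * Y x \<partial>M)"

definition mom :: "('a \<Rightarrow> real) multiset \<Rightarrow> real" where
  "mom B = (\<integral>x. mprod B x \<partial>M)"

text \<open>The n-th moment of the standard normal law, that is (n - 1)!! for even n.\<close>

definition gmom :: "nat \<Rightarrow> real" where
  "gmom n = (if even n then fact n / (2 ^ (n div 2) * fact (n div 2)) else 0)"

lemma distr_std:
  assumes "X \<in> V" "(\<integral>x. (X x)\<^sup>2 \<partial>M) = 1"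
  shows "distr M borel X = std_normal_distribution"
proof (rule Levy_uniqueness)
  note [measurable] = V_meas[OF assms(1)]
  show "real_distribution (distr M borel X)"
    by (simp add: real_distribution_distr)
  show "real_distribution std_normal_distribution"
    by (rule real_dist_normal_dist)
  show "char (distr M borel X) = char std_normal_distribution"
  proof
    fix t
    have "char (distr M borel X) t = (\<integral>x. iexp (t * X x) \<partial>M)"
      unfolding char_def by (subst integral_distr) auto
    also have "\<dots> = exp (- complex_of_real (\<integral>x. (t * X x)\<^sup>2 \<partial>M) / 2)"
      using V_char[OF V_scale[OF assms(1)], of t] by simp
    also have "(\<integral>x. (t * X x)\<^sup>2 \<partial>M) = t\<^sup>2"
      by (simp add: power_mult_distrib assms)
    finally show "char (distr M borel X) t = char std_normal_distribution t"
      by (simp add: char_std_normal_distribution exp_of_real[symmetric])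
  qed
qed

lemma std_moments:
  "integrable std_normal_distribution (\<lambda>x. \<bar>x\<bar>^n)"
  "(\<integral>x. x^n \<partial>std_normal_distribution) = gmom n"
proof -
  show "integrable std_normal_distribution (\<lambda>x. \<bar>x\<bar>^n)"
    using integrable_std_normal_moment_abs[of n] by (subst integrable_density) auto
  show "(\<integral>x. x^n \<partial>std_normal_distribution) = gmom n"
  proof (cases "even n")
    case True
    then obtain k where "n = 2 * k" by auto
    then show ?thesis using std_normal_distribution_even_moments(1)[of k] by (simp add: gmom_def)
  next
    case False
    then obtain k where n: "n = 2 * k + 1" by (auto elim: oddE)
    show ?thesis using integral_std_normal_distribution_moment_odd[of n] False by (simp add: gmom_def)
  qed
qed

lemma V_AE_0:
  assumes "X \<in> V" "(\<integral>x. (X x)\<^sup>2 \<partial>M) = 0" shows "AE x in M. X x = 0"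
proof -
  have "AE x in M. (X x)\<^sup>2 = 0"
    using integral_nonneg_eq_0_iff_AE[OF V_sq[OF assms(1)]] assms(2) by simp
  then show ?thesis by simp
qed

text \<open>A member with positive variance is rescaled to variance 1, where its law is standard
  normal; with variance 0 it vanishes almost everywhere and only the moment of order 0
  survives.\<close>

lemma V_moments:
  assumes "X \<in> V"
  shows "fin_moments M X" "(\<integral>x. X x ^ n \<partial>M) = gmom n * sqrt (\<integral>x. (X x)\<^sup>2 \<partial>M) ^ n"
proof -
  note [measurable] = V_meas[OF assms(1)]
  let ?v = "\<integral>x. (X x)\<^sup>2 \<partial>M"
  have "fin_moments M X \<and> (\<forall>n. (\<integral>x. X x ^ n \<partial>M) = gmom n * sqrt ?v ^ n)"
  proof (cases "?v = 0")
    case True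
    note ae = V_AE_0[OF assms True]
    have int: "integrable M (\<lambda>x. \<bar>X x\<bar>^n)" for n
    proof -
      have "integrable M (\<lambda>x. \<bar>X x\<bar>^n) \<longleftrightarrow> integrable M (\<lambda>x. (0::real)^n)"
        by (rule integrable_cong_AE) (use ae in auto)
      then show ?thesis by simp
    qed
    have "fin_moments M X" using int by (simp add: fin_moments_def)
    moreover have "(\<integral>x. X x ^ n \<partial>M) = gmom n * sqrt ?v ^ n" for n
    proof -
      have "(\<integral>x. X x ^ n \<partial>M) = (\<integral>x. 0 ^ n \<partial>M)"
        by (rule integral_cong_AE) (use ae in auto)
      then show ?thesis using True by (cases n) (auto simp: gmom_def prob_space)
    qed
    ultimately show ?thesis by blast
  next
    case False
    have pos: "?v > 0" using False by (simp add: less_le)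
    define Z where "Z = (\<lambda>x. (1 / sqrt ?v) * X x)"
    have ZV: "Z \<in> V" unfolding Z_def by (rule V_scale[OF assms])
    note [measurable] = V_meas[OF ZV]
    have Z1: "(\<integral>x. (Z x)\<^sup>2 \<partial>M) = 1"
      using pos by (simp add: Z_def power_mult_distrib power_divide)
    have XZ: "X x = sqrt ?v * Z x" for x using pos by (simp add: Z_def)
    have "integrable M (\<lambda>x. \<bar>Z x\<bar>^n)" for n
      using std_moments(1)[of n] distr_std[OF ZV Z1]
        integrable_distr_eq[of Z M borel "\<lambda>x. \<bar>x\<bar>^n"] by simp
    moreover have "(\<integral>x. Z x ^ n \<partial>M) = gmom n" for n
      using std_moments(2)[of n] distr_std[OF ZV Z1]
        integral_distr[of Z M borel "\<lambda>x. x^n"] by simp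
    ultimately have mZ: "\<And>n. (\<integral>x. Z x ^ n \<partial>M) = gmom n" and "fin_moments M Z"
      unfolding fin_moments_def by auto
    then have "fin_moments M (\<lambda>x. sqrt ?v * Z x)" by (intro fin_moments_cmult)
    then have "fin_moments M X" by (simp only: XZ[symmetric])
    moreover have "(\<integral>x. X x ^ n \<partial>M) = gmom n * sqrt ?v ^ n" for n
    proof -
      have "(\<integral>x. X x ^ n \<partial>M) = (\<integral>x. sqrt ?v ^ n * Z x ^ n \<partial>M)"
        by (rule Bochner_Integration.integral_cong) (simp_all add: XZ[symmetric] power_mult_distrib[symmetric])
      then show ?thesis by (simp add: mZ)
    qed
    ultimately show ?thesis by blast
  qed
  then show "fin_moments M X" "(\<integral>x. X x ^ n \<partial>M) = gmom n * sqrt ?v ^ n" by blast+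
qed

lemma V_fin_moments: "X \<in> V \<Longrightarrow> fin_moments M X"
  by (rule V_moments)

lemma mprod_fin_moments: "set_mset B \<subseteq> V \<Longrightarrow> fin_moments M (mprod B)"
  by (rule fin_moments_mprod) (auto intro: V_fin_moments)

lemma Q_add_scale:
  assumes "X \<in> V" "Y \<in> V" "Z \<in> V"
  shows "Q X (\<lambda>x. Y x + t * Z x) = Q X Y + t * Q X Z"
proof -
  have "integrable M (\<lambda>x. X x * Y x)" "integrable M (\<lambda>x. t * (X x * Z x))"
    by (intro fin_moments_integrable fin_moments_mult fin_moments_cmult V_fin_moments assms)+
  then show ?thesis by (simp add: Q_def algebra_simps)
qed

lemma gmom_rec: "gmom (2 * Suc q) = real (2 * q + 1) * gmom (2 * q)"
proof -
  have "fact (2 * Suc q) = real (2 * q + 2) * real (2 * q + 1) * fact (2 * q)" by simp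
  moreover have "2 ^ Suc q * fact (Suc q) = real (2 * q + 2) * (2 ^ q * fact q)" by (simp add: algebra_simps)
  ultimately have "gmom (2 * Suc q) = (real (2 * q + 2) * (real (2 * q + 1) * fact (2 * q))) / (real (2 * q + 2) * (2 ^ q * fact q))"
    unfolding gmom_def by (simp only: even_mult_iff even_numeral if_True nonzero_mult_div_cancel_left mult.assoc) simp
  then have "gmom (2 * Suc q) = (real (2 * q + 1) * fact (2 * q)) / (2 ^ q * fact q)"
    by (subst (asm) mult_divide_mult_cancel_left) simp_all
  then show ?thesis unfolding gmom_def by simp
qed

text \<open>The moment formula for \<open>Y + t * X\<close> holds for every t, and comparing
  derivatives at t = 0 gives the identity. Linear closure of \<open>V\<close> is what brings the
  joint law into play.\<close>

lemma moment_power: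
  assumes X: "X \<in> V" and Y: "Y \<in> V"
  shows "(\<integral>x. Y x ^ p * X x \<partial>M) = real p * Q X Y * (\<integral>x. Y x ^ (p - 1) \<partial>M)"
proof -
  define v where "v t = Q Y Y + t * (2 * Q X Y) + t\<^sup>2 * Q X X" for t
  have v: "(\<integral>x. (Y x + t * X x)\<^sup>2 \<partial>M) = v t" for t
  proof -
    have i: "integrable M (\<lambda>x. Y x * Y x)" "integrable M (\<lambda>x. t * 2 * (X x * Y x))" "integrable M (\<lambda>x. t\<^sup>2 * (X x * X x))"
      by (intro fin_moments_integrable fin_moments_mult fin_moments_cmult V_fin_moments assms)+
    have "(\<integral>x. (Y x + t * X x)\<^sup>2 \<partial>M) = (\<integral>x. Y x * Y x + t * 2 * (X x * Y x) + t\<^sup>2 * (X x * X x) \<partial>M)"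
      by (simp add: power2_eq_square algebra_simps)
    also have "\<dots> = v t"
      unfolding v_def Q_def using i by (subst Bochner_Integration.integral_add) auto
    finally show ?thesis .
  qed
  have YX: "(\<lambda>x. Y x + t * X x) \<in> V" for t by (intro V_add V_scale X Y)
  have f: "(\<integral>x. (Y x + t * X x) ^ Suc p * 1 \<partial>M) = gmom (Suc p) * sqrt (v t) ^ Suc p" for t
    using V_moments(2)[OF YX, of t "Suc p"] by (simp add: v)
  have "DERIV (\<lambda>t. \<integral>x. (Y x + t * X x) ^ Suc p * 1 \<partial>M) 0 :> real (Suc p) * (\<integral>x. Y x ^ (Suc p - 1) * (X x * 1) \<partial>M)"
    by (rule DERIV_moment) (auto intro: V_fin_moments X Y fin_moments_const)
  then have D1: "DERIV (\<lambda>t. gmom (Suc p) * sqrt (v t) ^ Suc p) 0 :> real (Suc p) * (\<integral>x. Y x ^ p * X x \<partial>M)"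
    by (simp only: f) simp
  have v0: "v 0 = (\<integral>x. (Y x)\<^sup>2 \<partial>M)" using v[of 0] by simp
  show ?thesis
  \<comment> \<open>For even p the exponent \<open>Suc p\<close> is odd and both sides vanish. For
    odd p the square root disappears from \<open>sqrt (v t) ^ Suc p\<close>, so this function is
    differentiable even where \<open>v 0 = 0\<close>.\<close>
  proof (cases "odd p")
    case False
    then have "gmom (Suc p) = 0" by (simp add: gmom_def)
    with D1 have "DERIV (\<lambda>t. 0::real) 0 :> real (Suc p) * (\<integral>x. Y x ^ p * X x \<partial>M)" by simp
    from DERIV_unique[OF this DERIV_const] have "(\<integral>x. Y x ^ p * X x \<partial>M) = 0" by simp
    moreover have "real p * (\<integral>x. Y x ^ (p - 1) \<partial>M) = 0"
      using False V_moments(2)[OF Y, of "p - 1"] by (cases "p = 0") (auto simp: gmom_def)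
    ultimately have "(\<integral>x. Y x ^ p * X x \<partial>M) = Q X Y * (real p * (\<integral>x. Y x ^ (p - 1) \<partial>M))" by simp
    then show ?thesis by (simp only: mult_ac)
  next
    case True
    then obtain q where p: "p = 2 * q + 1" by (auto elim: oddE)
    have vnn: "v t \<ge> 0" for t unfolding v[symmetric] by simp
    have sq: "sqrt (v t) ^ Suc p = v t ^ Suc q" for t
    proof -
      have "Suc p = 2 * Suc q" using p by simp
      then show ?thesis using vnn[of t] by (simp only: power_mult real_sqrt_pow2)
    qed
    have "DERIV v 0 :> 2 * Q X Y"
      unfolding v_def[abs_def] by (auto intro!: derivative_eq_intros)
    from DERIV_cmult[OF DERIV_power[OF this, of "Suc q"], of "gmom (Suc p)"]
    have "DERIV (\<lambda>t. gmom (Suc p) * v t ^ Suc q) 0 :> gmom (Suc p) * (real (Suc q) * v 0 ^ q * (2 * Q X Y))"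
      by (simp add: mult_ac)
    with D1 have "real (Suc p) * (\<integral>x. Y x ^ p * X x \<partial>M) = gmom (Suc p) * (real (Suc q) * v 0 ^ q * (2 * Q X Y))"
      unfolding sq by (rule DERIV_unique)
    also have "\<dots> = real (Suc p) * (gmom (Suc p) * v 0 ^ q * Q X Y)" by (simp add: p)
    finally have "(\<integral>x. Y x ^ p * X x \<partial>M) = gmom (Suc p) * v 0 ^ q * Q X Y" by (simp only: mult_cancel_left) simp
    moreover have "gmom (Suc p) = real p * gmom (2 * q)" using gmom_rec[of q] p by simp
    moreover have "(\<integral>x. Y x ^ (p - 1) \<partial>M) = gmom (2 * q) * v 0 ^ q"
      using V_moments(2)[OF Y, of "p - 1"] vnn[of 0] by (simp add: p v0[symmetric] power_mult)
    ultimately show ?thesis by simp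
  qed
qed

text \<open>Gaussian integration by parts for a product. The extra power of Y is there for the
  induction: a further factor Z comes from the case \<open>Suc p\<close> with
  \<open>Y + t * Z\<close> in place of Y, by differentiating at t = 0, after which the factor
  \<open>Suc p\<close> cancels.\<close>

lemma isserlis_power:
  assumes "set_mset B \<subseteq> V" "X \<in> V" "Y \<in> V"
  shows "(\<integral>x. Y x ^ p * (X x * mprod B x) \<partial>M)
     = real p * Q X Y * (\<integral>x. Y x ^ (p - 1) * mprod B x \<partial>M)
       + (\<Sum>b\<in>#B. Q X b * (\<integral>x. Y x ^ p * mprod (B - {#b#}) x \<partial>M))"
  using assms
proof (induction B arbitrary: X Y p)
  case empty
  then show ?case using moment_power[of X Y p] by simp
next
  case (add Z B)
  then have B: "set_mset B \<subseteq> V" and Z: "Z \<in> V" and X: "X \<in> V" and Y: "Y \<in> V" by auto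
  note fm = V_fin_moments[OF X] V_fin_moments[OF Y] V_fin_moments[OF Z] mprod_fin_moments[OF B]
  have Bb: "fin_moments M (mprod (B - {#b#}))" for b
    by (rule mprod_fin_moments) (use B in \<open>auto dest: in_diffD\<close>)
  have YZ: "(\<lambda>x. Y x + t * Z x) \<in> V" for t by (intro V_add V_scale Z Y)
  have id: "(\<integral>x. (Y x + t * Z x) ^ Suc p * (X x * mprod B x) \<partial>M)
     = real (Suc p) * (Q X Y + t * Q X Z) * (\<integral>x. (Y x + t * Z x) ^ p * mprod B x \<partial>M)
       + (\<Sum>b\<in>#B. Q X b * (\<integral>x. (Y x + t * Z x) ^ Suc p * mprod (B - {#b#}) x \<partial>M))" for t
    using add.IH[OF B X YZ[of t], of "Suc p"] by (simp only: Q_add_scale[OF X Y Z] diff_Suc_1)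
  have L: "DERIV (\<lambda>t. \<integral>x. (Y x + t * Z x) ^ Suc p * (X x * mprod B x) \<partial>M) 0
      :> real (Suc p) * (\<integral>x. Y x ^ p * (Z x * (X x * mprod B x)) \<partial>M)"
    using DERIV_moment[of Y Z "\<lambda>x. X x * mprod B x" "Suc p"] fm by (simp add: fin_moments_mult)
  have R1: "DERIV (\<lambda>t. \<integral>x. (Y x + t * Z x) ^ p * mprod B x \<partial>M) 0 :> real p * (\<integral>x. Y x ^ (p - 1) * (Z x * mprod B x) \<partial>M)"
    by (rule DERIV_moment) (use fm in auto)
  have R2: "DERIV (\<lambda>t. \<Sum>b\<in>#B. Q X b * (\<integral>x. (Y x + t * Z x) ^ Suc p * mprod (B - {#b#}) x \<partial>M)) 0
     :> (\<Sum>b\<in>#B. Q X b * (real (Suc p) * (\<integral>x. Y x ^ p * (Z x * mprod (B - {#b#}) x) \<partial>M)))"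
  proof (intro DERIV_sum_mset DERIV_cmult)
    fix b
    show "DERIV (\<lambda>t. \<integral>x. (Y x + t * Z x) ^ Suc p * mprod (B - {#b#}) x \<partial>M) 0
       :> real (Suc p) * (\<integral>x. Y x ^ p * (Z x * mprod (B - {#b#}) x) \<partial>M)"
      using DERIV_moment[OF fm(2) fm(3) Bb, of "Suc p"] by simp
  qed
  have R0: "DERIV (\<lambda>t. real (Suc p) * (Q X Y + t * Q X Z)) 0 :> real (Suc p) * Q X Z"
    by (auto intro!: derivative_eq_intros)
  have "real (Suc p) * (\<integral>x. Y x ^ p * (Z x * (X x * mprod B x)) \<partial>M)
     = real (Suc p) * Q X Z * (\<integral>x. (Y x + 0 * Z x) ^ p * mprod B x \<partial>M)
       + real p * (\<integral>x. Y x ^ (p - 1) * (Z x * mprod B x) \<partial>M) * (real (Suc p) * (Q X Y + 0 * Q X Z))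
       + (\<Sum>b\<in>#B. Q X b * (real (Suc p) * (\<integral>x. Y x ^ p * (Z x * mprod (B - {#b#}) x) \<partial>M)))"
    using L unfolding id by (rule DERIV_unique) (rule DERIV_add[OF DERIV_mult[OF R0 R1] R2])
  also have "(\<Sum>b\<in>#B. Q X b * (real (Suc p) * (\<integral>x. Y x ^ p * (Z x * mprod (B - {#b#}) x) \<partial>M)))
     = real (Suc p) * (\<Sum>b\<in>#B. Q X b * (\<integral>x. Y x ^ p * mprod (add_mset Z B - {#b#}) x \<partial>M))"
    unfolding sum_mset_distrib_left
    by (rule arg_cong[where f=sum_mset], rule image_mset_cong) (simp add: mult_ac diff_union_swap2)
  finally have "real (Suc p) * (\<integral>x. Y x ^ p * (Z x * (X x * mprod B x)) \<partial>M)
     = real (Suc p) * (Q X Z * (\<integral>x. Y x ^ p * mprod B x \<partial>M)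
       + real p * Q X Y * (\<integral>x. Y x ^ (p - 1) * (Z x * mprod B x) \<partial>M)
       + (\<Sum>b\<in>#B. Q X b * (\<integral>x. Y x ^ p * mprod (add_mset Z B - {#b#}) x \<partial>M)))"
    by (simp add: algebra_simps)
  then have "(\<integral>x. Y x ^ p * (Z x * (X x * mprod B x)) \<partial>M)
     = Q X Z * (\<integral>x. Y x ^ p * mprod B x \<partial>M)
       + real p * Q X Y * (\<integral>x. Y x ^ (p - 1) * (Z x * mprod B x) \<partial>M)
       + (\<Sum>b\<in>#B. Q X b * (\<integral>x. Y x ^ p * mprod (add_mset Z B - {#b#}) x \<partial>M))"
    by (simp only: mult_cancel_left) simp
  then show ?case by (simp add: mult_ac)
qed

lemma mom_add_mset:
  assumes "set_mset B \<subseteq> V" "X \<in> V"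
  shows "mom (add_mset X B) = (\<Sum>b\<in>#B. Q X b * mom (B - {#b#}))"
  using isserlis_power[OF assms(1,2,2), of 0] by (simp add: mom_def)

section \<open>Wick products and Wick's formula\<close>

definition eps :: "nat \<Rightarrow> real" where
  "eps n = (if even n then (-1) ^ (n div 2) else 0)"

lemma eps_simps [simp]: "eps 0 = 1" "eps (Suc (Suc n)) = - eps n"
  by (simp_all add: eps_def)

text \<open>\<open>wp Xs {#}\<close> is the Wick product of the list \<open>Xs\<close>: the expectation over an independent copy \<open>X'\<close>
  of the product of the \<open>X + \<i> X'\<close>. The multiset collects the factors taken from the copy, and \<open>eps n\<close>
  is the real part of \<open>\<i> ^ n\<close>.\<close>

primrec wp :: "('a \<Rightarrow> real) list \<Rightarrow> ('a \<Rightarrow> real) multiset \<Rightarrow> 'a \<Rightarrow> real" where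
  "wp [] B = (\<lambda>x. eps (size B) * mom B)"
| "wp (X # Xs) B = (\<lambda>x. wp Xs (add_mset X B) x + X x * wp Xs B x)"

text \<open>The expectation of the product of all \<open>X + i X'\<close> for X in
  \<open>Xs\<close>, all \<open>i b'\<close> for b in \<open>B\<close> and all c in
  \<open>C\<close>, where a prime denotes the independent copy.\<close>

definition Psi :: "('a \<Rightarrow> real) list \<Rightarrow> ('a \<Rightarrow> real) multiset \<Rightarrow> ('a \<Rightarrow> real) multiset \<Rightarrow> real" where
  "Psi Xs B C = (\<integral>x. wp Xs B x * mprod C x \<partial>M)"

lemma wp_fin_moments:
  assumes "set Xs \<subseteq> V" shows "fin_moments M (wp Xs B)"
  using assms
  by (induction Xs arbitrary: B)
     (simp_all add: fin_moments_const fin_moments_add fin_moments_mult V_fin_moments)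

lemma Psi_Nil: "Psi [] B C = eps (size B) * mom B * mom C"
  by (simp add: Psi_def mom_def)

lemma Psi_Cons:
  assumes "X \<in> V" "set Xs \<subseteq> V" "set_mset C \<subseteq> V"
  shows "Psi (X # Xs) B C = Psi Xs (add_mset X B) C + Psi Xs B (add_mset X C)"
proof -
  have "integrable M (\<lambda>x. wp Xs (add_mset X B) x * mprod C x)" "integrable M (\<lambda>x. X x * wp Xs B x * mprod C x)"
    by (intro fin_moments_integrable fin_moments_mult wp_fin_moments mprod_fin_moments V_fin_moments assms)+
  then show ?thesis by (simp add: Psi_def algebra_simps)
qed

lemma sum_mset_add_mset_diff:
  fixes f :: "'b \<Rightarrow> 'b multiset \<Rightarrow> real"
  shows "(\<Sum>c\<in>#add_mset Y C. f c (add_mset Y C - {#c#})) = f Y C + (\<Sum>c\<in>#C. f c (add_mset Y (C - {#c#})))"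
proof -
  have "image_mset (\<lambda>c. f c (add_mset Y C - {#c#})) C = image_mset (\<lambda>c. f c (add_mset Y (C - {#c#}))) C"
    by (rule image_mset_cong) (metis diff_union_swap2)
  then show ?thesis by simp
qed

text \<open>Integration by parts in an additional factor \<open>X + i X'\<close>: a pairing with c
  in \<open>C\<close> gives \<open>Q X c\<close>, a pairing with \<open>i b'\<close> gives
  \<open>- Q X b\<close>, and a pairing with another \<open>Y + i Y'\<close> gives
  \<open>Q X Y - Q X Y = 0\<close>. This cancellation is why a Wick product has no internal
  contractions.\<close>

lemma Psi_insert:
  assumes "X \<in> V" "set Xs \<subseteq> V" "set_mset B \<subseteq> V" "set_mset C \<subseteq> V"
  shows "Psi Xs (add_mset X B) C + Psi Xs B (add_mset X C)
     = (\<Sum>c\<in>#C. Q X c * Psi Xs B (C - {#c#})) - (\<Sum>b\<in>#B. Q X b * Psi Xs (B - {#b#}) C)"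
  using assms
proof (induction Xs arbitrary: B C)
  case Nil
  have "eps (Suc (size B)) * mom (add_mset X B) = - (\<Sum>b\<in>#B. Q X b * (eps (size (B - {#b#})) * mom (B - {#b#})))"
  proof -
    have "eps (Suc (size B)) * mom (add_mset X B) = (\<Sum>b\<in>#B. eps (Suc (size B)) * (Q X b * mom (B - {#b#})))"
      by (simp add: mom_add_mset Nil sum_mset_distrib_left)
    also have "\<dots> = (\<Sum>b\<in>#B. (-1) * (Q X b * (eps (size (B - {#b#})) * mom (B - {#b#}))))"
    proof (rule arg_cong[where f=sum_mset], rule image_mset_cong)
      fix b assume "b \<in># B"
      then have "Suc (size B) = Suc (Suc (size (B - {#b#})))"
        by (metis insert_DiffM size_add_mset)
      then show "eps (Suc (size B)) * (Q X b * mom (B - {#b#})) = (-1) * (Q X b * (eps (size (B - {#b#})) * mom (B - {#b#})))"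
        by (simp only: eps_simps) simp
    qed
    finally show ?thesis by (simp only: sum_mset_distrib_left[symmetric])
  qed
  moreover have "eps (size B) * mom B * mom (add_mset X C) = (\<Sum>c\<in>#C. Q X c * (eps (size B) * mom B * mom (C - {#c#})))"
    by (simp add: mom_add_mset Nil sum_mset_distrib_left mult_ac)
  moreover have "(\<Sum>b\<in>#B. Q X b * Psi [] (B - {#b#}) C)
     = (\<Sum>b\<in>#B. Q X b * (eps (size (B - {#b#})) * mom (B - {#b#}))) * mom C"
    by (simp only: Psi_Nil sum_mset_distrib_right mult.assoc)
  ultimately show ?case
    by (simp only: Psi_Nil size_add_mset)
next
  case (Cons Y Xs)
  have V: "Y \<in> V" "set Xs \<subseteq> V" "set_mset (add_mset Y B) \<subseteq> V" "set_mset (add_mset Y C) \<subseteq> V" "X \<in> V"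
    "set_mset B \<subseteq> V" "set_mset C \<subseteq> V" "set_mset (add_mset X C) \<subseteq> V"
    using Cons.prems by auto
  have Cc: "set_mset (C - {#c#}) \<subseteq> V" for c using V(7) by (auto dest: in_diffD)
  \<comment> \<open>Here Y has joined \<open>B\<close>, so its pairing with X enters with a minus
    sign; in the next identity Y has joined \<open>C\<close> and the same term enters with a plus
    sign. The two cancel in the sum.\<close>
  have 1: "Psi Xs (add_mset X (add_mset Y B)) C + Psi Xs (add_mset Y B) (add_mset X C)
     = (\<Sum>c\<in>#C. Q X c * Psi Xs (add_mset Y B) (C - {#c#}))
       - (Q X Y * Psi Xs B C + (\<Sum>b\<in>#B. Q X b * Psi Xs (add_mset Y (B - {#b#})) C))"
    using Cons.IH[of "add_mset Y B" C] V by (simp only: sum_mset_add_mset_diff[where f="\<lambda>b B. Q X b * Psi Xs B C"])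
  have 2: "Psi Xs (add_mset X B) (add_mset Y C) + Psi Xs B (add_mset X (add_mset Y C))
     = Q X Y * Psi Xs B C + (\<Sum>c\<in>#C. Q X c * Psi Xs B (add_mset Y (C - {#c#})))
       - (\<Sum>b\<in>#B. Q X b * Psi Xs (B - {#b#}) (add_mset Y C))"
    using Cons.IH[of B "add_mset Y C"] V by (simp only: sum_mset_add_mset_diff[where f="\<lambda>c C. Q X c * Psi Xs B C"])
  have 3: "(\<Sum>c\<in>#C. Q X c * Psi (Y # Xs) B (C - {#c#}))
     = (\<Sum>c\<in>#C. Q X c * Psi Xs (add_mset Y B) (C - {#c#})) + (\<Sum>c\<in>#C. Q X c * Psi Xs B (add_mset Y (C - {#c#})))"
    by (simp only: Psi_Cons[OF V(1,2) Cc] distrib_left sum_mset.distrib)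
  have 4: "(\<Sum>b\<in>#B. Q X b * Psi (Y # Xs) (B - {#b#}) C)
     = (\<Sum>b\<in>#B. Q X b * Psi Xs (add_mset Y (B - {#b#})) C) + (\<Sum>b\<in>#B. Q X b * Psi Xs (B - {#b#}) (add_mset Y C))"
    by (simp only: Psi_Cons[OF V(1,2,7)] distrib_left sum_mset.distrib)
  show ?case
    unfolding 3 4
    unfolding Psi_Cons[OF V(1,2,7)] Psi_Cons[OF V(1,2,8)] add_mset_commute[of Y X]
    using 1 2 by linarith
qed

lemma Psi_rec:
  assumes "X \<in> V" "set Xs \<subseteq> V" "set_mset C \<subseteq> V"
  shows "Psi (X # Xs) {#} C = (\<Sum>c\<in>#C. Q X c * Psi Xs {#} (C - {#c#}))"
  using Psi_insert[of X Xs "{#}" C] Psi_Cons[of X Xs C "{#}"] assms by simp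

text \<open>Each Wick factor has to be paired with its own element of \<open>C\<close>; if these are
  too few, some factor is left without a partner. This is the orthogonality of a Wick product to all
  products of lower degree.\<close>

lemma Psi_eq_0_size:
  assumes "set Xs \<subseteq> V" "set_mset C \<subseteq> V" "size C < length Xs"
  shows "Psi Xs {#} C = 0"
  using assms
proof (induction Xs arbitrary: C)
  case (Cons X Xs)
  have "image_mset (\<lambda>c. Q X c * Psi Xs {#} (C - {#c#})) C = image_mset (\<lambda>c. 0) C"
  proof (rule image_mset_cong)
    fix c assume "c \<in># C"
    then have "size (C - {#c#}) < length Xs"
      using Cons.prems(3) size_Diff1_less[of c C] by simp
    moreover have "set_mset (C - {#c#}) \<subseteq> V" using Cons.prems(2) by (auto dest: in_diffD)
    ultimately show "Q X c * Psi Xs {#} (C - {#c#}) = 0"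
      using Cons by simp
  qed
  then show ?case using Cons.prems by (simp add: Psi_rec)
qed simp

text \<open>Every complete pairing uses X and hence contains a vanishing covariance. It serves for
  indices of variance 0 in the chaos expansion.\<close>

lemma Psi_eq_0_degenerate:
  assumes "set Xs \<subseteq> V" "set_mset C \<subseteq> V" "X \<in> set Xs" "\<And>c. c \<in># C \<Longrightarrow> Q X c = 0"
  shows "Psi Xs {#} C = 0"
  using assms
proof (induction Xs arbitrary: C)
  case (Cons Y Xs)
  have "image_mset (\<lambda>c. Q Y c * Psi Xs {#} (C - {#c#})) C = image_mset (\<lambda>c. 0) C"
  proof (rule image_mset_cong)
    fix c assume c: "c \<in># C"
    have s: "set_mset (C - {#c#}) \<subseteq> V" using Cons.prems(2) by (auto dest: in_diffD)
    show "Q Y c * Psi Xs {#} (C - {#c#}) = 0"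
    proof (cases "Y = X")
      case True
      then show ?thesis using Cons.prems(4) c by simp
    next
      case False
      then have "Psi Xs {#} (C - {#c#}) = 0"
        using Cons.prems s by (intro Cons.IH) (auto dest: in_diffD)
      then show ?thesis by simp
    qed
  qed
  then show ?case using Cons.prems by (simp add: Psi_rec)
qed simp

text \<open>Wick's formula, with the sum over pairings absorbed by the symmetry of the coefficient.\<close>

lemma sum_symmetric_Psi:
  fixes b :: "'i multiset \<Rightarrow> real" and g :: "'i \<Rightarrow> 'a \<Rightarrow> real"
  assumes F: "finite F" and g: "\<And>i. i \<in> F \<Longrightarrow> g i \<in> V" and Xs: "set Xs \<subseteq> V" and k: "length Xs = k"
  shows "(\<Sum>j\<in>wlists F k. b (mset j) * Psi Xs {#} (mset (map g j)))
     = fact k * (\<Sum>j\<in>wlists F k. b (mset j) * (\<Prod>l<k. Q (Xs ! l) (g (j ! l))))"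
  using Xs k
proof (induction Xs arbitrary: b k)
  case Nil
  then show ?case by (simp add: Psi_Nil mom_def prob_space)
next
  case (Cons X Xs)
  then obtain k' where k: "k = Suc k'" "length Xs = k'" by auto
  have V: "X \<in> V" "set Xs \<subseteq> V" using Cons.prems by auto
  \<comment> \<open>The term in which X is matched with the index c, N being the multiset of indices
    left over. Because \<open>b\<close> depends only on the multiset, summing over the matched
    position just gives the factor k.\<close>
  define H where "H c N = b (add_mset c N) * (Q X (g c) * Psi Xs {#} (image_mset g N))" for c N
  have "(\<Sum>j\<in>wlists F k. b (mset j) * Psi (X # Xs) {#} (mset (map g j)))
      = (\<Sum>j\<in>wlists F k. \<Sum>c\<in>#mset j. H c (mset j - {#c#}))"
  proof (rule sum.cong)
    fix j assume j: "j \<in> wlists F k"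
    then have gj: "set_mset (image_mset g (mset j)) \<subseteq> V" using g by (auto simp: wlists_def)
    have "b (mset j) * Psi (X # Xs) {#} (mset (map g j))
       = (\<Sum>c\<in>#mset j. b (mset j) * (Q X (g c) * Psi Xs {#} (image_mset g (mset j) - {#g c#})))"
      by (simp add: Psi_rec[OF V gj] sum_mset_distrib_left image_mset.compositionality comp_def)
    also have "\<dots> = (\<Sum>c\<in>#mset j. H c (mset j - {#c#}))"
    proof (rule arg_cong[where f=sum_mset], rule image_mset_cong)
      fix c assume c: "c \<in># mset j"
      then show "b (mset j) * (Q X (g c) * Psi Xs {#} (image_mset g (mset j) - {#g c#})) = H c (mset j - {#c#})"
        unfolding H_def by (simp add: image_mset_Diff)
    qed
    finally show "b (mset j) * Psi (X # Xs) {#} (mset (map g j)) = (\<Sum>c\<in>#mset j. H c (mset j - {#c#}))" .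
  qed simp
  also have "\<dots> = real k * (\<Sum>c\<in>F. \<Sum>j\<in>wlists F k'. H c (mset j))"
    unfolding k by (rule sum_wlists_remove_one[OF F])
  also have "(\<Sum>c\<in>F. \<Sum>j\<in>wlists F k'. H c (mset j))
     = (\<Sum>c\<in>F. Q X (g c) * (\<Sum>j\<in>wlists F k'. b (add_mset c (mset j)) * Psi Xs {#} (mset (map g j))))"
    by (simp add: H_def sum_distrib_left mult_ac)
  also have "\<dots> = (\<Sum>c\<in>F. Q X (g c) * (fact k' * (\<Sum>j\<in>wlists F k'. b (add_mset c (mset j)) * (\<Prod>l<k'. Q (Xs ! l) (g (j ! l))))))"
    by (intro sum.cong refl arg_cong2[where f="(*)"] Cons.IH[OF V(2) k(2), of "\<lambda>N. b (add_mset _ N)"])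
  also have "real k * \<dots> = fact k * (\<Sum>c\<in>F. \<Sum>j\<in>wlists F k'. b (add_mset c (mset j)) * (Q X (g c) * (\<Prod>l<k'. Q (Xs ! l) (g (j ! l)))))"
    by (simp add: k sum_distrib_left mult_ac)
  also have "\<dots> = fact k * (\<Sum>j\<in>wlists F k. b (mset j) * (\<Prod>l<k. Q ((X # Xs) ! l) (g (j ! l))))"
    by (simp add: k sum_wlists_Suc[OF F] prod.lessThan_Suc_shift del: prod.lessThan_Suc)
  finally show ?case .
qed

text \<open>In the expansion of the product of the \<open>X + i X'\<close>, any term that takes a
  factor from the copy has fewer factors in x. \<open>L\<close> is an arbitrary linear family so
  that one statement serves both for spans of lower products and for orthogonal complements;
  \<open>D\<close> collects the factors already taken from x itself.\<close>

lemma wp_leading_term: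
  assumes L0: "(\<lambda>x. 0) \<in> L"
    and Ladd: "\<And>f g. f \<in> L \<Longrightarrow> g \<in> L \<Longrightarrow> (\<lambda>x. f x + g x) \<in> L"
    and Lscale: "\<And>c f. f \<in> L \<Longrightarrow> (\<lambda>x. c * f x) \<in> L"
    and "\<And>C. C \<subset># D + mset Xs \<Longrightarrow> mprod C \<in> L"
  shows "(\<lambda>x. mprod D x * wp Xs B x - eps (size B) * mom B * mprod (D + mset Xs) x) \<in> L"
  using assms(4)
proof (induction Xs arbitrary: D B)
  case Nil
  then show ?case using L0 by (simp add: mult_ac)
next
  case (Cons X Xs)
  have s: "D + mset Xs \<subset># D + mset (X # Xs)" by simp
  have 1: "(\<lambda>x. mprod D x * wp Xs (add_mset X B) x - eps (size (add_mset X B)) * mom (add_mset X B) * mprod (D + mset Xs) x) \<in> L"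
    by (rule Cons.IH) (meson Cons.prems s subset_mset.less_trans)
  have 2: "(\<lambda>x. mprod (add_mset X D) x * wp Xs B x - eps (size B) * mom B * mprod (add_mset X D + mset Xs) x) \<in> L"
    by (rule Cons.IH) (use Cons.prems in simp)
  have 3: "(\<lambda>x. eps (size (add_mset X B)) * mom (add_mset X B) * mprod (D + mset Xs) x) \<in> L"
    by (rule Lscale) (rule Cons.prems[OF s])
  show ?case using Ladd[OF Ladd[OF 1 2] 3] by (simp add: algebra_simps)
qed

lemma wp_minus_mprod:
  assumes "(\<lambda>x. 0) \<in> L"
    and "\<And>f g. f \<in> L \<Longrightarrow> g \<in> L \<Longrightarrow> (\<lambda>x. f x + g x) \<in> L"
    and "\<And>c f. f \<in> L \<Longrightarrow> (\<lambda>x. c * f x) \<in> L"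
    and "\<And>C. C \<subset># mset Xs \<Longrightarrow> mprod C \<in> L"
  shows "(\<lambda>x. wp Xs {#} x - mprod (mset Xs) x) \<in> L"
  using wp_leading_term[of L "{#}" Xs "{#}"] assms by (simp add: mom_def prob_space)

text \<open>The first Wick product is orthogonal to lower degrees, so the second may be replaced by
  its leading monomial; this is where the inequality between the lengths enters.\<close>

lemma integral_wp_wp:
  assumes Xs: "set Xs \<subseteq> V" and Ys: "set Ys \<subseteq> V" and le: "length Ys \<le> length Xs"
  shows "(\<integral>x. wp Xs {#} x * wp Ys {#} x \<partial>M) = Psi Xs {#} (mset Ys)"
proof -
  define L where "L = {h. fin_moments M h \<and> (\<integral>x. wp Xs {#} x * h x \<partial>M) = 0}"
  note W = wp_fin_moments[OF Xs]
  have "(\<lambda>x. wp Ys {#} x - mprod (mset Ys) x) \<in> L"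
  proof (rule wp_minus_mprod)
    fix f g assume "f \<in> L" "g \<in> L"
    then show "(\<lambda>x. f x + g x) \<in> L"
      using W by (auto simp: L_def distrib_left fin_moments_integrable fin_moments_mult fin_moments_add)
  next
    fix c f assume "f \<in> L"
    then show "(\<lambda>x. c * f x) \<in> L"
      using W by (auto simp: L_def mult.left_commute intro!: fin_moments_cmult)
  next
    fix C assume C: "C \<subset># mset Ys"
    then have "set_mset C \<subseteq> V" using Ys by (metis (no_types) mset_subset_eqD set_mset_mset subset_iff subset_mset.less_imp_le)
    moreover have "size C < length Xs" using mset_subset_size[OF C] le by simp
    ultimately show "mprod C \<in> L"
      using Psi_eq_0_size[OF Xs] by (auto simp: L_def Psi_def mprod_fin_moments)
  qed (simp add: L_def fin_moments_const)
  then have "(\<integral>x. wp Xs {#} x * (wp Ys {#} x - mprod (mset Ys) x) \<partial>M) = 0" by (simp add: L_def)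
  moreover have "integrable M (\<lambda>x. wp Xs {#} x * wp Ys {#} x)" "integrable M (\<lambda>x. wp Xs {#} x * mprod (mset Ys) x)"
    using Ys by (auto intro!: fin_moments_integrable fin_moments_mult W wp_fin_moments mprod_fin_moments)
  ultimately show ?thesis by (simp add: Psi_def right_diff_distrib)
qed

end

section \<open>Square-integrable functions\<close>

lemma L2R_D: "f \<in> L2R M \<Longrightarrow> f \<in> borel_measurable M" "f \<in> L2R M \<Longrightarrow> integrable M (\<lambda>x. (f x)\<^sup>2)"
  by (auto simp: L2R_def)

lemma L2R_mult_integrable:
  assumes "f \<in> L2R M" "g \<in> L2R M" shows "integrable M (\<lambda>x. f x * g x)"
proof (rule Bochner_Integration.integrable_bound)
  note [measurable] = L2R_D(1)[OF assms(1)] L2R_D(1)[OF assms(2)]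
  show "integrable M (\<lambda>x. (f x)\<^sup>2 + (g x)\<^sup>2)" using assms by (auto simp: L2R_def)
  show "(\<lambda>x. f x * g x) \<in> borel_measurable M" by measurable
  have "\<bar>f x * g x\<bar> \<le> (f x)\<^sup>2 + (g x)\<^sup>2" for x
  proof -
    have "0 \<le> (\<bar>f x\<bar> - \<bar>g x\<bar>)\<^sup>2" by simp
    then have "2 * \<bar>f x * g x\<bar> \<le> (f x)\<^sup>2 + (g x)\<^sup>2" by (simp add: power2_diff abs_mult)
    moreover have "0 \<le> \<bar>f x * g x\<bar>" by simp
    ultimately show ?thesis by linarith
  qed
  then show "AE x in M. norm (f x * g x) \<le> norm ((f x)\<^sup>2 + (g x)\<^sup>2)" by simp
qed

lemma L2R_add:
  assumes "f \<in> L2R M" "g \<in> L2R M" shows "(\<lambda>x. f x + g x) \<in> L2R M"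
  using assms L2R_mult_integrable[OF assms]
  by (auto simp: L2R_def power2_sum mult.assoc)

lemma L2R_cmult: "f \<in> L2R M \<Longrightarrow> (\<lambda>x. c * f x) \<in> L2R M"
  by (auto simp: L2R_def power_mult_distrib)

lemma L2R_diff:
  assumes "f \<in> L2R M" "g \<in> L2R M" shows "(\<lambda>x. f x - g x) \<in> L2R M"
  using L2R_add[OF assms(1) L2R_cmult[OF assms(2), of "-1"]] by simp

lemma L2R_zero: "(\<lambda>x. 0) \<in> L2R M"
  by (simp add: L2R_def)

lemma L2R_sum: "(\<And>i. i \<in> I \<Longrightarrow> f i \<in> L2R M) \<Longrightarrow> (\<lambda>x. \<Sum>i\<in>I. f i x) \<in> L2R M"
  by (induction I rule: infinite_finite_induct) (auto simp: L2R_zero L2R_add)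

lemma (in finite_measure) L2R_integrable:
  assumes "f \<in> L2R M" shows "integrable M f"
proof -
  have "(\<lambda>x. 1) \<in> L2R M" by (simp add: L2R_def)
  from L2R_mult_integrable[OF assms this] show ?thesis by simp
qed

lemma L2norm_nonneg [simp]: "0 \<le> L2norm M f"
  by (simp add: L2norm_def)

lemma L2norm_power2: "(L2norm M f)\<^sup>2 = (\<integral>x. (f x)\<^sup>2 \<partial>M)"
  by (simp add: L2norm_def)

lemma L2norm_eq_0_AE:
  assumes "f \<in> L2R M" "L2norm M f = 0" shows "AE x in M. f x = 0"
proof -
  have "(\<integral>x. (f x)\<^sup>2 \<partial>M) = 0" using L2norm_power2[of M f] assms(2) by simp
  then have "AE x in M. (f x)\<^sup>2 = 0"
    using integral_nonneg_eq_0_iff_AE[OF L2R_D(2)[OF assms(1)]] by simp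
  then show ?thesis by simp
qed

lemma L2_Cauchy_Schwarz:
  assumes f: "f \<in> L2R M" and g: "g \<in> L2R M"
  shows "\<bar>\<integral>x. f x * g x \<partial>M\<bar> \<le> L2norm M f * L2norm M g"
proof (cases "L2norm M g = 0")
  case True
  have [measurable]: "f \<in> borel_measurable M" "g \<in> borel_measurable M" using f g by (auto simp: L2R_def)
  have "AE x in M. f x * g x = 0" using L2norm_eq_0_AE[OF g True] by auto
  then have "(\<integral>x. f x * g x \<partial>M) = (\<integral>x. 0 \<partial>M)" by (intro integral_cong_AE) auto
  then show ?thesis using True by simp
next
  case False
  define A B C where "A = (\<integral>x. (f x)\<^sup>2 \<partial>M)" and "B = (\<integral>x. f x * g x \<partial>M)" and "C = (\<integral>x. (g x)\<^sup>2 \<partial>M)"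
  have C: "C > 0" using False by (auto simp: C_def L2norm_def less_le)
  \<comment> \<open>The combination C f - B g is C times the component of f orthogonal to g.\<close>
  have eq: "(\<integral>x. (C * f x - B * g x)\<^sup>2 \<partial>M) = C\<^sup>2 * A - 2 * C * B * B + B\<^sup>2 * C"
  proof -
    have "(\<integral>x. (C * f x - B * g x)\<^sup>2 \<partial>M) = (\<integral>x. C\<^sup>2 * (f x)\<^sup>2 - 2 * C * B * (f x * g x) + B\<^sup>2 * (g x)\<^sup>2 \<partial>M)"
      by (simp add: power2_diff power_mult_distrib mult_ac add_diff_eq diff_add_eq)
    also have "\<dots> = C\<^sup>2 * A - 2 * C * B * B + B\<^sup>2 * C"
      using L2R_D(2)[OF f] L2R_D(2)[OF g] L2R_mult_integrable[OF f g] by (simp add: A_def B_def C_def)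
    finally show ?thesis .
  qed
  have "0 \<le> (\<integral>x. (C * f x - B * g x)\<^sup>2 \<partial>M)" by simp
  then have "0 \<le> C * (A * C - B\<^sup>2)" unfolding eq by (simp add: algebra_simps power2_eq_square)
  then have "B\<^sup>2 \<le> A * C" using C by (simp add: zero_le_mult_iff)
  then have "\<bar>B\<bar> \<le> sqrt (A * C)" by (simp add: real_le_rsqrt)
  then show ?thesis by (simp add: A_def B_def C_def L2norm_def real_sqrt_mult)
qed

lemma L2norm_triangle:
  assumes f: "f \<in> L2R M" and g: "g \<in> L2R M"
  shows "L2norm M (\<lambda>x. f x + g x) \<le> L2norm M f + L2norm M g"
proof -
  have "(L2norm M (\<lambda>x. f x + g x))\<^sup>2 = (L2norm M f)\<^sup>2 + 2 * (\<integral>x. f x * g x \<partial>M) + (L2norm M g)\<^sup>2"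
    using L2R_D(2)[OF f] L2R_D(2)[OF g] L2R_mult_integrable[OF f g]
    by (simp add: L2norm_power2 power2_sum mult.assoc)
  also have "\<dots> \<le> (L2norm M f + L2norm M g)\<^sup>2"
    using L2_Cauchy_Schwarz[OF f g] by (simp add: power2_sum)
  finally show ?thesis by (rule power2_le_imp_le) simp
qed

lemma L2norm_cmult: "L2norm M (\<lambda>x. c * f x) = \<bar>c\<bar> * L2norm M f"
  by (simp add: L2norm_def power_mult_distrib real_sqrt_mult)

lemma L2norm_minus_commute: "L2norm M (\<lambda>x. f x - g x) = L2norm M (\<lambda>x. g x - f x)"
  by (simp add: L2norm_def power2_commute)

lemma (in prob_space) integral_abs_le_L2norm:
  assumes "f \<in> L2R M" shows "(\<integral>x. \<bar>f x\<bar> \<partial>M) \<le> L2norm M f"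
proof -
  have "(\<lambda>x. \<bar>f x\<bar>) \<in> L2R M" "(\<lambda>x. 1) \<in> L2R M" using assms by (auto simp: L2R_def)
  from L2_Cauchy_Schwarz[OF this] show ?thesis by (simp add: L2norm_def prob_space)
qed

text \<open>Riesz-Fischer: on a probability space an L2-Cauchy sequence is Cauchy in L1, hence a
  subsequence converges almost everywhere, and Fatou's lemma turns the pointwise limit into an L2
  limit.\<close>

lemma (in prob_space) L2_complete:
  assumes u: "\<And>n. u n \<in> L2R M"
    and cauchy: "\<And>e. e > 0 \<Longrightarrow> \<exists>N. \<forall>i\<ge>N. \<forall>j\<ge>N. L2norm M (\<lambda>x. u i x - u j x) < e"
  obtains h where "h \<in> L2R M" "(\<lambda>n. L2norm M (\<lambda>x. u n x - h x)) \<longlonglongrightarrow> 0"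
proof -
  have [measurable]: "u n \<in> borel_measurable M" for n using L2R_D(1)[OF u] .
  obtain r where r: "strict_mono r" and ae: "AE x in M. Cauchy (\<lambda>i. u (r i) x)"
  proof (rule cauchy_L1_AE_cauchy_subseq)
    show "integrable M (u n)" for n by (rule L2R_integrable[OF u])
    fix e :: real assume "e > 0"
    then obtain N where N: "\<And>i j. i \<ge> N \<Longrightarrow> j \<ge> N \<Longrightarrow> L2norm M (\<lambda>x. u i x - u j x) < e" using cauchy by blast
    show "\<exists>N. \<forall>i\<ge>N. \<forall>j\<ge>N. (\<integral>x. norm (u i x - u j x) \<partial>M) < e"
    proof (intro exI[of _ N] allI impI)
      fix i j assume "N \<le> i" "N \<le> j"
      then show "(\<integral>x. norm (u i x - u j x) \<partial>M) < e"
        using N[of i j] integral_abs_le_L2norm[OF L2R_diff[OF u u], of i j] by simp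
    qed
  qed
  define h where "h x = lim (\<lambda>i. u (r i) x)" for x
  have [measurable]: "h \<in> borel_measurable M" unfolding h_def by measurable
  have conv: "AE x in M. (\<lambda>i. u (r i) x) \<longlonglongrightarrow> h x"
    using ae unfolding h_def by eventually_elim (simp add: Cauchy_convergent_iff convergent_LIMSEQ_iff)
  \<comment> \<open>The assumed bound is uniform in the later terms, so Fatou along the subsequence
    passes it to \<open>h\<close>; integrability comes out of the same estimate.\<close>
  have key: "integrable M (\<lambda>x. (u n x - h x)\<^sup>2) \<and> (\<integral>x. (u n x - h x)\<^sup>2 \<partial>M) \<le> e\<^sup>2"
    if e: "e > 0" and n: "\<And>j. j \<ge> n \<Longrightarrow> L2norm M (\<lambda>x. u n x - u j x) < e" for n e
  proof -
    have b: "(\<integral>\<^sup>+x. ennreal ((u n x - u (r j) x)\<^sup>2) \<partial>M) \<le> ennreal (e\<^sup>2)" if "j \<ge> n" for j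
    proof -
      have "r j \<ge> n" using seq_suble[OF r, of j] that by simp
      then have "(L2norm M (\<lambda>x. u n x - u (r j) x))\<^sup>2 \<le> e\<^sup>2" using n[of "r j"] by (intro power_mono) auto
      then show ?thesis unfolding L2norm_power2
        by (subst nn_integral_eq_integral) (auto intro!: L2R_D(2) L2R_diff u ennreal_leI)
    qed
    have "(\<integral>\<^sup>+x. ennreal ((u n x - h x)\<^sup>2) \<partial>M) = (\<integral>\<^sup>+x. liminf (\<lambda>j. ennreal ((u n x - u (r j) x)\<^sup>2)) \<partial>M)"
    proof (rule nn_integral_cong_AE, use conv in eventually_elim)
      fix x assume "(\<lambda>i. u (r i) x) \<longlonglongrightarrow> h x"
      then have "(\<lambda>j. ennreal ((u n x - u (r j) x)\<^sup>2)) \<longlonglongrightarrow> ennreal ((u n x - h x)\<^sup>2)"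
        by (intro tendsto_intros)
      then show "ennreal ((u n x - h x)\<^sup>2) = liminf (\<lambda>j. ennreal ((u n x - u (r j) x)\<^sup>2))"
        by (intro lim_imp_Liminf[symmetric] trivial_limit_sequentially)
    qed
    also have "\<dots> \<le> liminf (\<lambda>j. \<integral>\<^sup>+x. ennreal ((u n x - u (r j) x)\<^sup>2) \<partial>M)"
      by (rule nn_integral_liminf) measurable
    also have "\<dots> \<le> liminf (\<lambda>j. ennreal (e\<^sup>2))"
      by (rule Liminf_mono) (auto simp: eventually_sequentially intro!: exI[of _ n] b)
    also have "\<dots> = ennreal (e\<^sup>2)" by (simp add: Liminf_const)
    finally have *: "(\<integral>\<^sup>+x. ennreal ((u n x - h x)\<^sup>2) \<partial>M) \<le> ennreal (e\<^sup>2)" .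
    then have int: "integrable M (\<lambda>x. (u n x - h x)\<^sup>2)"
      by (intro integrableI_nonneg) (auto simp: le_less_trans)
    from * have "ennreal (\<integral>x. (u n x - h x)\<^sup>2 \<partial>M) \<le> ennreal (e\<^sup>2)"
      using nn_integral_eq_integral[OF int] by simp
    with int show ?thesis by (simp add: ennreal_le_iff)
  qed
  obtain N0 where N0: "\<And>j. j \<ge> N0 \<Longrightarrow> L2norm M (\<lambda>x. u N0 x - u j x) < 1"
    using cauchy[of 1] by auto
  have "(\<lambda>x. u N0 x - h x) \<in> L2R M"
    using key[of 1 N0] N0 by (auto simp: L2R_def)
  from L2R_diff[OF u[of N0] this] have h: "h \<in> L2R M" by simp
  moreover have "(\<lambda>n. L2norm M (\<lambda>x. u n x - h x)) \<longlonglongrightarrow> 0"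
  proof (rule LIMSEQ_I)
    fix e :: real assume e: "e > 0"
    obtain N where N: "\<And>i j. i \<ge> N \<Longrightarrow> j \<ge> N \<Longrightarrow> L2norm M (\<lambda>x. u i x - u j x) < e/2"
      using cauchy[of "e/2"] e by auto
    have "norm (L2norm M (\<lambda>x. u n x - h x) - 0) < e" if "n \<ge> N" for n
    proof -
      have "(L2norm M (\<lambda>x. u n x - h x))\<^sup>2 \<le> (e/2)\<^sup>2"
        using key[of "e/2" n] N[of n] that e by (simp add: L2norm_power2)
      then have "L2norm M (\<lambda>x. u n x - h x) \<le> e/2" by (rule power2_le_imp_le) (use e in simp)
      then show ?thesis using e by simp
    qed
    then show "\<exists>no. \<forall>n\<ge>no. norm (L2norm M (\<lambda>x. u n x - h x) - 0) < e" by blast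
  qed
  ultimately show ?thesis by (rule that)
qed

section \<open>Linear spans and L2 closures\<close>

lemma sum_lessThan_add: "(\<Sum>i<n1 + n2. f i) = (\<Sum>i<n1. f i) + (\<Sum>i<n2. (f (n1 + i) :: 'b::comm_monoid_add))" for n1 n2 :: nat
  by (induction n2) (auto simp: add_ac)

lemma fspanE:
  assumes "f \<in> fspan S"
  obtains n :: nat and g and c :: "nat \<Rightarrow> real" where "\<forall>i<n. g i \<in> S" "f = (\<lambda>x. \<Sum>i<n. c i * g i x)"
proof -
  from assms have "\<exists>n::nat. \<exists>c::nat \<Rightarrow> real. \<exists>g. (\<forall>i<n. g i \<in> S) \<and> f = (\<lambda>x. \<Sum>i<n. c i * g i x)"
    by (simp add: fspan_def)
  then show ?thesis by (elim exE conjE) (rule that)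
qed

lemma fspan_base: "g \<in> S \<Longrightarrow> g \<in> fspan S"
  unfolding fspan_def by (intro CollectI exI[of _ 1] exI[of _ "\<lambda>_. 1"] exI[of _ "\<lambda>_. g"]) auto

lemma fspan_zero: "(\<lambda>x. 0) \<in> fspan S"
  unfolding fspan_def by (intro CollectI exI[of _ 0]) auto

lemma fspan_scale: "f \<in> fspan S \<Longrightarrow> (\<lambda>x. a * f x) \<in> fspan S"
  unfolding fspan_def
proof (clarify, intro exI conjI)
  fix n :: nat and c :: "nat \<Rightarrow> real" and g
  assume "\<forall>i<n. g i \<in> S"
  then show "\<forall>i<n. g i \<in> S" .
  show "(\<lambda>x. a * (\<Sum>i<n. c i * g i x)) = (\<lambda>x. \<Sum>i<n. (a * c i) * g i x)"
    by (simp add: sum_distrib_left mult.assoc)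
qed

lemma fspan_add:
  assumes "f \<in> fspan S" "g \<in> fspan S" shows "(\<lambda>x. f x + g x) \<in> fspan S"
proof -
  obtain n1 :: nat and g1 and c1 :: "nat \<Rightarrow> real" where 1: "\<forall>i<n1. g1 i \<in> S" "f = (\<lambda>x. \<Sum>i<n1. c1 i * g1 i x)"
    by (rule fspanE[OF assms(1)])
  obtain n2 :: nat and g2 and c2 :: "nat \<Rightarrow> real" where 2: "\<forall>i<n2. g2 i \<in> S" "g = (\<lambda>x. \<Sum>i<n2. c2 i * g2 i x)"
    by (rule fspanE[OF assms(2)])
  define c where "c i = (if i < n1 then c1 i else c2 (i - n1))" for i :: nat
  define h where "h i = (if i < n1 then g1 i else g2 (i - n1))" for i :: nat
  have "h i \<in> S" if "i < n1 + n2" for i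
  proof (cases "i < n1")
    case True
    then show ?thesis using 1(1) by (simp add: h_def)
  next
    case False
    then have "i - n1 < n2" using that by simp
    then show ?thesis using 2(1) False by (simp add: h_def)
  qed
  then have "\<forall>i<n1 + n2. h i \<in> S" by blast
  moreover have "(\<lambda>x. f x + g x) = (\<lambda>x. \<Sum>i<n1 + n2. c i * h i x)"
    unfolding 1(2) 2(2) sum_lessThan_add by (simp add: c_def h_def)
  ultimately show ?thesis unfolding fspan_def by blast
qed

lemma fspan_sum: "(\<And>i. i \<in> I \<Longrightarrow> f i \<in> fspan S) \<Longrightarrow> (\<lambda>x. \<Sum>i\<in>I. f i x) \<in> fspan S"
  by (induction I rule: infinite_finite_induct) (auto simp: fspan_zero fspan_add)

lemma fspan_induct:
  assumes "f \<in> fspan S" and "\<And>g. g \<in> S \<Longrightarrow> P g" and "P (\<lambda>x. 0)"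
    and "\<And>f g. P f \<Longrightarrow> P g \<Longrightarrow> P (\<lambda>x. f x + g x)" and "\<And>c f. P f \<Longrightarrow> P (\<lambda>x. c * f x)"
  shows "P f"
proof -
  obtain n :: nat and g and c :: "nat \<Rightarrow> real" where 1: "\<forall>i<n. g i \<in> S" "f = (\<lambda>x. \<Sum>i<n. c i * g i x)"
    by (rule fspanE[OF assms(1)])
  have "k \<le> n \<Longrightarrow> P (\<lambda>x. \<Sum>i<k. c i * g i x)" for k
    by (induction k) (use assms(2-5) 1(1) in auto)
  then show ?thesis by (simp add: 1(2))
qed

lemma L2closure_L2R: "f \<in> L2closure M S \<Longrightarrow> f \<in> L2R M"
  by (simp add: L2closure_def)

lemma L2closure_base:
  assumes "f \<in> S" "f \<in> L2R M" shows "f \<in> L2closure M S"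
  using assms by (auto simp: L2closure_def L2norm_def intro!: bexI[of _ f])

lemma L2closure_add:
  assumes S: "S \<subseteq> L2R M" "\<And>f g. f \<in> S \<Longrightarrow> g \<in> S \<Longrightarrow> (\<lambda>x. f x + g x) \<in> S"
    and f: "f \<in> L2closure M S" and g: "g \<in> L2closure M S"
  shows "(\<lambda>x. f x + g x) \<in> L2closure M S"
  unfolding L2closure_def
proof (intro CollectI conjI allI impI)
  note fR = L2closure_L2R[OF f] and gR = L2closure_L2R[OF g]
  show "(\<lambda>x. f x + g x) \<in> L2R M" by (rule L2R_add[OF fR gR])
  fix e :: real assume e: "e > 0"
  obtain f' where f': "f' \<in> S" "L2norm M (\<lambda>x. f x - f' x) < e/2" using f e unfolding L2closure_def by (auto dest: spec[of _ "e/2"])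
  obtain g' where g': "g' \<in> S" "L2norm M (\<lambda>x. g x - g' x) < e/2" using g e unfolding L2closure_def by (auto dest: spec[of _ "e/2"])
  have "L2norm M (\<lambda>x. (f x - f' x) + (g x - g' x)) \<le> L2norm M (\<lambda>x. f x - f' x) + L2norm M (\<lambda>x. g x - g' x)"
    by (rule L2norm_triangle) (use fR gR f'(1) g'(1) S(1) in \<open>auto intro!: L2R_diff\<close>)
  then have "L2norm M (\<lambda>x. (f x + g x) - (f' x + g' x)) < e" using f'(2) g'(2) by (simp add: algebra_simps)
  then show "\<exists>h\<in>S. L2norm M (\<lambda>x. (f x + g x) - h x) < e" using S(2)[OF f'(1) g'(1)] by (rule bexI)
qed

lemma L2closure_scale:
  assumes S: "\<And>c f. f \<in> S \<Longrightarrow> (\<lambda>x. c * f x) \<in> S" and f: "f \<in> L2closure M S"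
  shows "(\<lambda>x. c * f x) \<in> L2closure M S"
  unfolding L2closure_def
proof (intro CollectI conjI allI impI)
  show "(\<lambda>x. c * f x) \<in> L2R M" by (rule L2R_cmult[OF L2closure_L2R[OF f]])
  fix e :: real assume e: "e > 0"
  \<comment> \<open>The summand 1 avoids a separate case for \<open>c = 0\<close>.\<close>
  have "e / (\<bar>c\<bar> + 1) > 0" using e by (simp add: divide_pos_pos add_nonneg_pos)
  then obtain f' where f': "f' \<in> S" "L2norm M (\<lambda>x. f x - f' x) < e / (\<bar>c\<bar> + 1)" using f unfolding L2closure_def by blast
  have "L2norm M (\<lambda>x. c * f x - c * f' x) = \<bar>c\<bar> * L2norm M (\<lambda>x. f x - f' x)"
    using L2norm_cmult[of M c "\<lambda>x. f x - f' x"] by (simp add: right_diff_distrib)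
  also have "\<dots> \<le> \<bar>c\<bar> * (e / (\<bar>c\<bar> + 1))" using f'(2) by (intro mult_left_mono) auto
  also have "\<dots> < e" using e by (simp add: field_simps)
  finally show "\<exists>h\<in>S. L2norm M (\<lambda>x. c * f x - h x) < e" using S[OF f'(1), of c] by (rule bexI)
qed

lemma L2closure_orthogonal:
  assumes "f \<in> L2closure M S" "S \<subseteq> L2R M" "h \<in> L2R M" and orth: "\<And>g. g \<in> S \<Longrightarrow> (\<integral>x. h x * g x \<partial>M) = 0"
  shows "(\<integral>x. h x * f x \<partial>M) = 0"
proof (rule ccontr)
  note fR = L2closure_L2R[OF assms(1)]
  assume "(\<integral>x. h x * f x \<partial>M) \<noteq> 0"
  then have pos: "\<bar>\<integral>x. h x * f x \<partial>M\<bar> > 0" by simp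
  have N: "L2norm M h + 1 > 0" by (simp add: add_nonneg_pos)
  have "\<bar>\<integral>x. h x * f x \<partial>M\<bar> / (L2norm M h + 1) > 0" using pos N by simp
  then obtain g where g: "g \<in> S" "L2norm M (\<lambda>x. f x - g x) < \<bar>\<integral>x. h x * f x \<partial>M\<bar> / (L2norm M h + 1)"
    using assms(1) unfolding L2closure_def by blast
  have gR: "g \<in> L2R M" using g(1) assms(2) by auto
  have "(\<integral>x. h x * (f x - g x) \<partial>M) = (\<integral>x. h x * f x \<partial>M)"
    using L2R_mult_integrable[OF assms(3) fR] L2R_mult_integrable[OF assms(3) gR] orth[OF g(1)]
    by (simp add: right_diff_distrib)
  then have "\<bar>\<integral>x. h x * f x \<partial>M\<bar> \<le> L2norm M h * L2norm M (\<lambda>x. f x - g x)"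
    using L2_Cauchy_Schwarz[OF assms(3) L2R_diff[OF fR gR]] by simp
  also have "\<dots> \<le> (L2norm M h + 1) * L2norm M (\<lambda>x. f x - g x)" by (simp add: distrib_right)
  also have "\<dots> < \<bar>\<integral>x. h x * f x \<partial>M\<bar>" using g(2) N by (simp add: field_simps)
  finally show False by simp
qed

section \<open>Finite measures on separable Hilbert spaces\<close>

text \<open>The representing vector is the minimiser of |x|^2 - 2 \<phi>(x): the parallelogram law
  makes a minimising sequence Cauchy, and the first-order condition at the limit is the claim. It is
  needed for the adjoints of the powers of T.\<close>

lemma riesz_representation:
  fixes \<phi> :: "'h::{real_inner,complete_space} \<Rightarrow> real"
  assumes "bounded_linear \<phi>"
  obtains w where "\<And>x. \<phi> x = inner w x"
proof -
  interpret bounded_linear \<phi> by fact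
  obtain K where K: "\<And>x. norm (\<phi> x) \<le> norm x * K" and K0: "K > 0" using pos_bounded by blast
  define F where "F x = (norm x)\<^sup>2 - 2 * \<phi> x" for x
  have lower: "- K\<^sup>2 \<le> F x" for x
  proof -
    have "0 \<le> (norm x - K)\<^sup>2" by simp
    moreover have "\<phi> x \<le> norm x * K" using K[of x] by simp
    ultimately show ?thesis by (simp add: F_def power2_diff)
  qed
  define I where "I = (INF x. F x)"
  have bdd: "bdd_below (range F)" by (rule bdd_belowI[of _ "- K\<^sup>2"]) (use lower in auto)
  have I_le: "I \<le> F x" for x unfolding I_def by (rule cINF_lower[OF bdd]) simp
  have "\<exists>x. F x < I + 1 / real (Suc n)" for n
  proof -
    have "(INF x. F x) < I + 1 / real (Suc n)" unfolding I_def by simp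
    then show ?thesis by (subst (asm) cINF_less_iff[OF _ bdd]) auto
  qed
  then obtain x where x: "\<And>n. F (x n) < I + 1 / real (Suc n)" by metis
  have par: "(norm (a - b))\<^sup>2 = 2 * F a + 2 * F b - 4 * F ((1/2) *\<^sub>R (a + b))" for a b
    by (simp add: F_def add diff scaleR power2_norm_eq_inner inner_add_left inner_add_right inner_diff_left inner_diff_right inner_commute[of b a] power_divide field_simps)
  have dist: "(norm (x i - x j))\<^sup>2 \<le> 4 / real (Suc n)" if "i \<ge> n" "j \<ge> n" for i j n
  proof -
    have "1 / real (Suc i) \<le> 1 / real (Suc n)" "1 / real (Suc j) \<le> 1 / real (Suc n)"
      using that by (auto intro!: divide_left_mono)
    then show ?thesis using par[of "x i" "x j"] x[of i] x[of j] I_le[of "(1/2) *\<^sub>R (x i + x j)"] by simp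
  qed
  have "Cauchy x"
  proof (rule metric_CauchyI)
    fix e :: real assume e: "e > 0"
    obtain n where n: "4 / e\<^sup>2 < real n" using reals_Archimedean2 by blast
    have "4 / real (Suc n) < e\<^sup>2" using n e by (simp add: field_simps) (smt (verit) zero_less_power)
    then have "\<forall>i\<ge>n. \<forall>j\<ge>n. dist (x i) (x j) < e"
      using dist[of n] e unfolding dist_norm by (meson le_less_trans less_imp_le power2_less_imp_less)
    then show "\<exists>M. \<forall>m\<ge>M. \<forall>n\<ge>M. dist (x m) (x n) < e" by blast
  qed
  then obtain w where w: "x \<longlonglongrightarrow> w" using Cauchy_convergent_iff convergent_def by blast
  have "(\<lambda>n. F (x n)) \<longlonglongrightarrow> F w" unfolding F_def by (intro tendsto_intros tendsto w)
  moreover have "(\<lambda>n. I + 1 / real (Suc n)) \<longlonglongrightarrow> I + 0"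
    by (intro tendsto_intros LIMSEQ_Suc lim_1_over_n)
  ultimately have "F w \<le> I" using x by (intro LIMSEQ_le[of "\<lambda>n. F (x n)" _ "\<lambda>n. I + 1 / real (Suc n)"]) (auto intro: less_imp_le)
  then have min: "F w \<le> F y" for y using I_le[of y] by simp
  have "\<phi> v = inner w v" for v
  proof -
    define a where "a = \<phi> v - inner w v"
    have q: "0 \<le> t\<^sup>2 * (norm v)\<^sup>2 - 2 * t * a" for t
    proof -
      have "(norm (w + t *\<^sub>R v))\<^sup>2 = (norm w)\<^sup>2 + 2 * t * inner w v + t\<^sup>2 * (norm v)\<^sup>2"
        unfolding power2_norm_eq_inner
        by (simp add: inner_add_left inner_add_right inner_commute[of v w] power2_eq_square algebra_simps)
      then show ?thesis using min[of "w + t *\<^sub>R v"] by (simp add: F_def a_def add scaleR algebra_simps)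
    qed
    have "a = 0"
    proof (rule ccontr)
      assume "a \<noteq> 0"
      \<comment> \<open>The test value t = a / N makes the quadratic negative unless a = 0; the
        added 1 keeps N positive when v = 0.\<close>
      define N where "N = (norm v)\<^sup>2 + 1"
      have N: "N > 0" by (simp add: N_def add_nonneg_pos)
      have "0 \<le> (a/N)\<^sup>2 * (norm v)\<^sup>2 - 2 * (a/N) * a" by (rule q)
      also have "\<dots> < (a/N)\<^sup>2 * N - 2 * (a/N) * a" using \<open>a \<noteq> 0\<close> N by (simp add: N_def)
      also have "\<dots> = - (a\<^sup>2 / N)" using N by (simp add: power2_eq_square field_simps)
      also have "\<dots> \<le> 0" using N by simp
      finally show False by simp
    qed
    then show ?thesis by (simp add: a_def)
  qed
  then show ?thesis by (rule that)
qed

section \<open>Uniqueness of measures with a given characteristic function\<close>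

text \<open>Levy's theorem concerns probability laws on the line, so both measures are divided by
  their common mass, which is read off at t = 0; mass 0 is a case of its own.\<close>

lemma finite_measure_char_unique:
  fixes K1 K2 :: "'a measure"
  assumes "finite_measure K1" "finite_measure K2"
    and X [measurable]: "X \<in> borel_measurable K1" "X \<in> borel_measurable K2"
    and char: "\<And>t::real. (\<integral>z. iexp (t * X z) \<partial>K1) = (\<integral>z. iexp (t * X z) \<partial>K2)"
    and B [measurable]: "B \<in> sets borel"
  shows "measure K1 (X -` B \<inter> space K1) = measure K2 (X -` B \<inter> space K2)"
proof -
  interpret K1: finite_measure K1 by fact
  interpret K2: finite_measure K2 by fact
  define c where "c = measure K1 (space K1)"
  have c2: "measure K2 (space K2) = c"
    using char[of 0] by (simp add: c_def)
  have c0: "c \<ge> 0" by (simp add: c_def)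
  show ?thesis
  proof (cases "c = 0")
    case True
    have "measure K1 (X -` B \<inter> space K1) \<le> measure K1 (space K1)" "measure K2 (X -` B \<inter> space K2) \<le> measure K2 (space K2)"
      by (auto intro!: K1.finite_measure_mono K2.finite_measure_mono)
    then show ?thesis using True c2 by (simp add: c_def measure_le_0_iff)
  next
    case False
    define N where "N K = distr (scale_measure (ennreal (1/c)) K) borel X" for K
    have N: "real_distribution (N K) \<and> (\<forall>t. char (N K) t = (1/c) * (\<integral>z. iexp (t * X z) \<partial>K))
        \<and> measure (N K) B = (1/c) * measure K (X -` B \<inter> space K)"
      if K: "finite_measure K" "measure K (space K) = c" and [measurable]: "X \<in> borel_measurable K" for K
    proof -
      interpret K: finite_measure K by fact
      have pr: "prob_space (scale_measure (ennreal (1/c)) K)"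
      proof
        show "emeasure (scale_measure (ennreal (1/c)) K) (space (scale_measure (ennreal (1/c)) K)) = 1"
          using c0 False K(2) by (simp add: space_scale_measure K.emeasure_eq_measure ennreal_mult[symmetric])
      qed
      have m: "X \<in> borel_measurable (scale_measure (ennreal (1/c)) K)"
        by (simp add: measurable_cong_sets[OF sets_scale_measure refl])
      have dens: "scale_measure (ennreal (1/c)) K = density K (\<lambda>_. ennreal (1/c))"
        by (rule measure_eqI) (auto simp: emeasure_density nn_integral_cmult_indicator)
      have "real_distribution (N K)"
        unfolding N_def by (rule prob_space.real_distribution_distr[OF pr m])
      moreover have "char (N K) t = (1/c) * (\<integral>z. iexp (t * X z) \<partial>K)" for t
      proof -
        have "char (N K) t = (\<integral>z. iexp (t * X z) \<partial>scale_measure (ennreal (1/c)) K)"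
          unfolding N_def char_def by (subst integral_distr[OF m]) auto
        also have "\<dots> = (\<integral>z. (1/c) *\<^sub>R iexp (t * X z) \<partial>K)"
          unfolding dens using c0 by (subst integral_density) auto
        also have "\<dots> = (1/c) * (\<integral>z. iexp (t * X z) \<partial>K)"
          by (simp add: scaleR_conv_of_real)
        finally show ?thesis .
      qed
      moreover have "measure (N K) B = (1/c) * measure K (X -` B \<inter> space K)"
        unfolding N_def using c0
        by (subst measure_distr[OF m]) (auto simp: space_scale_measure measure_def enn2real_mult)
      ultimately show ?thesis by blast
    qed
    have N1: "real_distribution (N K1)" "\<And>t. char (N K1) t = (1/c) * (\<integral>z. iexp (t * X z) \<partial>K1)"
      "measure (N K1) B = (1/c) * measure K1 (X -` B \<inter> space K1)"
      using N[OF assms(1) c_def[symmetric] X(1)] by blast+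
    have N2: "real_distribution (N K2)" "\<And>t. char (N K2) t = (1/c) * (\<integral>z. iexp (t * X z) \<partial>K2)"
      "measure (N K2) B = (1/c) * measure K2 (X -` B \<inter> space K2)"
      using N[OF assms(2) c2 X(2)] by blast+
    have "N K1 = N K2"
      by (rule Levy_uniqueness[OF N1(1) N2(1)]) (rule ext, simp only: N1(2) N2(2) char)
    then show ?thesis using N1(3) N2(3) False by simp
  qed
qed

text \<open>The weight is absorbed into the measure as a density; being nonnegative and bounded, it
  leaves the measure finite.\<close>

lemma finite_measure_weighted_char_unique:
  fixes K1 K2 :: "'a measure" and u X :: "'a \<Rightarrow> real"
  assumes "finite_measure K1" "finite_measure K2" and sets: "sets K2 = sets K1"
    and [measurable]: "X \<in> borel_measurable K1" "u \<in> borel_measurable K1"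
    and u: "\<And>z. 0 \<le> u z" "\<And>z. u z \<le> C"
    and char: "\<And>t::real. (\<integral>z. u z * iexp (t * X z) \<partial>K1) = (\<integral>z. u z * iexp (t * X z) \<partial>K2)"
    and B [measurable]: "B \<in> sets borel"
  shows "(\<integral>z. u z * indicator B (X z) \<partial>K1) = (\<integral>z. u z * indicator B (X z) \<partial>K2)"
proof -
  have [measurable]: "X \<in> borel_measurable K2" "u \<in> borel_measurable K2"
    using assms(4,5) measurable_cong_sets[OF sets refl] by blast+
  have *: "finite_measure (density K u) \<and>
     (\<forall>t. (\<integral>z. iexp (t * X z) \<partial>density K u) = (\<integral>z. u z * iexp (t * X z) \<partial>K)) \<and>
     measure (density K u) (X -` B \<inter> space (density K u)) = (\<integral>z. u z * indicator B (X z) \<partial>K)"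
    if K: "finite_measure K" and [measurable]: "X \<in> borel_measurable K" "u \<in> borel_measurable K" for K
  proof -
    interpret K: finite_measure K by fact
    have ui: "integrable K u"
      by (rule K.integrable_const_bound[of _ C]) (use u in auto)
    have "emeasure (density K u) (space (density K u)) = ennreal (integral\<^sup>L K u)"
      using nn_integral_eq_integral[OF ui] u by (simp add: emeasure_density)
    then have "finite_measure (density K u)" by (intro finite_measureI) simp
    moreover have "(\<integral>z. iexp (t * X z) \<partial>density K u) = (\<integral>z. u z * iexp (t * X z) \<partial>K)" for t
      using u by (subst integral_density) (auto simp: scaleR_conv_of_real)
    moreover have "measure (density K u) (X -` B \<inter> space (density K u)) = (\<integral>z. u z * indicator B (X z) \<partial>K)"
    proof -
      have "measure (density K u) (X -` B \<inter> space (density K u))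
        = (\<integral>z. indicator (X -` B \<inter> space K) z \<partial>density K u)"
        by simp
      also have "\<dots> = (\<integral>z. u z *\<^sub>R indicator (X -` B \<inter> space K) z \<partial>K)"
        using u by (subst integral_density) auto
      also have "\<dots> = (\<integral>z. u z * indicator B (X z) \<partial>K)"
        by (rule Bochner_Integration.integral_cong) (auto simp: indicator_def)
      finally show ?thesis .
    qed
    ultimately show ?thesis by blast
  qed
  have "measure (density K1 u) (X -` B \<inter> space (density K1 u)) = measure (density K2 u) (X -` B \<inter> space (density K2 u))"
  proof (rule finite_measure_char_unique)
    show "finite_measure (density K1 u)" "finite_measure (density K2 u)"
      using *[of K1] *[of K2] assms(1,2) by auto
    show "(\<integral>z. iexp (t * X z) \<partial>density K1 u) = (\<integral>z. iexp (t * X z) \<partial>density K2 u)" for t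
      using *[of K1] *[of K2] assms(1,2) char by auto
  qed auto
  then show ?thesis using *[of K1] *[of K2] assms(1,2) by auto
qed

text \<open>The indicator of a cylinder set given by finitely many real functionals. A product of
  indicators, rather than a set, can be integrated against an exponential during the
  induction.\<close>

definition slab :: "('h::real_inner \<times> real set) list \<Rightarrow> 'h \<Rightarrow> real" where
  "slab L z = (\<Prod>(y, B)\<leftarrow>L. indicator B (inner y z))"

lemma slab_simps [simp]: "slab [] z = 1" "slab ((y, B) # L) z = indicator B (inner y z) * slab L z"
  by (simp_all add: slab_def)

lemma slab_bounds: "0 \<le> slab L z" "slab L z \<le> 1"
  by (induction L) (auto simp: indicator_def)

lemma inner_borel_measurable:
  fixes y :: "'h::real_inner"
  assumes "sets M = sets borel" shows "(\<lambda>z. inner y z) \<in> borel_measurable M"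
proof -
  have "(\<lambda>z. inner y z) \<in> borel_measurable borel"
    by (intro borel_measurable_continuous_onI continuous_intros)
  then show ?thesis by (simp add: measurable_cong_sets[OF assms refl])
qed

lemma slab_measurable:
  assumes M: "sets M = sets borel" and L: "\<And>y B. (y, B) \<in> set L \<Longrightarrow> B \<in> sets borel"
  shows "slab L \<in> borel_measurable M"
  using L
proof (induction L)
  case Nil
  then show ?case by (simp add: slab_def[abs_def])
next
  case (Cons p L)
  obtain y B where p: "p = (y, B)" by force
  note [measurable] = inner_borel_measurable[OF M, of y]
  have [measurable]: "B \<in> sets borel" using Cons.prems p by auto
  have [measurable]: "slab L \<in> borel_measurable M" by (rule Cons.IH) (use Cons.prems in auto)
  have "slab (p # L) = (\<lambda>z. indicator B (inner y z) * slab L z)" by (simp add: p fun_eq_iff)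
  then show ?case by simp
qed

text \<open>This reduces uniqueness to the line, one functional at a time: the exponential in x acts
  as a weight while the one-dimensional theorem is applied to the functional of y and turns its
  exponential into an indicator.\<close>

lemma integral_slab_iexp_unique:
  fixes M1 M2 :: "'h::real_inner measure"
  assumes fin: "finite_measure M1" "finite_measure M2" and M1: "sets M1 = sets borel" and M2: "sets M2 = sets borel"
    and char: "\<And>x. (\<integral>z. iexp (inner x z) \<partial>M1) = (\<integral>z. iexp (inner x z) \<partial>M2)"
    and L: "\<And>y B. (y, B) \<in> set L \<Longrightarrow> B \<in> sets borel"
  shows "(\<integral>z. slab L z * iexp (inner x z) \<partial>M1) = (\<integral>z. slab L z * iexp (inner x z) \<partial>M2)"
  using L
proof (induction L arbitrary: x)
  case Nil
  then show ?case using char by simp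
next
  case (Cons p L)
  obtain y B where p: "p = (y, B)" by force
  have B [measurable]: "B \<in> sets borel" using Cons.prems p by auto
  have IH: "(\<integral>z. slab L z * iexp (inner x z) \<partial>M1) = (\<integral>z. slab L z * iexp (inner x z) \<partial>M2)" for x
    by (rule Cons.IH) (use Cons.prems in auto)
  have Lm: "slab L \<in> borel_measurable M" if "sets M = sets borel" for M
    by (rule slab_measurable[OF that]) (use Cons.prems in auto)
  note [measurable] = inner_borel_measurable[OF M1] inner_borel_measurable[OF M2] Lm[OF M1] Lm[OF M2]
  have int: "integrable M (\<lambda>z. slab L z * iexp (inner x z))" if M: "finite_measure M" "sets M = sets borel" for M and x :: 'h
  proof -
    interpret finite_measure M by fact
    note [measurable] = inner_borel_measurable[OF M(2)] Lm[OF M(2)]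
    show ?thesis
      by (rule integrable_const_bound[of _ 1]) (use slab_bounds[of L] in \<open>auto simp: norm_mult\<close>)
  qed
  \<comment> \<open>A weight has to be nonnegative, which a complex exponential is not. For
    \<open>cmod c \<le> 1\<close> the second factor is nonnegative, and the values 0, 1 and -i of c
    make it 1, 1 + cos and 1 + sin.\<close>
  define u where "u c z = slab L z * (1 + Re (c * iexp (inner x z)))" for c z
  have u_eq: "of_real (u c z) * iexp (t * inner y z)
     = slab L z * iexp (inner (t *\<^sub>R y) z)
       + (c / 2) * (slab L z * iexp (inner (x + t *\<^sub>R y) z))
       + (cnj c / 2) * (slab L z * iexp (inner (t *\<^sub>R y - x) z))" for c z t
  proof -
    have Re: "complex_of_real (Re w) = (w + cnj w) / 2" for w by (simp add: complex_add_cnj)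
    have "cnj (c * iexp (inner x z)) = cnj c * iexp (- inner x z)" by (simp add: exp_cnj)
    then have "of_real (u c z) * iexp (t * inner y z)
      = slab L z * (1 + (c * iexp (inner x z) + cnj c * iexp (- inner x z)) / 2) * iexp (t * inner y z)"
      unfolding u_def by (simp only: of_real_mult of_real_add of_real_1 Re)
    then show ?thesis
      by (simp add: inner_add_left inner_diff_left exp_add exp_diff exp_minus field_simps)
  qed
  have ui: "(\<integral>z. of_real (u c z) * iexp (t * inner y z) \<partial>M)
     = (\<integral>z. slab L z * iexp (inner (t *\<^sub>R y) z) \<partial>M)
       + (c / 2) * (\<integral>z. slab L z * iexp (inner (x + t *\<^sub>R y) z) \<partial>M)
       + (cnj c / 2) * (\<integral>z. slab L z * iexp (inner (t *\<^sub>R y - x) z) \<partial>M)"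
    if M: "finite_measure M" "sets M = sets borel" for M c t
    unfolding u_eq
    by (simp only: Bochner_Integration.integral_add integral_mult_right_zero int[OF M] integrable_mult_right
        Bochner_Integration.integrable_add)
  have ueq: "(\<integral>z. u c z * indicator B (inner y z) \<partial>M1) = (\<integral>z. u c z * indicator B (inner y z) \<partial>M2)"
    if c: "cmod c \<le> 1" for c
  proof (rule finite_measure_weighted_char_unique[OF fin])
    have "\<bar>Re (c * iexp (inner x z))\<bar> \<le> 1" for z
      using abs_Re_le_cmod[of "c * iexp (inner x z)"] c by (simp add: norm_mult)
    then have b: "0 \<le> 1 + Re (c * iexp (inner x z))" "1 + Re (c * iexp (inner x z)) \<le> 2" for z
      by (smt (verit))+
    show "0 \<le> u c z" for z unfolding u_def using slab_bounds[of L z] b by (intro mult_nonneg_nonneg) auto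
    show "u c z \<le> 2" for z
      unfolding u_def using mult_mono[OF slab_bounds(2)[of L z] b(2)[of z]] b(1)[of z] by simp
    show "(\<integral>z. of_real (u c z) * iexp (t * inner y z) \<partial>M1) = (\<integral>z. of_real (u c z) * iexp (t * inner y z) \<partial>M2)" for t
      unfolding ui[OF fin(1) M1] ui[OF fin(2) M2] IH ..
    show "u c \<in> borel_measurable M1" unfolding u_def[abs_def] by measurable
  qed (use M1 M2 in auto)
  \<comment> \<open>The cosine and sine integrals are differences of weighted ones, and together
    they restore the complex exponential.\<close>
  have split: "(\<integral>z. slab (p # L) z * iexp (inner x z) \<partial>M)
     = of_real ((\<integral>z. u 1 z * indicator B (inner y z) \<partial>M) - (\<integral>z. u 0 z * indicator B (inner y z) \<partial>M))
       + \<i> * of_real ((\<integral>z. u (-\<i>) z * indicator B (inner y z) \<partial>M) - (\<integral>z. u 0 z * indicator B (inner y z) \<partial>M))"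
    if M: "finite_measure M" "sets M = sets borel" for M
  proof -
    interpret finite_measure M by fact
    note [measurable] = inner_borel_measurable[OF M(2)] Lm[OF M(2)]
    have ui: "integrable M (\<lambda>z. u c z * indicator B (inner y z))" for c
    proof (rule integrable_const_bound[of _ "1 + cmod c"])
      have "\<bar>1 + Re (c * iexp (inner x z))\<bar> \<le> 1 + cmod c" for z
        using abs_Re_le_cmod[of "c * iexp (inner x z)"] by (simp add: norm_mult)
      then have "\<bar>u c z\<bar> \<le> 1 * (1 + cmod c)" for z
        unfolding u_def abs_mult using slab_bounds[of L z] by (intro mult_mono) auto
      then show "AE z in M. norm (u c z * indicator B (inner y z)) \<le> 1 + cmod c"
        by (auto simp: indicator_def)
    qed (simp add: u_def)
    have "of_real (slab (p # L) z) * iexp (inner x z)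
      = of_real (u 1 z * indicator B (inner y z) - u 0 z * indicator B (inner y z))
       + \<i> * of_real (u (-\<i>) z * indicator B (inner y z) - u 0 z * indicator B (inner y z))" for z
      by (simp add: p u_def cis_conv_exp[symmetric] complex_eq_iff algebra_simps)
    then have "(\<integral>z. of_real (slab (p # L) z) * iexp (inner x z) \<partial>M)
      = (\<integral>z. of_real (u 1 z * indicator B (inner y z) - u 0 z * indicator B (inner y z))
       + \<i> * of_real (u (-\<i>) z * indicator B (inner y z) - u 0 z * indicator B (inner y z)) \<partial>M)" by simp
    also have "\<dots> = (\<integral>z. of_real (u 1 z * indicator B (inner y z) - u 0 z * indicator B (inner y z)) \<partial>M)
       + \<i> * (\<integral>z. of_real (u (-\<i>) z * indicator B (inner y z) - u 0 z * indicator B (inner y z)) \<partial>M)"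
      by (subst Bochner_Integration.integral_add)
        (intro integrable_of_real integrable_mult_right Bochner_Integration.integrable_diff ui | simp)+
    also have "\<dots> = of_real ((\<integral>z. u 1 z * indicator B (inner y z) \<partial>M) - (\<integral>z. u 0 z * indicator B (inner y z) \<partial>M))
       + \<i> * of_real ((\<integral>z. u (-\<i>) z * indicator B (inner y z) \<partial>M) - (\<integral>z. u 0 z * indicator B (inner y z) \<partial>M))"
      by (simp only: integral_complex_of_real Bochner_Integration.integral_diff[OF ui ui])
    finally show ?thesis .
  qed
  show ?case unfolding split[OF fin(1) M1] split[OF fin(2) M2] by (simp add: ueq)
qed

text \<open>A ball is the intersection of its supporting half-spaces. The condition is closed in the
  normal vector d, so a dense set of normals is enough, and a countable one keeps the intersection
  inside a \<sigma>-algebra.\<close>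

lemma cball_eq_dense_halfspaces:
  fixes a :: "'h::real_inner"
  assumes D: "closure D = UNIV" and r0: "r \<ge> 0"
  shows "cball a r = (\<Inter>d\<in>D. {z. inner d z \<le> inner d a + r * norm d})"
proof (intro equalityI subsetI)
  fix z assume "z \<in> cball a r"
  then have r: "norm (z - a) \<le> r" by (simp add: dist_norm norm_minus_commute)
  have "inner d z \<le> inner d a + r * norm d" for d
  proof -
    have "inner d (z - a) \<le> norm d * norm (z - a)" by (rule norm_cauchy_schwarz)
    also have "\<dots> \<le> norm d * r" by (rule mult_left_mono[OF r]) simp
    finally show ?thesis by (simp add: inner_diff_right mult.commute)
  qed
  then show "z \<in> (\<Inter>d\<in>D. {z. inner d z \<le> inner d a + r * norm d})" by simp
next
  fix z assume z: "z \<in> (\<Inter>d\<in>D. {z. inner d z \<le> inner d a + r * norm d})"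
  have "closed {d. inner d z \<le> inner d a + r * norm d}" by (intro closed_Collect_le continuous_intros)
  moreover have "D \<subseteq> {d. inner d z \<le> inner d a + r * norm d}" using z by auto
  ultimately have "closure D \<subseteq> {d. inner d z \<le> inner d a + r * norm d}" by (simp add: closure_minimal)
  then have all: "inner d z \<le> inner d a + r * norm d" for d using D by auto
  have "inner (z - a) (z - a) \<le> r * norm (z - a)"
    using all[of "z - a"] by (simp add: inner_diff_right)
  then have "norm (z - a) * norm (z - a) \<le> r * norm (z - a)"
    by (simp add: power2_norm_eq_inner[symmetric] power2_eq_square)
  then have "norm (z - a) \<le> r"
    using r0 by (metis mult_le_cancel_right norm_ge_zero not_less order_trans less_le)
  then show "z \<in> cball a r" by (simp add: dist_norm norm_minus_commute)
qed

text \<open>Separability enters twice: countably many normals yield each ball, and countably many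
  balls with centres in the dense set exhaust each open set.\<close>

lemma borel_eq_slabs:
  assumes "separable_type TYPE('h::real_inner)"
  shows "sets (borel :: 'h measure)
    = sigma_sets UNIV {{z. slab L z = 1} | L. \<forall>(y, B)\<in>set L. B \<in> sets borel}"
    (is "_ = sigma_sets UNIV ?E")
proof
  interpret E: sigma_algebra UNIV "sigma_sets UNIV ?E" by (rule sigma_algebra_sigma_sets) simp
  obtain D :: "'h set" where D: "countable D" "closure D = UNIV"
    using assms by (auto simp: separable_type_def)
  have halfspace: "{z. inner d z \<le> c} \<in> sigma_sets UNIV ?E" for d :: 'h and c
  proof (rule sigma_sets.Basic)
    have "{z. inner d z \<le> c} = {z. slab [(d, {..c})] z = 1}" by (auto simp: indicator_def)
    moreover have "\<forall>(y, B)\<in>set [(d, {..c})]. B \<in> sets borel" by simp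
    ultimately show "{z. inner d z \<le> c} \<in> ?E" by blast
  qed
  have D0: "D \<noteq> {}" using D(2) by auto
  have cball: "cball a r \<in> sigma_sets UNIV ?E" if "r \<ge> 0" for a :: 'h and r
    unfolding cball_eq_dense_halfspaces[OF D(2) that]
    by (rule E.countable_INT'') (auto intro: halfspace D(1))
  have open_gen: "sets (borel :: 'h measure) = sigma_sets UNIV {S. open S}"
    by (simp add: borel_def)
  have "sigma_sets UNIV {S. open S} \<subseteq> sigma_sets UNIV ?E"
  proof (rule E.sigma_sets_subset, rule subsetI)
    fix U :: "'h set" assume "U \<in> {S. open S}"
    then have U: "open U" by simp
    define I where "I = {(d, n::nat). d \<in> D \<and> cball d (1 / real (Suc n)) \<subseteq> U}"
    have "countable I"
      by (rule countable_subset[of _ "D \<times> UNIV"]) (auto simp: I_def intro: D(1))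
    have "U = (\<Union>(d, n)\<in>I. cball d (1 / real (Suc n)))"
    proof (intro equalityI subsetI)
      fix z assume z: "z \<in> U"
      obtain e where e: "e > 0" "ball z e \<subseteq> U" using U z open_contains_ball by blast
      obtain n where n: "1 / real (Suc n) < e / 2" using nat_approx_posE[of "e/2"] e by auto
      obtain d where d: "d \<in> D" "dist d z < 1 / real (Suc n)"
        using D(2) closure_approachable[of z D] by (metis UNIV_I of_nat_0_less_iff zero_less_Suc zero_less_divide_1_iff)
      have "cball d (1 / real (Suc n)) \<subseteq> U"
      proof
        fix y assume "y \<in> cball d (1 / real (Suc n))"
        then have "dist z y < e" using d(2) n dist_triangle[of z y d] by (simp add: dist_commute)
        then show "y \<in> U" using e by auto
      qed
      then have "(d, n) \<in> I" using d by (simp add: I_def)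
      moreover have "z \<in> cball d (1 / real (Suc n))" using d by simp
      ultimately show "z \<in> (\<Union>(d, n)\<in>I. cball d (1 / real (Suc n)))" by blast
    qed (auto simp: I_def)
    also have "\<dots> \<in> sigma_sets UNIV ?E"
      by (rule E.countable_UN') (auto intro!: cball \<open>countable I\<close>)
    finally show "U \<in> sigma_sets UNIV ?E" .
  qed
  then show "sets borel \<subseteq> sigma_sets UNIV ?E" by (simp only: open_gen)
  show "sigma_sets UNIV ?E \<subseteq> sets (borel :: 'h measure)"
  proof -
    have "?E \<subseteq> sets (borel :: 'h measure)"
    proof
      fix A assume "A \<in> ?E"
      then obtain L where L: "A = {z. slab L z = 1}" "\<forall>(y, B)\<in>set L. B \<in> sets borel" by auto
      have [measurable]: "slab L \<in> borel_measurable borel" by (rule slab_measurable) (use L(2) in auto)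
      have "{z \<in> space borel. slab L z = 1} \<in> sets borel" by measurable
      then show "A \<in> sets borel" by (simp add: L(1))
    qed
    then show ?thesis using sets.sigma_sets_subset[of ?E borel] by simp
  qed
qed

lemma slab_append: "slab (L @ L') z = slab L z * slab L' z"
  by (simp add: slab_def)

lemma slab_01: "slab L z = 0 \<or> slab L z = 1"
  by (induction L) (auto simp: indicator_def)

text \<open>Cylinder sets form an intersection-stable generator, and the measure of one is the
  integral of its indicator against the exponential of the zero functional. It is used for the image
  of \<open>m\<close> under \<open>T ^^ n\<close> and for densities with respect to
  \<open>m\<close>.\<close>

lemma hilbert_char_unique:
  fixes M1 M2 :: "'h::real_inner measure"
  assumes sep: "separable_type TYPE('h)"
    and fin: "finite_measure M1" "finite_measure M2" and M1: "sets M1 = sets borel" and M2: "sets M2 = sets borel"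
    and char: "\<And>x. (\<integral>z. iexp (inner x z) \<partial>M1) = (\<integral>z. iexp (inner x z) \<partial>M2)"
  shows "M1 = M2"
proof -
  define E where "E = {{z::'h. slab L z = 1} | L. \<forall>(y, B)\<in>set L. B \<in> sets borel}"
  have sp: "space M1 = UNIV" "space M2 = UNIV"
    using sets_eq_imp_space_eq[OF M1] sets_eq_imp_space_eq[OF M2] by auto
  show ?thesis
  proof (rule measure_eqI_generator_eq[where E=E and \<Omega>=UNIV and A="\<lambda>i. UNIV"])
    show "Int_stable E"
    proof (rule Int_stableI)
      fix a b assume "a \<in> E" "b \<in> E"
      then obtain L L' where L: "a = {z. slab L z = 1}" "\<forall>(y, B)\<in>set L. B \<in> sets borel"
        and L': "b = {z. slab L' z = 1}" "\<forall>(y, B)\<in>set L'. B \<in> sets borel" unfolding E_def by blast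
      have "a \<inter> b = {z. slab (L @ L') z = 1}"
        unfolding L(1) L'(1) slab_append using slab_01[of L] slab_01[of L'] by auto (metis mult_1 mult_zero_left)+
      moreover have "\<forall>(y, B)\<in>set (L @ L'). B \<in> sets borel" using L(2) L'(2) by auto
      ultimately show "a \<inter> b \<in> E" unfolding E_def by blast
    qed
    show "sets M1 = sigma_sets UNIV E" "sets M2 = sigma_sets UNIV E"
      using M1 M2 borel_eq_slabs[OF sep] by (simp_all add: E_def)
    show "range (\<lambda>i. UNIV) \<subseteq> E"
      unfolding E_def by (auto intro!: exI[of _ "[]"])
    show "emeasure M1 UNIV \<noteq> \<infinity>"
      using finite_measure.emeasure_finite[OF fin(1)] by auto
    fix A assume "A \<in> E"
    then obtain L where L: "A = {z. slab L z = 1}" "\<forall>(y, B)\<in>set L. B \<in> sets borel" unfolding E_def by blast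
    have m: "emeasure M A = ennreal (Re (\<integral>z. slab L z * iexp (inner 0 z) \<partial>M))"
      if M: "finite_measure M" "sets M = sets borel" for M
    proof -
      interpret finite_measure M by fact
      have [measurable]: "slab L \<in> borel_measurable M" by (rule slab_measurable[OF M(2)]) (use L(2) in auto)
      have sM: "space M = UNIV" using sets_eq_imp_space_eq[OF M(2)] by simp
      have "{z \<in> space M. slab L z = 1} \<in> sets M" by measurable
      then have A: "A \<in> sets M" by (simp add: L(1) sM)
      have "slab L = indicator A"
        using slab_01[of L] by (auto simp: fun_eq_iff L(1) indicator_def)
      then have "(\<integral>z. slab L z * iexp (inner 0 z) \<partial>M) = of_real (\<integral>z. indicator A z \<partial>M)"
        by simp
      also have "(\<integral>z. indicator A z \<partial>M) = measure M A" using A by simp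
      finally show ?thesis by (simp add: emeasure_eq_measure)
    qed
    show "emeasure M1 A = emeasure M2 A"
      unfolding m[OF fin(1) M1] m[OF fin(2) M2]
      by (subst integral_slab_iexp_unique[OF fin M1 M2 char]) (use L(2) in auto)
  qed auto
qed

section \<open>Riemann sums on the circle\<close>

text \<open>Continuity is asked only on the half-open interval, since the eigenvector field may jump
  at its end. Left end points stay inside the interval, and the bounded step functions built on them
  converge by dominated convergence.\<close>

lemma riemann_sum_tendsto:
  fixes F :: "real \<Rightarrow> complex"
  assumes cont: "continuous_on {0..<2*pi} F" and B: "\<And>t. t \<in> {0..<2*pi} \<Longrightarrow> norm (F t) \<le> B"
  shows "(\<lambda>N. (\<Sum>s<N. F (2*pi * real s / real N)) / of_nat N) \<longlonglongrightarrow>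
    (\<integral>t. F t \<partial>lebesgue_on {0..<2*pi}) / of_real (2*pi)"
proof -
  let ?L = "lebesgue_on {0..<2*pi}"
  define w where "w N = 2 * pi / real N" for N :: nat
  define G where "G N t = (\<Sum>s<N. indicator {w N * real s..<w N * real (Suc s)} t *\<^sub>R F (w N * real s))" for N :: nat and t
  have fin: "finite_measure ?L"
    by (intro finite_measureI) (simp add: emeasure_restrict_space space_restrict_space)
  interpret finite_measure ?L by (rule fin)
  have [measurable]: "F \<in> borel_measurable ?L"
    by (intro continuous_imp_measurable_on_sets_lebesgue cont) auto
  have im: "(\<lambda>t. indicator {a..<b} t *\<^sub>R c) \<in> borel_measurable ?L" for a b :: real and c :: complex
  proof -
    have "(\<lambda>t. indicator {a..<b} t *\<^sub>R c) \<in> borel_measurable lborel" by measurable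
    then have "(\<lambda>t. indicator {a..<b} t *\<^sub>R c) \<in> borel_measurable lebesgue"
      by (rule measurable_completion)
    then show ?thesis by (rule measurable_restrict_space1)
  qed
  have Gm [measurable]: "G N \<in> borel_measurable ?L" for N
    unfolding G_def[abs_def] by (intro borel_measurable_sum im)
  have Gval: "G N t = F (w N * real (nat \<lfloor>t / w N\<rfloor>))" "nat \<lfloor>t / w N\<rfloor> < N" "w N * real (nat \<lfloor>t / w N\<rfloor>) \<le> t" "t - w N \<le> w N * real (nat \<lfloor>t / w N\<rfloor>)"
    if N: "N > 0" and t: "t \<in> {0..<2*pi}" for N t
  proof -
    have w: "w N > 0" using N by (simp add: w_def)
    define k where "k = nat \<lfloor>t / w N\<rfloor>"
    have fl: "real k \<le> t / w N" "t / w N < real k + 1"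
      using t w by (simp_all add: k_def of_nat_nat)
    then have k: "w N * real k \<le> t" "t < w N * real (Suc k)"
      using w by (simp_all add: field_simps)
    have "w N * real k < w N * real N" using k(1) t N by (simp add: w_def)
    then have kN: "k < N" using w by simp
    have uniq: "t \<in> {w N * real s..<w N * real (Suc s)} \<longleftrightarrow> s = k" for s
    proof
      assume s: "t \<in> {w N * real s..<w N * real (Suc s)}"
      then have "w N * real s < w N * real (Suc k)" "w N * real k < w N * real (Suc s)" using k by auto
      then have "s < Suc k" "k < Suc s" using w by (simp_all only: mult_less_cancel_left_pos of_nat_less_iff)
      then show "s = k" by simp
    qed (use k in auto)
    have "G N t = (\<Sum>s<N. if s = k then F (w N * real k) else 0)"
      unfolding G_def
    proof (rule sum.cong)
      fix s
      have "indicator {w N * real s..<w N * real (Suc s)} t = (if s = k then 1 else 0 :: real)"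
        unfolding indicator_def uniq by simp
      then show "indicator {w N * real s..<w N * real (Suc s)} t *\<^sub>R F (w N * real s) = (if s = k then F (w N * real k) else 0)"
        by simp
    qed simp
    also have "\<dots> = F (w N * real k)" using kN by simp
    finally show "G N t = F (w N * real (nat \<lfloor>t / w N\<rfloor>))" by (simp add: k_def)
    show "nat \<lfloor>t / w N\<rfloor> < N" "w N * real (nat \<lfloor>t / w N\<rfloor>) \<le> t" "t - w N \<le> w N * real (nat \<lfloor>t / w N\<rfloor>)"
      using kN k by (simp_all add: k_def[symmetric] algebra_simps)
  qed
  have in_range: "w N * real s \<in> {0..<2*pi}" if "s < N" for s N
    using that by (auto simp: w_def field_simps)
  have GN: "(\<integral>t. G N t \<partial>?L) / of_real (2*pi) = (\<Sum>s<N. F (2*pi * real s / real N)) / of_nat N" if N: "N > 0" for N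
  proof -
    have w: "w N > 0" using N by (simp add: w_def)
    have one: "(\<integral>t. indicator {w N * real s..<w N * real (Suc s)} t *\<^sub>R F (w N * real s) \<partial>?L) = of_real (w N) * F (w N * real s)"
      if s: "s < N" for s
    proof -
      have sub: "{w N * real s..<w N * real (Suc s)} \<subseteq> {0..<2*pi}"
      proof -
        have "w N * real (Suc s) \<le> w N * real N" using s w by (intro mult_left_mono) auto
        also have "\<dots> = 2 * pi" using N by (simp add: w_def)
        finally show ?thesis using w by (auto intro: order_trans[OF mult_nonneg_nonneg])
      qed
      have "(\<integral>t. indicator {w N * real s..<w N * real (Suc s)} t *\<^sub>R F (w N * real s) \<partial>?L)
        = measure ?L {w N * real s..<w N * real (Suc s)} *\<^sub>R F (w N * real s)"
      proof (rule has_bochner_integral_integral_eq[OF has_bochner_integral_indicator])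
        show "{w N * real s..<w N * real (Suc s)} \<in> sets ?L"
          using sub by (subst sets_restrict_space_iff) auto
        show "emeasure ?L {w N * real s..<w N * real (Suc s)} < \<infinity>"
          by (simp add: emeasure_eq_measure)
      qed
      also have "measure ?L {w N * real s..<w N * real (Suc s)} = w N"
        using sub w by (simp add: measure_restrict_space algebra_simps)
      finally show ?thesis by (simp add: scaleR_conv_of_real)
    qed
    have "(\<integral>t. G N t \<partial>?L) = (\<Sum>s<N. (\<integral>t. indicator {w N * real s..<w N * real (Suc s)} t *\<^sub>R F (w N * real s) \<partial>?L))"
      unfolding G_def
    proof (rule Bochner_Integration.integral_sum)
      fix s
      show "integrable ?L (\<lambda>t. indicator {w N * real s..<w N * real (Suc s)} t *\<^sub>R F (w N * real s))"
        by (rule integrable_const_bound[where B="norm (F (w N * real s))", OF _ im]) (auto simp: indicator_def)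
    qed
    also have "\<dots> = of_real (w N) * (\<Sum>s<N. F (w N * real s))"
      unfolding sum_distrib_left by (rule sum.cong) (auto simp only: lessThan_iff one)
    finally have e: "(\<integral>t. G N t \<partial>?L) = of_real (w N) * (\<Sum>s<N. F (w N * real s))" .
    have "(\<Sum>s<N. F (w N * real s)) = (\<Sum>s<N. F (2*pi * real s / real N))" by (simp add: w_def)
    then show ?thesis unfolding e by (simp add: w_def)
  qed
  have "(\<lambda>N. \<integral>t. G N t \<partial>?L) \<longlonglongrightarrow> (\<integral>t. F t \<partial>?L)"
  proof (rule integral_dominated_convergence[where w="\<lambda>_. B"])
    show "AE t in ?L. norm (G N t) \<le> B" for N
    proof (rule AE_I2)
      fix t assume "t \<in> space ?L"
      then have t: "t \<in> {0..<2*pi}" by (simp add: space_restrict_space)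
      show "norm (G N t) \<le> B"
      proof (cases "N > 0")
        case True
        then show ?thesis unfolding Gval(1)[OF True t] by (intro B in_range Gval(2) t)
      next
        case False
        \<comment> \<open>For \<open>N = 0\<close> the step function is an empty sum, and the bound
          holds because B dominates a norm.\<close>
        then show ?thesis using order_trans[OF norm_ge_zero B[OF t]] by (simp add: G_def)
      qed
    qed
    show "AE t in ?L. (\<lambda>N. G N t) \<longlonglongrightarrow> F t"
    proof (rule AE_I2)
      fix t assume "t \<in> space ?L"
      then have t: "t \<in> {0..<2*pi}" by (simp add: space_restrict_space)
      define p where "p N = w N * real (nat \<lfloor>t / w N\<rfloor>)" for N
      have "(\<lambda>N. t - w N) \<longlonglongrightarrow> t - 0"
        unfolding w_def by (intro tendsto_intros tendsto_divide_0[OF tendsto_const] filterlim_at_top_imp_at_infinity filterlim_real_sequentially)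
      then have wl: "(\<lambda>N. t - w N) \<longlonglongrightarrow> t" by simp
      have "p \<longlonglongrightarrow> t"
        by (rule tendsto_sandwich[OF _ _ wl tendsto_const])
           (use Gval(3,4)[OF _ t] in \<open>auto simp: p_def eventually_sequentially intro!: exI[of _ 1]\<close>)
      moreover have "\<forall>\<^sub>F N in sequentially. p N \<in> {0..<2*pi}"
        unfolding eventually_sequentially p_def using in_range Gval(2)[OF _ t] by (intro exI[of _ 1]) simp
      ultimately have "(\<lambda>N. F (p N)) \<longlonglongrightarrow> F t"
        using continuous_on_tendsto_compose[OF cont _ t] by blast
      moreover have "\<forall>\<^sub>F N in sequentially. F (p N) = G N t"
        unfolding eventually_sequentially p_def using Gval(1)[OF _ t] by (intro exI[of _ 1]) simp
      ultimately show "(\<lambda>N. G N t) \<longlonglongrightarrow> F t" by (rule Lim_transform_eventually)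
    qed
  qed auto
  then have "(\<lambda>N. (\<integral>t. G N t \<partial>?L) / of_real (2*pi)) \<longlonglongrightarrow> (\<integral>t. F t \<partial>?L) / of_real (2*pi)"
    by (intro tendsto_intros) auto
  moreover have "\<forall>\<^sub>F N in sequentially. (\<integral>t. G N t \<partial>?L) / of_real (2*pi) = (\<Sum>s<N. F (2*pi * real s / real N)) / of_nat N"
    unfolding eventually_sequentially by (intro exI[of _ 1] allI impI GN) simp
  ultimately show ?thesis by (rule Lim_transform_eventually)
qed

text \<open>The q-th roots of unity add up to 0 as soon as there are two of them. This is the
  discrete form of the cancellation of the oscillating factor over one of its periods.\<close>

lemma sum_cis_block:
  assumes "q \<ge> 2" shows "(\<Sum>r<q. cis (2*pi * real r / real q)) = 0"
proof -
  define z where "z = cis (2*pi / real q)"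
  have "z \<noteq> 1"
  proof
    assume "z = 1"
    then have "cos (2*pi / real q) = 1" by (simp add: z_def complex_eq_iff)
    then obtain x :: int where "2*pi / real q = real_of_int x * 2 * pi" using cos_one_2pi_int by auto
    then have "(2 * pi) * (1 / real q) = (2 * pi) * real_of_int x" by (simp add: mult_ac)
    then have "1 / real q = real_of_int x" by (simp only: mult_cancel_left) simp
    moreover have "0 < 1 / real q" "1 / real q < 1" using assms by auto
    ultimately show False by simp
  qed
  have "z ^ q = 1" by (simp only: z_def Complex.DeMoivre) (use assms in simp)
  have "(\<Sum>r<q. z ^ r) = 0" using geometric_sum[OF \<open>z \<noteq> 1\<close>, of q] \<open>z ^ q = 1\<close> by simp
  then show ?thesis by (simp add: z_def Complex.DeMoivre mult_ac)
qed

lemma sum_lessThan_mult: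
  fixes f :: "nat \<Rightarrow> 'a::comm_monoid_add"
  shows "(\<Sum>s<n * q. f s) = (\<Sum>p<n. \<Sum>r<q. f (p * q + r))"
  by (simp add: sum.nat_group[symmetric] mult.commute sum.atLeastLessThan_shift_0 atLeast0LessThan)

section \<open>The Gaussian measure of an eigenvector field\<close>

lemma iexp_diff_le: "cmod (iexp a - iexp b) \<le> \<bar>a - b\<bar>"
proof -
  have "iexp a - iexp b = iexp b * (iexp (a - b) - 1)" by (simp add: exp_diff right_diff_distrib)
  then have "cmod (iexp a - iexp b) = cmod (iexp (a - b) - 1)" by (simp add: norm_mult)
  also have "\<dots> \<le> \<bar>a - b\<bar>" using iexp_approx1[of "a - b" 0] by simp
  finally show ?thesis .
qed

locale hilbert_gauss =
  fixes J T :: "'h::{real_inner,complete_space} \<Rightarrow> 'h"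
    and E :: "complex \<Rightarrow> 'h"
    and \<alpha> :: real
    and m :: "'h measure"
    and e :: "nat \<Rightarrow> 'h"
  assumes J: "complex_structure J"
    and sep: "separable_type TYPE('h)"
    and T: "bounded_linear T" and TJ: "\<forall>x. T (J x) = J (T x)"
    and TE: "T_eigenvector_field J T E"
    and \<alpha>: "0 < \<alpha>" and hold: "holderian \<alpha> E"
    and gm: "gaussian_measure J E m"
    and eb: "R_eigenbasis J E e"
begin

lemma J_linear: "linear J" and J_J [simp]: "J (J x) = - x" and inner_J_J [simp]: "inner (J x) (J y) = inner x y"
  using J by (auto simp: complex_structure_def)

lemma inner_J_right: "inner x (J z) = - inner (J x) z"
  using inner_J_J[of x "J z"] inner_J_J[of "J x" z] by simp

lemma Re_cinner [simp]: "Re (cinner J x z) = inner x z" and Im_cinner: "Im (cinner J x z) = inner (J x) z"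
  by (simp_all add: cinner_def inner_J_right)

lemma Re_cinner_cnj: "Re (cinner J x u * cnj (cinner J y v)) = inner x u * inner y v + inner (J x) u * inner (J y) v"
  by (simp add: Im_cinner)

lemma sets_m: "sets m = sets borel" and prob_m: "prob_space m"
  using gm by (auto simp: gaussian_measure_def)

sublocale P: prob_space m by (rule prob_m)

lemma inner_m_measurable [measurable]: "(\<lambda>z. inner x z) \<in> borel_measurable m"
  by (rule inner_borel_measurable[OF sets_m])

lemma cinner_complex_symmetric_gaussian: "complex_symmetric_gaussian m (\<lambda>z. cinner J x z)"
  using gm by (auto simp: gaussian_measure_def)

lemma inner_L2R: "(\<lambda>z. inner x z) \<in> L2R m"
proof -
  have "integrable m (\<lambda>z. cinner J x z * cnj (cinner J x z))"
    using gm by (auto simp: gaussian_measure_def)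
  then have "integrable m (\<lambda>z. Re (cinner J x z * cnj (cinner J x z)))" by (rule integrable_Re)
  then have "integrable m (\<lambda>z. (inner x z)\<^sup>2 + (inner (J x) z)\<^sup>2)"
    unfolding Re_cinner_cnj by (simp add: power2_eq_square)
  then have "integrable m (\<lambda>z. (inner x z)\<^sup>2)"
    by (rule Bochner_Integration.integrable_bound) auto
  then show ?thesis by (simp add: L2R_def)
qed

lemma normal_char:
  assumes d: "distributed m lborel X (normal_density 0 \<sigma>)" and \<sigma>: "\<sigma> > 0"
  shows "(\<integral>z. iexp (X z) \<partial>m) = exp (- complex_of_real (\<sigma>\<^sup>2) / 2)" "(\<integral>z. (X z)\<^sup>2 \<partial>m) = \<sigma>\<^sup>2"
proof -
  have d': "distributed m lborel (\<lambda>x. X x / \<sigma>) std_normal_density"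
    using P.normal_standard_normal_convert[OF \<sigma>, of X 0] d by simp
  have Xm [measurable]: "X \<in> borel_measurable m" using distributed_measurable[OF d] by simp
  have eq: "distr m borel (\<lambda>x. X x / \<sigma>) = std_normal_distribution"
    using distributed_distr_eq_density[OF d'] by (simp cong: distr_cong)
  have "(\<integral>z. iexp (X z) \<partial>m) = char (distr m borel (\<lambda>x. X x / \<sigma>)) \<sigma>"
    unfolding char_def using \<sigma> by (subst integral_distr) auto
  also have "\<dots> = exp (- complex_of_real (\<sigma>\<^sup>2) / 2)"
    unfolding eq char_std_normal_distribution by (simp add: exp_of_real[symmetric])
  finally show "(\<integral>z. iexp (X z) \<partial>m) = exp (- complex_of_real (\<sigma>\<^sup>2) / 2)" .
  have "(\<integral>z. (X z)\<^sup>2 \<partial>m) = (\<integral>z. \<sigma>\<^sup>2 * (X z / \<sigma>)\<^sup>2 \<partial>m)" using \<sigma> by (simp add: power_divide)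
  also have "\<dots> = \<sigma>\<^sup>2 * (\<integral>x. x\<^sup>2 \<partial>distr m borel (\<lambda>x. X x / \<sigma>))" by (subst integral_distr) auto
  also have "\<dots> = \<sigma>\<^sup>2"
    unfolding eq using std_normal_distribution_even_moments(1)[of 1] by simp
  finally show "(\<integral>z. (X z)\<^sup>2 \<partial>m) = \<sigma>\<^sup>2" .
qed

text \<open>The real and imaginary parts of \<open>cinner J x\<close> have the same variance, and
  passing from x to \<open>J x\<close> turns the former into the latter. The almost surely zero case
  fits the same formula with variance 0.\<close>

lemma inner_gauss:
  "(\<integral>z. iexp (inner x z) \<partial>m) = exp (- complex_of_real (\<integral>z. (inner x z)\<^sup>2 \<partial>m) / 2)"
  "(\<integral>z. (inner (J x) z)\<^sup>2 \<partial>m) = (\<integral>z. (inner x z)\<^sup>2 \<partial>m)"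
proof -
  have "(\<integral>z. iexp (inner x z) \<partial>m) = exp (- complex_of_real (\<integral>z. (inner x z)\<^sup>2 \<partial>m) / 2) \<and>
     (\<integral>z. (inner (J x) z)\<^sup>2 \<partial>m) = (\<integral>z. (inner x z)\<^sup>2 \<partial>m)"
  proof (cases "AE z in m. cinner J x z = 0")
    case True
    then have ae: "AE z in m. inner x z = 0" "AE z in m. inner (J x) z = 0"
      by (eventually_elim, simp add: complex_eq_iff Im_cinner)+
    have "(\<integral>z. (inner x z)\<^sup>2 \<partial>m) = (\<integral>z. 0 \<partial>m)" "(\<integral>z. (inner (J x) z)\<^sup>2 \<partial>m) = (\<integral>z. 0 \<partial>m)"
      by (rule integral_cong_AE; use ae in auto)+
    moreover have "(\<integral>z. iexp (inner x z) \<partial>m) = (\<integral>z. 1 \<partial>m)"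
      by (rule integral_cong_AE; use ae in auto)
    ultimately show ?thesis by (simp add: P.prob_space)
  next
    case False
    then obtain \<sigma> where "\<sigma> > 0" "distributed m lborel (\<lambda>z. inner x z) (normal_density 0 \<sigma>)"
      "distributed m lborel (\<lambda>z. inner (J x) z) (normal_density 0 \<sigma>)"
      using cinner_complex_symmetric_gaussian[of x] by (auto simp: complex_symmetric_gaussian_def Im_cinner)
    then show ?thesis using normal_char by metis
  qed
  then show "(\<integral>z. iexp (inner x z) \<partial>m) = exp (- complex_of_real (\<integral>z. (inner x z)\<^sup>2 \<partial>m) / 2)"
    "(\<integral>z. (inner (J x) z)\<^sup>2 \<partial>m) = (\<integral>z. (inner x z)\<^sup>2 \<partial>m)" by blast+
qed

section \<open>The real covariance and its expression through the eigenvector field\<close>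

definition cov :: "'h \<Rightarrow> 'h \<Rightarrow> real" where
  "cov x y = (\<integral>z. inner x z * inner y z \<partial>m)"

lemma cov_integrable: "integrable m (\<lambda>z. inner x z * inner y z)"
  by (rule L2R_mult_integrable[OF inner_L2R inner_L2R])

lemma cov_self: "(\<integral>z. (inner x z)\<^sup>2 \<partial>m) = cov x x"
  by (simp add: cov_def power2_eq_square)

lemma cov_add_self: "cov (x + y) (x + y) = cov x x + 2 * cov x y + cov y y"
proof -
  have "cov (x + y) (x + y) = (\<integral>z. inner x z * inner x z + 2 * (inner x z * inner y z) + inner y z * inner y z \<partial>m)"
    by (simp add: cov_def inner_add_left algebra_simps)
  also have "\<dots> = cov x x + 2 * cov x y + cov y y"
    by (simp add: cov_def cov_integrable)
  finally show ?thesis .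
qed

lemma cov_J: "cov (J x) (J y) = cov x y"
proof -
  have "cov (J (x + y)) (J (x + y)) = cov (x + y) (x + y)" "cov (J x) (J x) = cov x x" "cov (J y) (J y) = cov y y"
    using inner_gauss(2) by (simp_all add: cov_self)
  then show ?thesis
    using cov_add_self[of x y] cov_add_self[of "J x" "J y"] by (simp add: linear_add[OF J_linear])
qed

text \<open>The real part of the complex covariance adds those of the real and of the imaginary
  parts, which agree; hence the factor 1/2, which reappears in the weights of the
  discretisation.\<close>

lemma cov_R_form: "cov x y = Re (R_form J E x y) / 2"
proof -
  have i: "integrable m (\<lambda>z. cinner J x z * cnj (cinner J y z))"
    and R: "(\<integral>z. cinner J x z * cnj (cinner J y z) \<partial>m) = R_form J E x y"
    using gm by (auto simp: gaussian_measure_def)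
  have "Re (R_form J E x y) = (\<integral>z. inner x z * inner y z + inner (J x) z * inner (J y) z \<partial>m)"
    unfolding R[symmetric] integral_Re[OF i, symmetric] Re_cinner_cnj ..
  also have "\<dots> = 2 * cov x y"
    using cov_J[of x y] by (simp add: cov_integrable cov_def)
  finally show ?thesis by simp
qed

lemma E_bounded: obtains M where "M > 0" "\<And>l. l \<in> sphere 0 1 \<Longrightarrow> norm (E l) \<le> M"
proof -
  obtain M where "\<forall>l\<in>sphere 0 1. norm (E l) \<le> M" using TE by (auto simp: T_eigenvector_field_def)
  then show ?thesis using that[of "\<bar>M\<bar> + 1"] by fastforce
qed

lemma E_cis_continuous: "continuous_on {0..<2*pi} (\<lambda>\<theta>. E (cis \<theta>))"
proof -
  obtain C where C: "C > 0" "\<forall>\<theta>\<in>{0..<2*pi}. \<forall>\<theta>'\<in>{0..<2*pi}. norm (E (cis \<theta>) - E (cis \<theta>')) \<le> C * \<bar>\<theta> - \<theta>'\<bar> powr \<alpha>"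
    using hold by (auto simp: holderian_def)
  show ?thesis
    unfolding continuous_on_def
  proof
    fix \<theta> assume \<theta>: "\<theta> \<in> {0..<2*pi}"
    have "((\<lambda>t. \<bar>t - \<theta>\<bar> powr \<alpha>) \<longlongrightarrow> 0) (at \<theta> within {0..<2*pi})"
    proof (rule tendsto_eq_rhs)
      have "((\<lambda>t. \<bar>t - \<theta>\<bar>) \<longlongrightarrow> \<bar>\<theta> - \<theta>\<bar>) (at \<theta> within {0..<2*pi})" by (intro tendsto_intros)
      then show "((\<lambda>t. \<bar>t - \<theta>\<bar> powr \<alpha>) \<longlongrightarrow> 0 powr \<alpha>) (at \<theta> within {0..<2*pi})"
        by (intro tendsto_powr' tendsto_const) (use \<alpha> in auto)
    qed simp
    then have lim: "((\<lambda>t. C * \<bar>t - \<theta>\<bar> powr \<alpha>) \<longlongrightarrow> 0) (at \<theta> within {0..<2*pi})"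
      using tendsto_mult_right_zero by blast
    have "((\<lambda>t. E (cis t) - E (cis \<theta>)) \<longlongrightarrow> 0) (at \<theta> within {0..<2*pi})"
      by (rule Lim_null_comparison[OF _ lim]) (use C \<theta> in \<open>auto simp: eventually_at_filter\<close>)
    then show "((\<lambda>t. E (cis t)) \<longlongrightarrow> E (cis \<theta>)) (at \<theta> within {0..<2*pi})" by (simp add: Lim_null[symmetric])
  qed
qed

lemma cinner_continuous: "continuous_on S f \<Longrightarrow> continuous_on S (\<lambda>t. cinner J x (f t))"
proof -
  assume f: "continuous_on S f"
  have eq: "(\<lambda>t. cinner J x (f t)) = (\<lambda>t. of_real (inner x (f t)) + \<i> * of_real (inner (J x) (f t)))"
    by (simp add: fun_eq_iff complex_eq_iff Im_cinner)
  show "continuous_on S (\<lambda>t. cinner J x (f t))"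
    unfolding eq by (intro continuous_intros f)
qed

lemma norm_J [simp]: "norm (J x) = norm x"
  by (simp add: norm_eq_sqrt_inner)

lemma norm_cinner: "cmod (cinner J x z) \<le> 2 * norm x * norm z"
proof -
  have "cmod (cinner J x z) \<le> \<bar>inner x z\<bar> + \<bar>inner (J x) z\<bar>"
    using cmod_le[of "cinner J x z"] by (simp add: Im_cinner)
  also have "\<dots> \<le> norm x * norm z + norm (J x) * norm z"
    by (intro add_mono Cauchy_Schwarz_ineq2)
  finally show ?thesis by simp
qed

text \<open>The map from x to the function \<open>inner x\<close> is bounded into L2. This lets
  density of the span of the eigenbasis in the Hilbert space pass to density in L2.\<close>

lemma cov_bound: obtains K where "K \<ge> 0" "\<And>x. cov x x \<le> K * (norm x)\<^sup>2"
proof -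
  obtain M where M: "M > 0" "\<And>l. l \<in> sphere 0 1 \<Longrightarrow> norm (E l) \<le> M" using E_bounded by metis
  have "cov x x \<le> (4 * M\<^sup>2) * (norm x)\<^sup>2" for x
  proof -
    define h where "h \<theta> = cinner J x (E (cis \<theta>)) * cnj (cinner J x (E (cis \<theta>)))" for \<theta>
    have hb: "norm (h \<theta>) \<le> 4 * M\<^sup>2 * (norm x)\<^sup>2" for \<theta>
    proof -
      have "cmod (cinner J x (E (cis \<theta>))) \<le> 2 * norm x * M"
        using norm_cinner[of x "E (cis \<theta>)"] M(2)[of "cis \<theta>"]
        by (smt (verit) mult_left_mono norm_ge_zero norm_cis mem_sphere_0)
      then have "cmod (cinner J x (E (cis \<theta>))) * cmod (cinner J x (E (cis \<theta>))) \<le> (2 * norm x * M) * (2 * norm x * M)"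
        using M(1) by (intro mult_mono) auto
      then show ?thesis by (simp add: h_def norm_mult power2_eq_square mult_ac)
    qed
    have "h \<in> borel_measurable (lebesgue_on {0..<2*pi})"
      unfolding h_def[abs_def]
      by (intro continuous_imp_measurable_on_sets_lebesgue continuous_intros cinner_continuous E_cis_continuous) auto
    moreover have fin: "finite_measure (lebesgue_on {0..<2*pi})"
      by (intro finite_measureI) (simp add: emeasure_restrict_space space_restrict_space)
    ultimately have ih: "integrable (lebesgue_on {0..<2*pi}) h"
      by (intro finite_measure.integrable_const_bound[where B="4 * M\<^sup>2 * (norm x)\<^sup>2"]) (auto simp: hb)
    have "norm (\<integral>\<theta>. h \<theta> \<partial>lebesgue_on {0..<2*pi}) \<le> (\<integral>\<theta>. 4 * M\<^sup>2 * (norm x)\<^sup>2 \<partial>lebesgue_on {0..<2*pi})"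
      by (rule order_trans[OF integral_norm_bound integral_mono])
         (auto intro: hb ih finite_measure.integrable_const[OF fin])
    also have "\<dots> = (2 * pi) * (4 * M\<^sup>2 * (norm x)\<^sup>2)"
      by (simp add: measure_restrict_space space_restrict_space)
    finally have "norm (R_form J E x x) \<le> 4 * M\<^sup>2 * (norm x)\<^sup>2"
      by (simp add: R_form_def circ_integral_def h_def norm_divide field_simps)
    moreover have "Re (R_form J E x x) \<le> norm (R_form J E x x)" by (rule complex_Re_le_cmod)
    ultimately show ?thesis unfolding cov_R_form
      by (smt (verit) field_sum_of_halves norm_ge_zero)
  qed
  then show ?thesis by (intro that[of "4 * M\<^sup>2"]) auto
qed

section \<open>The Gaussian space of the coordinate functionals\<close>

definition frak :: "int \<Rightarrow> 'h" where "frak = frak_e J e"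

lemma gvar_eq: "gvar J e k = (\<lambda>z. inner (frak k) z)"
  by (simp add: gvar_def frak_def fun_eq_iff)

abbreviation "gvar_span \<equiv> fspan {gvar J e k | k. k \<noteq> 0}"

abbreviation "coef \<equiv> alpha_coef J e m"

lemma inner_fspan:
  assumes "x \<in> cspan J (e ` {1..})"
  shows "(\<lambda>z. inner x z) \<in> gvar_span"
proof -
  obtain n c v where v: "\<forall>i<n. v i \<in> e ` {1..}" and x: "x = (\<Sum>i<n::nat. cscale J (c i) (v i))"
    using assms unfolding cspan_def by blast
  have 1: "(\<lambda>z. inner (e j) z) \<in> gvar_span"
    "(\<lambda>z. inner (J (e j)) z) \<in> gvar_span" if "j \<ge> 1" for j :: nat
  proof -
    have "gvar J e (int j) = (\<lambda>z. inner (e j) z)" "gvar J e (- int j) = (\<lambda>z. inner (J (e j)) z)"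
      using that by (auto simp: gvar_eq frak_def frak_e_def)
    moreover have "gvar J e (int j) \<in> gvar_span" "gvar J e (- int j) \<in> gvar_span"
      using that by (auto intro!: fspan_base) 
    ultimately show "(\<lambda>z. inner (e j) z) \<in> gvar_span"
    "(\<lambda>z. inner (J (e j)) z) \<in> gvar_span" by auto
  qed
  have "(\<lambda>z. \<Sum>i<n. Re (c i) * inner (v i) z + Im (c i) * inner (J (v i)) z) \<in> gvar_span"
    by (intro fspan_sum fspan_add fspan_scale) (use v 1 in auto)
  then show ?thesis by (simp add: x cscale_def inner_sum_left inner_add_left)
qed

lemma fspan_gvar_inner:
  assumes "f \<in> gvar_span" obtains w where "f = (\<lambda>z. inner w z)"
proof -
  have "\<exists>w. f = (\<lambda>z. inner w z)"
    using assms
  proof (rule fspan_induct)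
    show "\<exists>w. (\<lambda>x. 0) = inner w" by (intro exI[of _ 0]) auto
    show "\<exists>w. g = inner w" if "g \<in> {gvar J e k | k. k \<noteq> 0}" for g using that by (auto simp: gvar_eq)
    show "\<exists>w. (\<lambda>x. f x + g x) = inner w" if fg: "\<exists>w. f = inner w" "\<exists>w. g = inner w" for f g
    proof -
      obtain w v where "f = inner w" "g = inner v" using fg by blast
      then show ?thesis by (intro exI[of _ "w + v"]) (simp add: fun_eq_iff inner_add_left)
    qed
    show "\<exists>w. (\<lambda>x. c * f x) = inner w" if fg: "\<exists>w. f = inner w" for f c
    proof -
      obtain w where "f = inner w" using fg by blast
      then show ?thesis by (intro exI[of _ "c *\<^sub>R w"]) (simp add: fun_eq_iff)
    qed
  qed
  then show ?thesis using that by blast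
qed

lemma fspan_gvar_L2R: "gvar_span \<subseteq> L2R m"
proof
  fix f assume "f \<in> gvar_span"
  then obtain w where "f = (\<lambda>z. inner w z)" by (rule fspan_gvar_inner)
  then show "f \<in> L2R m" using inner_L2R by simp
qed

text \<open>Wick calculus will be applied to the functionals of the vectors
  \<open>adj n (frak i)\<close>, which need not be finite combinations of coordinate functionals;
  they are reached as L2 limits of such combinations.\<close>

lemma inner_in_Gspace: "(\<lambda>z. inner x z) \<in> Gspace J e m"
  unfolding Gspace_def L2closure_def
proof (intro CollectI conjI allI impI inner_L2R)
  fix \<epsilon> :: real assume \<epsilon>: "\<epsilon> > 0"
  obtain K where K: "K \<ge> 0" "\<And>x. cov x x \<le> K * (norm x)\<^sup>2" using cov_bound by metis
  have "x \<in> closure (cspan J (e ` {1..}))" using eb by (auto simp: R_eigenbasis_def)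
  moreover have "\<epsilon> / (sqrt K + 1) > 0" using \<epsilon> K(1) by (simp add: add_nonneg_pos)
  ultimately obtain y where y: "y \<in> cspan J (e ` {1..})" "dist y x < \<epsilon> / (sqrt K + 1)"
    using closure_approachable by blast
  have "L2norm m (\<lambda>z. inner x z - inner y z) = sqrt (cov (x - y) (x - y))"
    by (simp add: L2norm_def cov_self[symmetric] inner_diff_left)
  also have "\<dots> \<le> sqrt (K * (norm (x - y))\<^sup>2)" by (simp add: K(2))
  also have "\<dots> = sqrt K * norm (x - y)" by (simp add: real_sqrt_mult)
  also have "\<dots> \<le> (sqrt K + 1) * norm (x - y)" by (simp add: distrib_right)
  also have "\<dots> < \<epsilon>"
  proof -
    have "sqrt K + 1 > 0" using K(1) by (simp add: add_nonneg_pos)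
    then show ?thesis using y(2) by (simp add: dist_norm norm_minus_commute pos_less_divide_eq mult.commute)
  qed
  finally show "\<exists>g\<in>gvar_span. L2norm m (\<lambda>z. inner x z - g z) < \<epsilon>"
    using inner_fspan[OF y(1)] by (rule bexI)
qed

text \<open>An L2 limit of Gaussian variables is Gaussian: the exponentials converge because
  \<open>iexp\<close> is 1-Lipschitz, and the variances because the L2 norm is continuous.\<close>

lemma Gspace_char:
  assumes X: "X \<in> Gspace J e m"
  shows "(\<integral>z. iexp (X z) \<partial>m) = exp (- complex_of_real (\<integral>z. (X z)\<^sup>2 \<partial>m) / 2)"
proof -
  have XR: "X \<in> L2R m" using X L2closure_L2R unfolding Gspace_def by blast
  note [measurable] = L2R_D(1)[OF XR]
  have "\<exists>w. L2norm m (\<lambda>z. X z - inner w z) < 1 / real (Suc n)" for n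
  proof -
    have "1 / real (Suc n) > 0" by simp
    then obtain g where g: "g \<in> gvar_span" "L2norm m (\<lambda>z. X z - g z) < 1 / real (Suc n)"
      using X unfolding Gspace_def L2closure_def by blast
    obtain w where "g = (\<lambda>z. inner w z)" using fspan_gvar_inner[OF g(1)] by blast
    then show ?thesis using g(2) by blast
  qed
  then obtain w where w: "\<And>n. L2norm m (\<lambda>z. X z - inner (w n) z) < 1 / real (Suc n)" by metis
  have lim0: "(\<lambda>n. 1 / real (Suc n)) \<longlonglongrightarrow> 0" by (intro LIMSEQ_Suc lim_1_over_n)
  have i: "integrable m (\<lambda>z. iexp (Y z))" if [measurable]: "Y \<in> borel_measurable m" for Y
    by (rule P.integrable_const_bound[of _ 1]) auto
  have "(\<lambda>n. \<integral>z. iexp (inner (w n) z) \<partial>m) \<longlonglongrightarrow> (\<integral>z. iexp (X z) \<partial>m)"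
  proof (rule Lim_transform2[where f="\<lambda>n. \<integral>z. iexp (X z) \<partial>m"])
    show "(\<lambda>n. (\<integral>z. iexp (X z) \<partial>m) - (\<integral>z. iexp (inner (w n) z) \<partial>m)) \<longlonglongrightarrow> 0"
    proof (rule Lim_null_comparison[OF _ lim0], rule always_eventually, rule allI)
      fix n
      have d: "(\<lambda>z. X z - inner (w n) z) \<in> L2R m" by (rule L2R_diff[OF XR inner_L2R])
      have "norm ((\<integral>z. iexp (X z) \<partial>m) - (\<integral>z. iexp (inner (w n) z) \<partial>m)) = norm (\<integral>z. iexp (X z) - iexp (inner (w n) z) \<partial>m)"
        by (subst Bochner_Integration.integral_diff) (auto intro!: i)
      also have "\<dots> \<le> (\<integral>z. \<bar>X z - inner (w n) z\<bar> \<partial>m)"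
        by (rule order_trans[OF integral_norm_bound integral_mono])
           (auto intro!: integrable_norm Bochner_Integration.integrable_diff i iexp_diff_le Bochner_Integration.integrable_abs P.L2R_integrable[OF XR] P.L2R_integrable[OF inner_L2R])
      also have "\<dots> \<le> L2norm m (\<lambda>z. X z - inner (w n) z)" by (rule P.integral_abs_le_L2norm[OF d])
      also have "\<dots> \<le> 1 / real (Suc n)" using w[of n] by simp
      finally show "norm ((\<integral>z. iexp (X z) \<partial>m) - (\<integral>z. iexp (inner (w n) z) \<partial>m)) \<le> 1 / real (Suc n)" .
    qed
  qed simp
  moreover have "(\<lambda>n. L2norm m (\<lambda>z. inner (w n) z)) \<longlonglongrightarrow> L2norm m X"
  proof (rule Lim_transform2[where f="\<lambda>n. L2norm m X"])
    show "(\<lambda>n. L2norm m X - L2norm m (\<lambda>z. inner (w n) z)) \<longlonglongrightarrow> 0"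
    proof (rule Lim_null_comparison[OF _ lim0], rule always_eventually, rule allI)
      fix n
      have "L2norm m X \<le> L2norm m (\<lambda>z. X z - inner (w n) z) + L2norm m (\<lambda>z. inner (w n) z)"
        using L2norm_triangle[OF L2R_diff[OF XR inner_L2R] inner_L2R, of "w n" "w n"] by simp
      moreover have "L2norm m (\<lambda>z. inner (w n) z) \<le> L2norm m (\<lambda>z. inner (w n) z - X z) + L2norm m X"
        using L2norm_triangle[OF L2R_diff[OF inner_L2R XR] XR, of "w n"] by simp
      ultimately show "norm (L2norm m X - L2norm m (\<lambda>z. inner (w n) z)) \<le> 1 / real (Suc n)"
        using w[of n] by (simp add: L2norm_minus_commute[of m X])
    qed
  qed simp
  then have "(\<lambda>n. exp (- complex_of_real ((L2norm m (\<lambda>z. inner (w n) z))\<^sup>2) / 2)) \<longlonglongrightarrow> exp (- complex_of_real ((L2norm m X)\<^sup>2) / 2)"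
    by (intro tendsto_intros) auto
  then have "(\<lambda>n. \<integral>z. iexp (inner (w n) z) \<partial>m) \<longlonglongrightarrow> exp (- complex_of_real (\<integral>z. (X z)\<^sup>2 \<partial>m) / 2)"
    unfolding L2norm_power2 inner_gauss(1)[symmetric] .
  ultimately show ?thesis by (rule LIMSEQ_unique)
qed

sublocale gaussian_space m "Gspace J e m"
proof
  fix X assume X: "X \<in> Gspace J e m"
  then have XR: "X \<in> L2R m" using L2closure_L2R unfolding Gspace_def by blast
  show "X \<in> borel_measurable m" "integrable m (\<lambda>x. (X x)\<^sup>2)" using XR by (auto simp: L2R_def)
  show "(\<integral>x. iexp (X x) \<partial>m) = exp (- complex_of_real (\<integral>x. (X x)\<^sup>2 \<partial>m) / 2)" by (rule Gspace_char[OF X])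
  show "(\<lambda>x. c * X x) \<in> Gspace J e m" for c
    using X unfolding Gspace_def by (rule L2closure_scale[rotated]) (rule fspan_scale)
next
  fix X Y assume X: "X \<in> Gspace J e m" and Y: "Y \<in> Gspace J e m"
  show "(\<lambda>x. X x + Y x) \<in> Gspace J e m"
    unfolding Gspace_def
    by (rule L2closure_add[OF fspan_gvar_L2R fspan_add X[unfolded Gspace_def] Y[unfolded Gspace_def]])
qed

abbreviation "V \<equiv> Gspace J e m"

lemma fin_moments_L2R: "fin_moments m f \<Longrightarrow> f \<in> L2R m"
  using fin_moments_power_integrable[of m f 2] by (auto simp: L2R_def fin_moments_def)

lemma Q_inner: "Q (\<lambda>z. inner x z) (\<lambda>z. inner y z) = cov x y"
  by (simp add: Q_def cov_def)

section \<open>Adjoints of the powers of T and invariance of the measure\<close>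

lemma cscale_cscale: "cscale J a (cscale J b x) = cscale J (a * b) x"
  using J_linear by (simp add: cscale_def linear_add linear_scale algebra_simps)

lemma cinner_cscale: "cinner J x (cscale J a z) = a * cinner J x z"
  by (simp add: complex_eq_iff Im_cinner cscale_def inner_add_right inner_J_right)

lemma T_cscale: "T (cscale J a x) = cscale J a (T x)"
  using T TJ by (simp add: cscale_def linear_simps)

lemma Tn_bounded_linear: "bounded_linear (T ^^ n)"
proof (induction n)
  case 0
  then show ?case using bounded_linear_ident by (simp add: id_def)
next
  case (Suc n)
  then show ?case using bounded_linear_compose[OF T Suc.IH] by (simp add: comp_def)
qed

lemma Tn_J: "(T ^^ n) (J x) = J ((T ^^ n) x)"
  by (induction n) (auto simp: TJ)

lemma Tn_E: "l \<in> sphere 0 1 \<Longrightarrow> (T ^^ n) (E l) = cscale J (l ^ n) (E l)"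
proof (induction n)
  case 0
  then show ?case by (simp add: cscale_def)
next
  case (Suc n)
  moreover have "T (E l) = cscale J l (E l)" using TE Suc.prems by (auto simp: T_eigenvector_field_def)
  ultimately show ?case by (simp add: T_cscale cscale_cscale mult.commute)
qed

text \<open>The adjoint of \<open>T ^^ n\<close> for the real inner product; since T commutes with
  J, it is also the complex adjoint.\<close>

definition adj :: "nat \<Rightarrow> 'h \<Rightarrow> 'h" where
  "adj n x = (SOME w. \<forall>z. inner x ((T ^^ n) z) = inner w z)"

lemma inner_adj: "inner x ((T ^^ n) z) = inner (adj n x) z"
proof -
  have "bounded_linear (\<lambda>z. inner x ((T ^^ n) z))"
    by (rule bounded_linear_compose[OF bounded_linear_inner_right Tn_bounded_linear])
  then have "\<exists>w. \<forall>z. inner x ((T ^^ n) z) = inner w z" using riesz_representation by metis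
  from someI_ex[OF this] show ?thesis unfolding adj_def by blast
qed

lemma cinner_adj: "cinner J (adj n x) z = cinner J x ((T ^^ n) z)"
proof -
  have "inner (J (adj n x)) z = - inner (adj n x) (J z)" by (simp add: inner_J_right)
  also have "\<dots> = - inner x ((T ^^ n) (J z))" by (simp add: inner_adj)
  also have "\<dots> = inner (J x) ((T ^^ n) z)" by (simp add: Tn_J inner_J_right)
  finally show ?thesis by (simp add: complex_eq_iff Im_cinner inner_adj)
qed

lemma cinner_adj_E: "cinner J (adj n x) (E (cis \<theta>)) = cis \<theta> ^ n * cinner J x (E (cis \<theta>))"
  by (simp add: cinner_adj Tn_E cinner_cscale)

text \<open>Each vector of the field is an eigenvector of \<open>T ^^ n\<close> with a unimodular
  eigenvalue, which cancels against its conjugate. Hence T preserves the covariance.\<close>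

lemma R_form_adj: "R_form J E (adj n x) (adj n y) = R_form J E x y"
proof -
  have "cnj (cis \<theta> ^ n) * cis \<theta> ^ n = 1" for \<theta>
    by (simp add: power_mult_distrib[symmetric] cis_cnj cis_mult)
  then have "cis \<theta> ^ n * a * cnj (cis \<theta> ^ n * b) = a * cnj b" for \<theta> a b
    by (simp add: mult_ac)
  then show ?thesis by (simp only: R_form_def circ_integral_def cinner_adj_E)
qed

text \<open>Moving only one of the two vectors leaves the factor \<open>l ^ n\<close> standing, so
  this is the Fourier coefficient that has to be small.\<close>

lemma cov_adj: "cov (adj n x) y = Re (circ_integral (\<lambda>l. l ^ n * cinner J x (E l) * cnj (cinner J y (E l)))) / 2"
  unfolding cov_R_form R_form_def circ_integral_def cinner_adj_E ..

lemma cov_adj_adj: "cov (adj n x) (adj n y) = cov x y"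
  by (simp add: cov_R_form R_form_adj)

lemma Tn_measurable: "(T ^^ n) \<in> measurable m borel"
proof -
  have "(T ^^ n) \<in> measurable borel borel"
    by (intro borel_measurable_continuous_onI linear_continuous_on Tn_bounded_linear)
  then show ?thesis by (simp add: measurable_cong_sets[OF sets_m refl])
qed

lemma Tn_measurable_m: "(T ^^ n) \<in> measurable m m"
  using Tn_measurable by (simp add: measurable_cong_sets[OF refl sets_m])

text \<open>A centred Gaussian law is determined by its covariance: both characteristic functions
  depend on variances only, and these agree by \<open>cov_adj_adj\<close>.\<close>

lemma Tn_invariant: "distr m borel (T ^^ n) = m"
proof (rule hilbert_char_unique[OF sep])
  show "finite_measure (distr m borel (T ^^ n))"
    using P.prob_space_distr[OF Tn_measurable] by (simp add: prob_space_def)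
  show "finite_measure m" by unfold_locales
  fix x
  have "(\<integral>z. iexp (inner x z) \<partial>distr m borel (T ^^ n)) = (\<integral>z. iexp (inner (adj n x) z) \<partial>m)"
    by (subst integral_distr[OF Tn_measurable]) (auto simp: inner_adj intro!: borel_measurable_continuous_onI continuous_intros)
  also have "\<dots> = (\<integral>z. iexp (inner x z) \<partial>m)" by (simp only: inner_gauss(1) cov_self cov_adj_adj)
  finally show "(\<integral>z. iexp (inner x z) \<partial>distr m borel (T ^^ n)) = (\<integral>z. iexp (inner x z) \<partial>m)" .
qed (simp_all add: sets_m)

lemma Tn_integral:
  fixes f :: "'h \<Rightarrow> real"
  assumes "f \<in> borel_measurable m"
  shows "(\<integral>z. f ((T ^^ n) z) \<partial>m) = (\<integral>z. f z \<partial>m)"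
proof -
  have "f \<in> borel_measurable borel" using assms by (simp add: measurable_cong_sets[OF sets_m refl])
  from integral_distr[OF Tn_measurable this, of n] show ?thesis by (simp add: Tn_invariant)
qed

lemma Tn_integrable:
  fixes f :: "'h \<Rightarrow> real"
  assumes "f \<in> borel_measurable m"
  shows "integrable m (\<lambda>z. f ((T ^^ n) z)) \<longleftrightarrow> integrable m f"
proof -
  have "f \<in> borel_measurable borel" using assms by (simp add: measurable_cong_sets[OF sets_m refl])
  from integrable_distr_eq[OF Tn_measurable this, of n] show ?thesis by (simp add: Tn_invariant)
qed

lemma Tn_L2R: assumes "f \<in> L2R m" shows "(\<lambda>z. f ((T ^^ n) z)) \<in> L2R m"
proof -
  note fm = L2R_D(1)[OF assms]
  have "(\<lambda>z. f ((T ^^ n) z)) \<in> borel_measurable m" using measurable_compose[OF Tn_measurable_m fm] .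
  moreover have "(\<lambda>x. (f x)\<^sup>2) \<in> borel_measurable m" using fm by measurable
  ultimately show ?thesis using Tn_integrable[of "\<lambda>x. (f x)\<^sup>2" n] assms by (auto simp: L2R_def)
qed

lemma Tn_L2norm: assumes "f \<in> L2R m" shows "L2norm m (\<lambda>z. f ((T ^^ n) z)) = L2norm m f"
proof -
  have "(\<lambda>x. (f x)\<^sup>2) \<in> borel_measurable m" using L2R_D(1)[OF assms] by measurable
  then show ?thesis using Tn_integral[of "\<lambda>x. (f x)\<^sup>2" n] by (simp add: L2norm_def)
qed

section \<open>Wick products and Wick transforms of coordinate monomials\<close>

lemma inner_V [simp, intro]: "inner x \<in> V"
  using inner_in_Gspace[of x] by simp

abbreviation "W Xs \<equiv> wp Xs {#}"

abbreviation "fes is \<equiv> map (\<lambda>i. inner (frak i)) is"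

lemma fes_V: "set (fes is) \<subseteq> V" by auto

lemma mprod_Tn: "mprod B ((T ^^ n) z) = mprod (image_mset (\<lambda>X z. X ((T ^^ n) z)) B) z"
  by (induction B) auto

lemma mom_Tn:
  assumes "set_mset B \<subseteq> V" shows "mom (image_mset (\<lambda>X z. X ((T ^^ n) z)) B) = mom B"
  unfolding mom_def mprod_Tn[symmetric]
  by (rule Tn_integral) (rule fin_moments_measurable[OF mprod_fin_moments[OF assms]])

text \<open>The coefficients of a Wick product are moments, which \<open>T ^^ n\<close> preserves;
  so composition acts on the factors alone and keeps the degree.\<close>

lemma wp_Tn:
  assumes "set Xs \<subseteq> V" "set_mset B \<subseteq> V"
  shows "wp Xs B ((T ^^ n) z) = wp (map (\<lambda>X z. X ((T ^^ n) z)) Xs) (image_mset (\<lambda>X z. X ((T ^^ n) z)) B) z"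
  using assms by (induction Xs arbitrary: B) (auto simp: mom_Tn)

lemma W_Tn: "W (fes is) ((T ^^ n) z) = W (map (\<lambda>i. inner (adj n (frak i))) is) z"
proof -
  have "W (fes is) ((T ^^ n) z) = wp (map (\<lambda>X z. X ((T ^^ n) z)) (fes is)) {#} z"
    using wp_Tn[OF fes_V, of "{#}"] by (simp del: map_map)
  also have "map (\<lambda>X z. X ((T ^^ n) z)) (fes is) = map (\<lambda>i. inner (adj n (frak i))) is"
    by (simp add: inner_adj fun_eq_iff)
  finally show ?thesis .
qed

definition wmono :: "int list \<Rightarrow> 'h \<Rightarrow> real" where
  "wmono is = (\<lambda>z. \<Prod>j<length is. gvar J e (is ! j) z)"

lemma wmono_mprod: "wmono is = mprod (mset (fes is))"
proof
  fix z
  have "(\<Prod>i\<leftarrow>is. inner (frak i) z) = (\<Prod>j<length is. inner (frak (is ! j)) z)"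
    using prod.list_conv_set_nth[of "map (\<lambda>i. inner (frak i) z) is"] by (simp add: atLeast0LessThan)
  moreover have "mprod (mset (fes is)) z = (\<Prod>i\<leftarrow>is. inner (frak i) z)"
    by (induction "is") auto
  ultimately show "wmono is z = mprod (mset (fes is)) z" by (simp add: wmono_def gvar_eq)
qed

lemma mprod_in_Gpow:
  assumes "set_mset B \<subseteq> V" shows "mprod B \<in> Gpow J e m (size B)"
proof -
  obtain Ys where Ys: "mset Ys = B" using ex_mset by blast
  have "mprod B = (\<lambda>x. \<Prod>i<size B. (Ys ! i) x)"
  proof
    fix x
    have "mprod (mset Ys) x = (\<Prod>Y\<leftarrow>Ys. Y x)" by (induction Ys) auto
    also have "\<dots> = (\<Prod>i<length Ys. (Ys ! i) x)"
      using prod.list_conv_set_nth[of "map (\<lambda>Y. Y x) Ys"] by (simp add: atLeast0LessThan)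
    finally show "mprod B x = (\<Prod>i<size B. (Ys ! i) x)" using Ys by auto
  qed
  moreover have "\<forall>i<size B. Ys ! i \<in> V" using assms Ys by (metis nth_mem set_mset_mset size_mset subsetD)
  ultimately show ?thesis unfolding Gpow_def by (intro fspan_base) blast
qed

lemma Gpow_cases:
  assumes "f \<in> Gpow J e m k"
  shows "f \<in> fspan {mprod B | B. set_mset B \<subseteq> V \<and> size B = k}"
proof -
  have "{(\<lambda>x. \<Prod>i<k. g i x) | g. \<forall>i<k. g i \<in> V} \<subseteq> {mprod B | B. set_mset B \<subseteq> V \<and> size B = k}"
  proof clarify
    fix g :: "nat \<Rightarrow> 'h \<Rightarrow> real" assume g: "\<forall>i<k. g i \<in> V"
    have "mprod (image_mset g (mset_set {..<k})) x = (\<Prod>i<k. g i x)" for x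
      by (simp add: mprod_def image_mset.compositionality comp_def prod_unfold_prod_mset)
    then show "\<exists>B. (\<lambda>x. \<Prod>i<k. g i x) = mprod B \<and> set_mset B \<subseteq> V \<and> size B = k"
      using g by (intro exI[of _ "image_mset g (mset_set {..<k})"]) auto
  qed
  then show ?thesis using assms unfolding Gpow_def fspan_def by blast
qed

text \<open>\<open>wick\<close> subtracts a projection selected by choice, so equality with the
  explicit polynomial is only claimed almost everywhere, and measurability is recorded separately.
  The polynomial is orthogonal to all lower degrees and differs from the monomial by lower degrees,
  so this difference is one admissible choice.\<close>

lemma wick_wmono:
  assumes k: "length is = k"
  shows "(AE z in m. wick J e m k (wmono is) z = W (fes is) z) \<and> wick J e m k (wmono is) \<in> borel_measurable m"
proof (cases "k = 0")
  case True
  then show ?thesis using k by (simp add: wick_def wmono_def[abs_def] mom_def P.prob_space)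
next
  case False
  define S where "S = fspan (\<Union>j<k. Gpow J e m j)"
  define f where "f = wmono is"
  define p where "p = (\<lambda>z. f z - W (fes is) z)"
  have Wf: "fin_moments m (W (fes is))" by (rule wp_fin_moments[OF fes_V])
  have ff: "fin_moments m f" unfolding f_def wmono_mprod by (rule mprod_fin_moments) auto
  have mp: "mprod B \<in> S" if "set_mset B \<subseteq> V" "size B < k" for B
    unfolding S_def using mprod_in_Gpow[OF that(1)] that(2) by (intro fspan_base) auto
  have "(\<lambda>z. W (fes is) z - mprod (mset (fes is)) z) \<in> S"
  proof (rule wp_minus_mprod)
    show "mprod C \<in> S" if "C \<subset># mset (fes is)" for C
    proof (rule mp)
      show "size C < k" using mset_subset_size[OF that] k by simp
      show "set_mset C \<subseteq> V" using fes_V[of "is"] that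
        by (metis (no_types) mset_subset_eqD set_mset_mset subset_iff subset_mset.less_imp_le)
    qed
  qed (auto simp: S_def fspan_zero fspan_add fspan_scale)
  then have "(\<lambda>z. (-1) * (W (fes is) z - mprod (mset (fes is)) z)) \<in> S" unfolding S_def by (rule fspan_scale)
  then have pS: "p \<in> S" by (simp add: p_def f_def wmono_mprod)
  have SR: "g \<in> L2R m \<and> (\<integral>z. W (fes is) z * g z \<partial>m) = 0" if "g \<in> S" for g
    using that[unfolded S_def]
  proof (rule fspan_induct)
    fix g assume "g \<in> (\<Union>j<k. Gpow J e m j)"
    then obtain j where j: "j < k" "g \<in> Gpow J e m j" by auto
    from Gpow_cases[OF j(2)] show "g \<in> L2R m \<and> (\<integral>z. W (fes is) z * g z \<partial>m) = 0"
    proof (rule fspan_induct)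
      fix g assume "g \<in> {mprod B | B. set_mset B \<subseteq> V \<and> size B = j}"
      then obtain B where B: "g = mprod B" "set_mset B \<subseteq> V" "size B = j" by auto
      have "Psi (fes is) {#} B = 0" using Psi_eq_0_size[OF fes_V B(2)] B(3) j(1) k by simp
      then show "g \<in> L2R m \<and> (\<integral>z. W (fes is) z * g z \<partial>m) = 0"
        using fin_moments_L2R[OF mprod_fin_moments[OF B(2)]] B(1) by (simp add: Psi_def)
    qed (auto simp: L2R_zero L2R_add L2R_cmult distrib_left mult.left_commute L2R_mult_integrable[OF fin_moments_L2R[OF Wf]])
  qed (auto simp: L2R_zero L2R_add L2R_cmult distrib_left mult.left_commute L2R_mult_integrable[OF fin_moments_L2R[OF Wf]])
  have GR: "(\<integral>z. W (fes is) z * g z \<partial>m) = 0" if "g \<in> Glower J e m k" for g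
    by (rule L2closure_orthogonal[OF that[unfolded Glower_def, folded S_def]])
       (use SR fin_moments_L2R[OF Wf] in auto)
  have Gl: "g \<in> L2R m" if "g \<in> Glower J e m k" for g
    using that L2closure_L2R unfolding Glower_def by blast
  have pG: "p \<in> Glower J e m k"
    unfolding Glower_def S_def[symmetric] by (rule L2closure_base[OF pS]) (use SR[OF pS] in blast)
  define q where "q = L2proj m (Glower J e m k) f"
  have "p \<in> Glower J e m k \<and> (\<forall>v\<in>Glower J e m k. L2inner m (\<lambda>x. f x - p x) v = 0)"
    using pG GR by (simp add: p_def L2inner_def)
  from someI[of "\<lambda>p. p \<in> Glower J e m k \<and> (\<forall>v\<in>Glower J e m k. L2inner m (\<lambda>x. f x - p x) v = 0)", OF this]
  have q: "q \<in> Glower J e m k" "\<And>v. v \<in> Glower J e m k \<Longrightarrow> L2inner m (\<lambda>x. f x - q x) v = 0"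
    unfolding q_def L2proj_def by blast+
  have pR: "p \<in> L2R m" and qR: "q \<in> L2R m" and fR: "f \<in> L2R m"
    using Gl pG q(1) fin_moments_L2R[OF ff] by auto
  \<comment> \<open>Two admissible projections differ by an element of the very space to which their
    difference is orthogonal; pairing the difference with itself then shows that it is null.\<close>
  have orth: "(\<integral>z. (p z - q z) * v z \<partial>m) = 0" if "v \<in> Glower J e m k" for v
  proof -
    have i: "integrable m (\<lambda>z. (f z - q z) * v z)" "integrable m (\<lambda>z. W (fes is) z * v z)"
      by (intro L2R_mult_integrable L2R_diff fR qR Gl[OF that] fin_moments_L2R[OF Wf])+
    have "(\<integral>z. (p z - q z) * v z \<partial>m) = (\<integral>z. (f z - q z) * v z - W (fes is) z * v z \<partial>m)"
      by (simp add: p_def algebra_simps)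
    also have "\<dots> = 0" using q(2)[OF that] GR[OF that] i by (simp add: L2inner_def)
    finally show ?thesis .
  qed
  have i2: "integrable m (\<lambda>z. (p z - q z) * p z)" "integrable m (\<lambda>z. (p z - q z) * q z)"
    by (intro L2R_mult_integrable L2R_diff pR qR)+
  have "(\<integral>z. (p z - q z)\<^sup>2 \<partial>m) = (\<integral>z. (p z - q z) * p z - (p z - q z) * q z \<partial>m)"
    by (simp add: power2_eq_square right_diff_distrib)
  also have "\<dots> = 0" using orth[OF pG] orth[OF q(1)] i2 by simp
  finally have "L2norm m (\<lambda>z. p z - q z) = 0" by (simp add: L2norm_def)
  then have "AE z in m. p z - q z = 0" by (rule L2norm_eq_0_AE[OF L2R_diff[OF pR qR]])
  then have "AE z in m. wick J e m k f z = W (fes is) z"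
    by eventually_elim (use False in \<open>simp add: wick_def q_def[symmetric] p_def\<close>)
  moreover have "wick J e m k f = (\<lambda>z. f z - q z)" using False by (simp add: wick_def q_def)
  then have "wick J e m k f \<in> borel_measurable m" using L2R_D(1)[OF L2R_diff[OF fR qR]] by simp
  ultimately show ?thesis by (simp add: f_def)
qed

lemma sigma2_eq: "i \<noteq> 0 \<Longrightarrow> sigma2 J e m i = cov (frak i) (frak i)"
proof -
  assume "i \<noteq> 0"
  have "sigma2 J e m i = cov (e (nat \<bar>i\<bar>)) (e (nat \<bar>i\<bar>))" by (simp add: sigma2_def cov_self)
  also have "\<dots> = cov (frak i) (frak i)"
    using \<open>i \<noteq> 0\<close> by (cases "i > 0") (auto simp: frak_def frak_e_def cov_J)
  finally show ?thesis .
qed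

lemma alpha_coef_eq:
  assumes f: "f \<in> L2R m" and i: "0 \<notin> set is"
  shows "alpha_coef J e m f is
    = (\<integral>z. f z * W (fes is) z \<partial>m) / (fact (length is) * (\<Prod>j<length is. cov (frak (is ! j)) (frak (is ! j))))"
proof -
  have [measurable]: "f \<in> borel_measurable m" using f by (rule L2R_D)
  have [measurable]: "W (fes is) \<in> borel_measurable m"
    by (rule fin_moments_measurable[OF wp_fin_moments[OF fes_V]])
  note w = wick_wmono[of "is" "length is", OF refl]
  have [measurable]: "wick J e m (length is) (wmono is) \<in> borel_measurable m" using w by blast
  have "(\<integral>z. f z * wick J e m (length is) (wmono is) z \<partial>m) = (\<integral>z. f z * W (fes is) z \<partial>m)"
    by (rule integral_cong_AE) (use w in auto)
  moreover have "(\<Prod>j<length is. sigma2 J e m (is ! j)) = (\<Prod>j<length is. cov (frak (is ! j)) (frak (is ! j)))"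
  proof (rule prod.cong)
    fix j assume "j \<in> {..<length is}"
    then have "is ! j \<noteq> 0" using i by (metis lessThan_iff nth_mem)
    then show "sigma2 J e m (is ! j) = cov (frak (is ! j)) (frak (is ! j))" by (rule sigma2_eq)
  qed simp
  ultimately show ?thesis by (simp add: alpha_coef_def L2inner_def wmono_def)
qed

text \<open>Permuting the indices permutes the factors of one and the same function. This symmetry
  is what lets the sum over pairings collapse to a factor k!.\<close>

lemma alpha_coef_mset:
  assumes "mset is = mset js" shows "coef f is = coef f js"
proof -
  have l: "length is = length js" using assms by (metis size_mset)
  have p: "(\<Prod>j<length is. h (is ! j)) = (\<Prod>j<length js. (h (js ! j) :: real))" for h
  proof -
    have "prod_mset (image_mset h (mset is)) = prod_mset (image_mset h (mset js))" using assms by simp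
    moreover have "prod_mset (image_mset h (mset ks)) = (\<Prod>j<length ks. h (ks ! j))" for ks
      using prod.list_conv_set_nth[of "map h ks"] by (simp add: atLeast0LessThan prod_mset_prod_list flip: mset_map)
    ultimately show ?thesis by simp
  qed
  have "(\<lambda>z. \<Prod>j<length is. gvar J e (is ! j) z) = (\<lambda>z. \<Prod>j<length js. gvar J e (js ! j) z)"
    by (rule ext) (rule p)
  moreover have "(\<Prod>j<length is. sigma2 J e m (is ! j)) = (\<Prod>j<length js. sigma2 J e m (js ! j))" by (rule p)
  ultimately show ?thesis unfolding alpha_coef_def by (simp only: l)
qed

lemma inner_frak: "i \<noteq> 0 \<Longrightarrow> j \<noteq> 0 \<Longrightarrow> inner (frak i) (frak j) = (if i = j then 1 else 0)"
proof -
  assume ij: "i \<noteq> 0" "j \<noteq> 0"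
  have e: "cinner J (e a) (e b) = (if a = b then 1 else 0)" if "a \<ge> 1" "b \<ge> 1" for a b
    using eb that by (auto simp: R_eigenbasis_def)
  have 1: "inner (e a) (e b) = (if a = b then 1 else 0)" "inner (J (e a)) (e b) = 0" "inner (e a) (J (e b)) = 0" if "a \<ge> 1" "b \<ge> 1" for a b
    using arg_cong[OF e[OF that], of Re] arg_cong[OF e[OF that], of Im]
    by (auto simp: Im_cinner inner_J_right)
  have 2: "nat \<bar>i\<bar> \<ge> 1" "nat \<bar>j\<bar> \<ge> 1" using ij by auto
  show ?thesis
    using ij 2 by (cases "i > 0"; cases "j > 0") (auto simp: frak_def frak_e_def 1 nat_eq_iff)
qed

text \<open>The eigenbasis diagonalises the covariance: paired with an eigenvector, the form is a
  real multiple of the inner product. When both indices are negative, \<open>cov_J\<close> strips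
  the two J first.\<close>

lemma cov_frak: "i \<noteq> 0 \<Longrightarrow> j \<noteq> 0 \<Longrightarrow> i \<noteq> j \<Longrightarrow> cov (frak i) (frak j) = 0"
proof -
  assume ij: "i \<noteq> 0" "j \<noteq> 0" "i \<noteq> j"
  have main: "cov (e a) y = 0" if a: "a \<ge> 1" and y: "inner (e a) y = 0" for a y
  proof -
    obtain c :: real where "R_form J E (e a) y = complex_of_real c * cinner J (e a) y"
      using eb a unfolding R_eigenbasis_def by metis
    then show ?thesis using y by (simp add: cov_R_form)
  qed
  have frak: "frak k = (if k > 0 then e (nat k) else J (e (nat (- k))))" for k by (simp add: frak_def frak_e_def)
  have cs: "cov x y = cov y x" for x y by (simp add: cov_def mult.commute)
  show ?thesis
  proof (cases "i > 0")
    case True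
    then show ?thesis using main[of "nat i" "frak j"] inner_frak[OF ij(1,2)] ij by (simp add: frak[of i])
  next
    case False
    show ?thesis
    proof (cases "j > 0")
      case True
      then show ?thesis using main[of "nat j" "frak i"] inner_frak[OF ij(2,1)] ij cs[of "frak i"] by (simp add: frak[of j])
    next
      case j: False
      have "inner (e (nat (- i))) (e (nat (- j))) = 0"
        using inner_frak[OF ij(1,2)] ij False j by (simp add: frak)
      then show ?thesis using main[of "nat (- i)" "e (nat (- j))"] ij False j by (simp add: frak cov_J)
    qed
  qed
qed

section \<open>Totality of the Wick polynomials\<close>

definition basis_mset :: "('h \<Rightarrow> real) multiset \<Rightarrow> bool" where
  "basis_mset B \<longleftrightarrow> (\<forall>b\<in>#B. \<exists>i. i \<noteq> 0 \<and> b = inner (frak i))"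

lemma basis_mset_V: "basis_mset B \<Longrightarrow> set_mset B \<subseteq> V"
  by (auto simp: basis_mset_def)

lemma basis_mset_list:
  assumes "basis_mset B" obtains "is" where "0 \<notin> set is" "mset (fes is) = B"
proof -
  obtain c where c: "\<And>b. b \<in># B \<Longrightarrow> c b \<noteq> (0::int) \<and> b = inner (frak (c b))"
    using assms unfolding basis_mset_def by metis
  obtain Ys where Ys: "mset Ys = B" using ex_mset by blast
  have "fes (map c Ys) = Ys" using c Ys by (auto intro!: map_idI simp: comp_def)
  moreover have "0 \<notin> set (map c Ys)" using c Ys by auto
  ultimately show ?thesis using that[of "map c Ys"] Ys by simp
qed

lemma L2R_fin_moments_integrable: "r \<in> L2R m \<Longrightarrow> fin_moments m h \<Longrightarrow> integrable m (\<lambda>z. r z * h z)"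
  by (rule L2R_mult_integrable) (auto intro: fin_moments_L2R)

text \<open>A Wick polynomial and its leading monomial differ by products of proper subfamilies, so
  induction on the degree passes from the former to the latter.\<close>

lemma orthogonal_mprod:
  assumes r: "r \<in> L2R m" and orth: "\<And>is. 0 \<notin> set is \<Longrightarrow> (\<integral>z. r z * W (fes is) z \<partial>m) = 0"
  shows "basis_mset B \<Longrightarrow> (\<integral>z. r z * mprod B z \<partial>m) = 0"
proof (induction "size B" arbitrary: B rule: less_induct)
  case less
  obtain "is" where i: "0 \<notin> set is" "mset (fes is) = B" using basis_mset_list[OF less.prems] by metis
  define L where "L = {h. fin_moments m h \<and> (\<integral>z. r z * h z \<partial>m) = 0}"
  have "(\<lambda>z. W (fes is) z - mprod (mset (fes is)) z) \<in> L"
  proof (rule wp_minus_mprod)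
    show "(\<lambda>x. f x + g x) \<in> L" if "f \<in> L" "g \<in> L" for f g
      using that L2R_fin_moments_integrable[OF r] by (auto simp: L_def distrib_left fin_moments_add)
    show "(\<lambda>x. c * f x) \<in> L" if "f \<in> L" for c f
      using that by (auto simp: L_def mult.left_commute fin_moments_cmult)
    show "mprod C \<in> L" if C: "C \<subset># mset (fes is)" for C
    proof -
      have gC: "basis_mset C" using less.prems C unfolding basis_mset_def i(2)
        by (meson mset_subset_eqD subset_mset.less_imp_le)
      moreover have "size C < size B" using mset_subset_size[OF C] unfolding i(2) .
      ultimately show ?thesis using less.hyps mprod_fin_moments[OF basis_mset_V[OF gC]] by (simp add: L_def)
    qed
  qed (simp add: L_def P.fin_moments_const)
  then have "(\<integral>z. r z * (W (fes is) z - mprod B z) \<partial>m) = 0" unfolding L_def i(2) by simp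
  moreover have "integrable m (\<lambda>z. r z * W (fes is) z)" "integrable m (\<lambda>z. r z * mprod B z)"
    using L2R_fin_moments_integrable[OF r wp_fin_moments[OF fes_V]] L2R_fin_moments_integrable[OF r mprod_fin_moments[OF basis_mset_V[OF less.prems]]] by auto
  ultimately show ?case using orth[OF i(1)] by (simp add: right_diff_distrib)
qed

lemma orthogonal_power:
  assumes r: "r \<in> L2R m" and orth: "\<And>B. basis_mset B \<Longrightarrow> (\<integral>z. r z * mprod B z \<partial>m) = 0"
    and X: "X \<in> gvar_span"
  shows "(\<integral>z. r z * X z ^ n \<partial>m) = 0"
proof -
  \<comment> \<open>Membership quantifies over all further monomials, which makes the family stable
    under multiplication by a coordinate functional and, by linearity, by every element of the
    span.\<close>
  define A where "A = {h. fin_moments m h \<and> (\<forall>B. basis_mset B \<longrightarrow> (\<integral>z. r z * (h z * mprod B z) \<partial>m) = 0)}"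
  have fB: "fin_moments m (mprod B)" if "basis_mset B" for B by (rule mprod_fin_moments[OF basis_mset_V[OF that]])
  have step: "(\<lambda>z. Y z * h z) \<in> A" if Y: "Y \<in> gvar_span" and h: "h \<in> A" for Y h
    using Y
  proof (rule fspan_induct)
    fix g assume "g \<in> {gvar J e k | k. k \<noteq> 0}"
    then obtain k where k: "k \<noteq> 0" "g = inner (frak k)" by (auto simp: gvar_eq)
    have "(\<integral>z. r z * (g z * h z * mprod B z) \<partial>m) = 0" if B: "basis_mset B" for B
    proof -
      have "basis_mset (add_mset g B)" using B k by (auto simp: basis_mset_def)
      then have "(\<integral>z. r z * (h z * mprod (add_mset g B) z) \<partial>m) = 0" using h by (auto simp: A_def)
      then show ?thesis by (simp add: mult_ac)
    qed
    moreover have "fin_moments m (\<lambda>z. g z * h z)"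
      using h fin_moments_mult[OF V_fin_moments[OF inner_V[of "frak k"]]] unfolding A_def k by auto
    ultimately show "(\<lambda>z. g z * h z) \<in> A" by (auto simp: A_def)
  next
    show "(\<lambda>z. 0 * h z) \<in> A" by (simp add: A_def P.fin_moments_const)
  next
    fix f g assume fg: "(\<lambda>z. f z * h z) \<in> A" "(\<lambda>z. g z * h z) \<in> A"
    have "(\<integral>z. r z * ((f z * h z + g z * h z) * mprod B z) \<partial>m) = 0" if B: "basis_mset B" for B
    proof -
      have "integrable m (\<lambda>z. r z * (f z * h z * mprod B z))" "integrable m (\<lambda>z. r z * (g z * h z * mprod B z))"
        using fg by (auto simp: A_def intro!: L2R_fin_moments_integrable[OF r] fin_moments_mult[OF _ fB[OF B]])
      then show ?thesis using fg B by (simp add: A_def distrib_left distrib_right)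
    qed
    then show "(\<lambda>z. (f z + g z) * h z) \<in> A"
      using fg by (auto simp: A_def distrib_right fin_moments_add)
  next
    fix c f assume f: "(\<lambda>z. f z * h z) \<in> A"
    then have "fin_moments m (\<lambda>z. c * (f z * h z))" by (auto simp: A_def intro!: fin_moments_cmult)
    moreover have "(\<integral>z. r z * (c * (f z * h z) * mprod B z) \<partial>m) = 0" if "basis_mset B" for B
    proof -
      have "(\<integral>z. r z * (c * (f z * h z) * mprod B z) \<partial>m) = (\<integral>z. c * (r z * (f z * h z * mprod B z)) \<partial>m)"
        by (simp add: mult_ac)
      also have "\<dots> = 0" using f that by (simp add: A_def)
      finally show ?thesis .
    qed
    ultimately show "(\<lambda>z. c * f z * h z) \<in> A" by (simp add: A_def mult.assoc)
  qed
  have "(\<lambda>z. X z ^ n) \<in> A"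
  proof (induction n)
    case 0
    then show ?case using orth by (simp add: A_def P.fin_moments_const)
  next
    case (Suc n)
    then show ?case using step[OF X Suc] by simp
  qed
  moreover have "basis_mset {#}" by (simp add: basis_mset_def)
  ultimately show ?thesis by (auto simp: A_def dest!: spec[of _ "{#}"])
qed

text \<open>The quotient is the central binomial coefficient divided by
  \<open>2 ^ n * fact n\<close>, and that coefficient is at most 4^n. It controls the L2 size of the
  Taylor remainders of a Gaussian exponential.\<close>

lemma gmom_bound: "gmom (2 * n) / (fact n)\<^sup>2 \<le> 2 ^ n / fact n"
proof -
  have "gmom (2 * n) / (fact n)\<^sup>2 = (fact (2 * n) / (fact n * fact n)) / (2 ^ n * fact n)"
    by (simp add: gmom_def power2_eq_square)
  also have "fact (2 * n) / (fact n * fact n) = real ((2 * n) choose n)"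
    by (simp add: binomial_fact)
  also have "real ((2 * n) choose n) \<le> 2 ^ (2 * n)"
    using binomial_le_pow2[of "2 * n" n] by (metis of_nat_le_iff of_nat_numeral of_nat_power)
  also have "(2 ^ (2 * n) :: real) = 2 ^ n * 2 ^ n" by (simp add: mult_2 power_add)
  finally show ?thesis by (simp add: divide_right_mono)
qed

lemma L2R_iexp_integrable:
  assumes r: "r \<in> L2R m" and [measurable]: "Y \<in> borel_measurable m"
  shows "integrable m (\<lambda>z. of_real (r z) * iexp (Y z))"
proof (rule Bochner_Integration.integrable_bound)
  have [measurable]: "r \<in> borel_measurable m" using r by (rule L2R_D)
  show "integrable m r" by (rule P.L2R_integrable[OF r])
  show "(\<lambda>z. of_real (r z) * iexp (Y z)) \<in> borel_measurable m" by measurable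
qed (simp add: norm_mult)

text \<open>All Taylor polynomials of the exponential are orthogonal to r, so only the remainder
  counts; its L2 norm tends to 0 because the factorial beats the Gaussian moments.\<close>

lemma orthogonal_iexp_fspan:
  assumes r: "r \<in> L2R m" and orth: "\<And>n. (\<integral>z. r z * X z ^ n \<partial>m) = 0" and X: "X \<in> V"
  shows "(\<integral>z. of_real (r z) * iexp (X z) \<partial>m) = 0"
proof -
  have [measurable]: "r \<in> borel_measurable m" using r by (rule L2R_D)
  have [measurable]: "X \<in> borel_measurable m" by (rule V_meas[OF X])
  define v where "v = (\<integral>z. (X z)\<^sup>2 \<partial>m)"
  have v0: "v \<ge> 0" by (simp add: v_def)
  note Xf = V_fin_moments[OF X]
  have bound: "cmod (\<integral>z. of_real (r z) * iexp (X z) \<partial>m) \<le> L2norm m r * sqrt ((2 * v) ^ Suc n / fact (Suc n))" for n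
  proof -
    have i1: "integrable m (\<lambda>z. of_real (r z) * iexp (X z))" by (rule L2R_iexp_integrable[OF r]) simp
    have i2: "integrable m (\<lambda>z. of_real (r z) * (\<i> * of_real (X z)) ^ k / fact k :: complex)" for k
    proof -
      have "integrable m (\<lambda>z. (\<i> ^ k / fact k) * complex_of_real (r z * X z ^ k))"
        by (intro integrable_mult_right integrable_of_real L2R_fin_moments_integrable[OF r] P.fin_moments_power Xf)
      then show ?thesis by (simp add: power_mult_distrib mult_ac)
    qed
    have z: "(\<integral>z. of_real (r z) * (\<i> * of_real (X z)) ^ k / fact k \<partial>m) = (0::complex)" for k
    proof -
      have "(\<integral>z. of_real (r z) * (\<i> * of_real (X z)) ^ k / fact k \<partial>m) = (\<integral>z. (\<i> ^ k / fact k) * complex_of_real (r z * X z ^ k) \<partial>m)"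
        by (simp add: power_mult_distrib mult_ac)
      also have "\<dots> = 0" by (simp only: integral_mult_right_zero integral_complex_of_real orth) simp
      finally show ?thesis .
    qed
    have "(\<integral>z. of_real (r z) * iexp (X z) \<partial>m)
      = (\<integral>z. of_real (r z) * iexp (X z) - (\<Sum>k\<le>n. of_real (r z) * (\<i> * of_real (X z)) ^ k / fact k) \<partial>m)"
      by (subst Bochner_Integration.integral_diff[OF i1 Bochner_Integration.integrable_sum[OF i2]],
          subst Bochner_Integration.integral_sum[OF i2]) (simp only: z sum.neutral_const diff_zero)
    also have "cmod \<dots> \<le> (\<integral>z. \<bar>r z\<bar> * (\<bar>X z\<bar> ^ Suc n / fact (Suc n)) \<partial>m)"
    proof (rule order_trans[OF integral_norm_bound integral_mono])
      show "integrable m (\<lambda>z. cmod (of_real (r z) * iexp (X z) - (\<Sum>k\<le>n. of_real (r z) * (\<i> * of_real (X z)) ^ k / fact k)))"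
        by (intro integrable_norm Bochner_Integration.integrable_diff i1 Bochner_Integration.integrable_sum i2)
      have "integrable m (\<lambda>z. \<bar>r z * X z ^ Suc n\<bar>)"
        by (intro Bochner_Integration.integrable_abs L2R_fin_moments_integrable[OF r] P.fin_moments_power Xf)
      then have "integrable m (\<lambda>z. \<bar>r z * X z ^ Suc n\<bar> / fact (Suc n))" by (rule integrable_divide)
      then show "integrable m (\<lambda>z. \<bar>r z\<bar> * (\<bar>X z\<bar> ^ Suc n / fact (Suc n)))" by (simp add: abs_mult power_abs)
      fix z
      have "of_real (r z) * iexp (X z) - (\<Sum>k\<le>n. of_real (r z) * (\<i> * of_real (X z)) ^ k / fact k)
         = of_real (r z) * (iexp (X z) - (\<Sum>k\<le>n. (\<i> * of_real (X z)) ^ k / fact k))"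
        by (simp add: right_diff_distrib sum_distrib_left)
      then show "cmod (of_real (r z) * iexp (X z) - (\<Sum>k\<le>n. of_real (r z) * (\<i> * of_real (X z)) ^ k / fact k))
         \<le> \<bar>r z\<bar> * (\<bar>X z\<bar> ^ Suc n / fact (Suc n))"
        using iexp_approx1[of "X z" n] by (simp only: norm_mult norm_of_real) (intro mult_left_mono, auto)
    qed
    also have "\<dots> \<le> L2norm m (\<lambda>z. \<bar>r z\<bar>) * L2norm m (\<lambda>z. \<bar>X z\<bar> ^ Suc n / fact (Suc n))"
    proof (rule order_trans[OF abs_ge_self L2_Cauchy_Schwarz])
      show "(\<lambda>z. \<bar>r z\<bar>) \<in> L2R m" using r by (auto simp: L2R_def)
      have "fin_moments m (\<lambda>z. \<bar>X z\<bar>)" using Xf by (auto simp: fin_moments_def)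
      then have "(\<lambda>z. (1 / fact (Suc n)) * \<bar>X z\<bar> ^ Suc n) \<in> L2R m"
        by (intro fin_moments_L2R fin_moments_cmult P.fin_moments_power)
      then show "(\<lambda>z. \<bar>X z\<bar> ^ Suc n / fact (Suc n)) \<in> L2R m" by simp
    qed
    also have "L2norm m (\<lambda>z. \<bar>r z\<bar>) = L2norm m r" by (simp add: L2norm_def)
    also have "L2norm m (\<lambda>z. \<bar>X z\<bar> ^ Suc n / fact (Suc n)) \<le> sqrt ((2 * v) ^ Suc n / fact (Suc n))"
    proof -
      have "(\<integral>z. (\<bar>X z\<bar> ^ Suc n / fact (Suc n))\<^sup>2 \<partial>m) = (\<integral>z. X z ^ (2 * Suc n) / (fact (Suc n))\<^sup>2 \<partial>m)"
      proof -
        have "(\<bar>x\<bar> ^ Suc n)\<^sup>2 = x ^ (2 * Suc n)" for x :: real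
          by (metis power2_abs power_abs power_even_eq)
        then show ?thesis by (simp only: power_divide)
      qed
      also have "\<dots> = gmom (2 * Suc n) * v ^ Suc n / (fact (Suc n))\<^sup>2"
      proof -
        have "sqrt v ^ (2 * Suc n) = v ^ Suc n" using v0 by (simp only: power_mult real_sqrt_pow2)
        then show ?thesis using V_moments(2)[OF X, of "2 * Suc n"] by (simp only: integral_divide_zero v_def[symmetric])
      qed
      also have "\<dots> \<le> (2 * v) ^ Suc n / fact (Suc n)"
        using mult_right_mono[OF gmom_bound[of "Suc n"], of "v ^ Suc n"] v0
        by (simp only: power_mult_distrib) (simp add: mult_ac)
      finally show ?thesis unfolding L2norm_def by (rule real_sqrt_le_mono)
    qed
    finally show ?thesis by (simp add: mult_left_mono)
  qed
  have "(\<lambda>n. (2 * v) ^ n / fact n) \<longlonglongrightarrow> 0"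
    using summable_LIMSEQ_zero[OF summable_exp[of "2 * v"]] by (simp add: field_simps)
  then have "(\<lambda>n. L2norm m r * sqrt ((2 * v) ^ Suc n / fact (Suc n))) \<longlonglongrightarrow> L2norm m r * sqrt 0"
    by (intro tendsto_mult tendsto_const tendsto_real_sqrt LIMSEQ_Suc[where f="\<lambda>n. (2 * v) ^ n / fact n"])
  then have "(\<lambda>n. L2norm m r * sqrt ((2 * v) ^ Suc n / fact (Suc n))) \<longlonglongrightarrow> 0" by simp
  then have "cmod (\<integral>z. of_real (r z) * iexp (X z) \<partial>m) \<le> 0"
    by (rule LIMSEQ_le_const) (use bound in auto)
  then show ?thesis by simp
qed

text \<open>By the Lipschitz bound for \<open>iexp\<close>, pairing with r is continuous in the
  exponent for the L2 norm, so the relation extends from the span to its closure.\<close>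

lemma orthogonal_iexp:
  assumes r: "r \<in> L2R m" and orth: "\<And>X. X \<in> gvar_span \<Longrightarrow> (\<integral>z. of_real (r z) * iexp (X z) \<partial>m) = 0"
  shows "(\<integral>z. of_real (r z) * iexp (inner x z) \<partial>m) = 0"
proof (rule ccontr)
  assume ne: "(\<integral>z. of_real (r z) * iexp (inner x z) \<partial>m) \<noteq> 0"
  define d where "d = cmod (\<integral>z. of_real (r z) * iexp (inner x z) \<partial>m)"
  have d: "d > 0" using ne by (simp add: d_def)
  have "d / (L2norm m r + 1) > 0" using d by (simp add: add_nonneg_pos)
  then obtain g where g: "g \<in> gvar_span" "L2norm m (\<lambda>z. inner x z - g z) < d / (L2norm m r + 1)"
    using inner_in_Gspace[of x] unfolding Gspace_def L2closure_def by blast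
  have gR: "g \<in> L2R m" using g(1) fspan_gvar_L2R by auto
  note [measurable] = L2R_D(1)[OF gR] L2R_D(1)[OF r]
  note dR = L2R_diff[OF inner_L2R[of x] gR]
  have i: "integrable m (\<lambda>z. of_real (r z) * iexp (inner x z))" "integrable m (\<lambda>z. of_real (r z) * iexp (g z))"
    by (rule L2R_iexp_integrable[OF r]; simp)+
  have rR: "(\<lambda>z. \<bar>r z\<bar>) \<in> L2R m" "(\<lambda>z. \<bar>inner x z - g z\<bar>) \<in> L2R m" using r dR by (auto simp: L2R_def)
  have "(\<integral>z. of_real (r z) * iexp (inner x z) \<partial>m) = (\<integral>z. of_real (r z) * iexp (inner x z) - of_real (r z) * iexp (g z) \<partial>m)"
    using orth[OF g(1)] i by simp
  also have "cmod \<dots> \<le> (\<integral>z. \<bar>r z\<bar> * \<bar>inner x z - g z\<bar> \<partial>m)"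
  proof (rule order_trans[OF integral_norm_bound integral_mono])
    show "integrable m (\<lambda>z. cmod (of_real (r z) * iexp (inner x z) - of_real (r z) * iexp (g z)))"
      by (intro integrable_norm Bochner_Integration.integrable_diff i)
    show "integrable m (\<lambda>z. \<bar>r z\<bar> * \<bar>inner x z - g z\<bar>)"
      by (rule L2R_mult_integrable[OF rR])
    show "cmod (of_real (r z) * iexp (inner x z) - of_real (r z) * iexp (g z)) \<le> \<bar>r z\<bar> * \<bar>inner x z - g z\<bar>" for z
      using iexp_diff_le[of "inner x z" "g z"]
      by (simp only: right_diff_distrib[symmetric] norm_mult norm_of_real) (intro mult_left_mono, auto)
  qed
  also have "\<dots> \<le> L2norm m (\<lambda>z. \<bar>r z\<bar>) * L2norm m (\<lambda>z. \<bar>inner x z - g z\<bar>)"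
    by (rule order_trans[OF abs_ge_self L2_Cauchy_Schwarz[OF rR]])
  also have "\<dots> = L2norm m r * L2norm m (\<lambda>z. inner x z - g z)" by (simp add: L2norm_def)
  also have "\<dots> \<le> (L2norm m r + 1) * L2norm m (\<lambda>z. inner x z - g z)" by (simp add: distrib_right)
  also have "\<dots> < d"
  proof -
    have "L2norm m r + 1 > 0" by (simp add: add_nonneg_pos)
    then show ?thesis using g(2) by (simp add: pos_less_divide_eq mult.commute)
  qed
  finally show False by (simp add: d_def)
qed

text \<open>The positive and negative parts of r are densities of two finite measures with the same
  characteristic function. The measures coincide, so the parts agree; since one of them is zero at
  each point, both vanish.\<close>

lemma wick_total:
  assumes r: "r \<in> L2R m" and orth: "\<And>is. 0 \<notin> set is \<Longrightarrow> (\<integral>z. r z * W (fes is) z \<partial>m) = 0"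
  shows "AE z in m. r z = 0"
proof -
  have [measurable]: "r \<in> borel_measurable m" using r by (rule L2R_D)
  have ri: "integrable m r" by (rule P.L2R_integrable[OF r])
  have o1: "(\<integral>z. of_real (r z) * iexp (inner x z) \<partial>m) = 0" for x
  proof (rule orthogonal_iexp[OF r])
    fix X assume X: "X \<in> gvar_span"
    have "X \<in> V" unfolding Gspace_def by (rule L2closure_base[OF X]) (use X fspan_gvar_L2R in auto)
    moreover have "(\<integral>z. r z * X z ^ n \<partial>m) = 0" for n
      by (rule orthogonal_power[OF r orthogonal_mprod[OF r orth] X])
    ultimately show "(\<integral>z. of_real (r z) * iexp (X z) \<partial>m) = 0"
      by (intro orthogonal_iexp_fspan[OF r])
  qed
  define p q where "p z = max 0 (r z)" and "q z = max 0 (- r z)" for z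
  have [measurable]: "p \<in> borel_measurable m" "q \<in> borel_measurable m" by (auto simp: p_def[abs_def] q_def[abs_def])
  have pq: "integrable m p" "integrable m q" unfolding p_def[abs_def] q_def[abs_def] using ri by auto
  have nn: "0 \<le> p z" "0 \<le> q z" for z by (auto simp: p_def q_def)
  have fin: "finite_measure (density m p)" if "integrable m p" "\<And>z. 0 \<le> p z" for p :: "'h \<Rightarrow> real"
  proof (rule finite_measureI)
    have [measurable]: "p \<in> borel_measurable m" using that by auto
    show "emeasure (density m p) (space (density m p)) \<noteq> \<infinity>"
      using nn_integral_eq_integral[OF that(1)] that(2) by (simp add: emeasure_density)
  qed
  have "density m p = density m q"
  proof (rule hilbert_char_unique[OF sep fin[OF pq(1) nn(1)] fin[OF pq(2) nn(2)]])
    fix x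
    have i: "integrable m (\<lambda>z. p z *\<^sub>R iexp (inner x z))" "integrable m (\<lambda>z. q z *\<^sub>R iexp (inner x z))"
      by (rule Bochner_Integration.integrable_bound[OF pq(1)], simp_all)
         (rule Bochner_Integration.integrable_bound[OF pq(2)], simp_all)
    have "(\<integral>z. iexp (inner x z) \<partial>density m p) - (\<integral>z. iexp (inner x z) \<partial>density m q)
      = (\<integral>z. p z *\<^sub>R iexp (inner x z) \<partial>m) - (\<integral>z. q z *\<^sub>R iexp (inner x z) \<partial>m)"
      using nn by (simp add: integral_density)
    also have "\<dots> = (\<integral>z. p z *\<^sub>R iexp (inner x z) - q z *\<^sub>R iexp (inner x z) \<partial>m)" using i by simp
    also have "\<dots> = (\<integral>z. of_real (r z) * iexp (inner x z) \<partial>m)"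
      by (rule Bochner_Integration.integral_cong) (auto simp: p_def q_def scaleR_conv_of_real max_def)
    also have "\<dots> = 0" by (rule o1)
    finally show "(\<integral>z. iexp (inner x z) \<partial>density m p) = (\<integral>z. iexp (inner x z) \<partial>density m q)" by simp
  qed (simp_all add: sets_m)
  then have "AE z in m. ennreal (p z) = ennreal (q z)"
    by (subst (asm) P.density_unique_iff) auto
  then show ?thesis by eventually_elim (auto simp: p_def q_def max_def split: if_splits)
qed

subsection \<open>Chaos expansion\<close>

definition index_range :: "nat \<Rightarrow> int set" where
  "index_range N = {- int N..int N} - {0}"

lemma finite_index_range [simp]: "finite (index_range N)" by (simp add: index_range_def)

lemma zero_notin_index_range [simp]: "0 \<notin> index_range N" by (simp add: index_range_def)

lemma index_range_mono: "M \<le> N \<Longrightarrow> index_range M \<subseteq> index_range N" by (auto simp: index_range_def)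

lemma zero_notin_wlists_index_range: "is \<in> wlists (index_range N) k \<Longrightarrow> 0 \<notin> set is"
  using zero_notin_index_range[of N] unfolding wlists_def by blast

lemma wlists_index_range_exhaust:
  assumes "0 \<notin> set is" obtains N where "is \<in> wlists (index_range N) (length is)"
proof -
  obtain b where b: "\<And>i. i \<in> set is \<Longrightarrow> \<bar>i\<bar> \<le> b"
    using finite_imageI[of "set is" abs] by (metis List.finite_set Max_ge imageI)
  have "set is \<subseteq> index_range (nat b)"
  proof
    fix i assume i: "i \<in> set is"
    then have "i \<noteq> 0" using assms by metis
    then show "i \<in> index_range (nat b)" using b[OF i] by (auto simp: index_range_def)
  qed
  then show ?thesis using that by (auto simp: wlists_def)
qed

lemma W_fin_moments: "fin_moments m (W (fes is))"
  by (rule wp_fin_moments[OF fes_V])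

lemma W_L2R: "W (fes is) \<in> L2R m"
  by (rule fin_moments_L2R[OF W_fin_moments])

text \<open>The part of the k-th chaos component carried by indices up to N. A multi-index occurs
  together with all its permutations, which matches the k! in the denominator of the
  coefficient.\<close>

definition chaos :: "nat \<Rightarrow> nat \<Rightarrow> ('h \<Rightarrow> real) \<Rightarrow> 'h \<Rightarrow> real" where
  "chaos N k f z = (\<Sum>i\<in>wlists (index_range N) k. coef f i * W (fes i) z)"

text \<open>One parameter cuts off both the degree and the indices, so that a single limit recovers
  f.\<close>

definition proj :: "nat \<Rightarrow> ('h \<Rightarrow> real) \<Rightarrow> 'h \<Rightarrow> real" where
  "proj N f z = (\<Sum>k\<le>N. chaos N k f z)"

lemma chaos_L2R: "chaos N k f \<in> L2R m"
  unfolding chaos_def[abs_def] by (intro L2R_sum L2R_cmult W_L2R)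

lemma proj_L2R: "proj N f \<in> L2R m"
  unfolding proj_def[abs_def] by (intro L2R_sum chaos_L2R)

lemma integral_chaos:
  assumes h: "h \<in> L2R m"
  shows "(\<integral>z. chaos N k f z * h z \<partial>m) = (\<Sum>i\<in>wlists (index_range N) k. coef f i * (\<integral>z. W (fes i) z * h z \<partial>m))"
proof -
  have "(\<integral>z. chaos N k f z * h z \<partial>m) = (\<integral>z. (\<Sum>i\<in>wlists (index_range N) k. coef f i * (W (fes i) z * h z)) \<partial>m)"
    by (simp add: chaos_def sum_distrib_right mult.assoc)
  also have "\<dots> = (\<Sum>i\<in>wlists (index_range N) k. \<integral>z. coef f i * (W (fes i) z * h z) \<partial>m)"
    by (rule Bochner_Integration.integral_sum) (intro integrable_mult_right L2R_mult_integrable W_L2R h)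
  finally show ?thesis by simp
qed

lemma integral_proj:
  assumes h: "h \<in> L2R m"
  shows "(\<integral>z. proj N f z * h z \<partial>m) = (\<Sum>k\<le>N. \<integral>z. chaos N k f z * h z \<partial>m)"
proof -
  have "(\<integral>z. proj N f z * h z \<partial>m) = (\<integral>z. (\<Sum>k\<le>N. chaos N k f z * h z) \<partial>m)"
    by (simp add: proj_def sum_distrib_right)
  also have "\<dots> = (\<Sum>k\<le>N. \<integral>z. chaos N k f z * h z \<partial>m)"
    by (rule Bochner_Integration.integral_sum) (intro L2R_mult_integrable chaos_L2R h)
  finally show ?thesis .
qed

lemma W_orthogonal:
  assumes V: "set Xs \<subseteq> V" "set Ys \<subseteq> V" and ne: "length Xs \<noteq> length Ys"
  shows "(\<integral>z. W Xs z * W Ys z \<partial>m) = 0"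
proof (cases "length Ys < length Xs")
  case True
  then show ?thesis using integral_wp_wp[OF V] Psi_eq_0_size[OF V(1), of "mset Ys"] V(2) by simp
next
  case False
  then have l: "length Xs < length Ys" using ne by simp
  have "(\<integral>z. W Xs z * W Ys z \<partial>m) = (\<integral>z. W Ys z * W Xs z \<partial>m)" by (simp add: mult.commute)
  also have "\<dots> = 0" using l integral_wp_wp[OF V(2,1)] Psi_eq_0_size[OF V(2), of "mset Xs"] V(1) by simp
  finally show ?thesis .
qed

lemma sum_alpha_coef_W:
  assumes Xs: "set Xs \<subseteq> V" "length Xs = k"
  shows "(\<Sum>j\<in>wlists (index_range N) k. coef g j * (\<integral>z. W Xs z * W (fes j) z \<partial>m))
    = fact k * (\<Sum>j\<in>wlists (index_range N) k. coef g j * (\<Prod>l<k. Q (Xs ! l) (inner (frak (j ! l)))))"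
proof -
  \<comment> \<open>The coefficient as a function of a multiset; the chosen listing does not matter,
    by \<open>alpha_coef_mset\<close>.\<close>
  define b where "b M = coef g (SOME js. mset js = M)" for M
  have b: "b (mset j) = coef g j" for j
    unfolding b_def by (rule alpha_coef_mset) (rule someI_ex, blast)
  have "(\<integral>z. W Xs z * W (fes j) z \<partial>m) = Psi Xs {#} (mset (fes j))" if "j \<in> wlists (index_range N) k" for j
    using wlists_length[OF that] Xs by (intro integral_wp_wp fes_V) auto
  then have "(\<Sum>j\<in>wlists (index_range N) k. coef g j * (\<integral>z. W Xs z * W (fes j) z \<partial>m))
     = (\<Sum>j\<in>wlists (index_range N) k. b (mset j) * Psi Xs {#} (mset (fes j)))"
    by (simp add: b)
  also have "\<dots> = fact k * (\<Sum>j\<in>wlists (index_range N) k. b (mset j) * (\<Prod>l<k. Q (Xs ! l) (inner (frak (j ! l)))))"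
    by (rule sum_symmetric_Psi) (use Xs in auto)
  finally show ?thesis by (simp add: b)
qed

text \<open>The covariance is diagonal in the basis and the permutations have been absorbed into k!,
  so only the index list j itself survives, and the denominator of its coefficient cancels.\<close>

lemma integral_chaos_W:
  assumes f: "f \<in> L2R m" and j: "j \<in> wlists (index_range N) k"
  shows "(\<integral>z. chaos N k f z * W (fes j) z \<partial>m) = (\<integral>z. f z * W (fes j) z \<partial>m)"
proof -
  note lj = wlists_length[OF j] and nz = zero_notin_wlists_index_range[OF j]
  define s where "s = (\<Prod>l<k. cov (frak (j ! l)) (frak (j ! l)))"
  have "(\<integral>z. chaos N k f z * W (fes j) z \<partial>m)
     = (\<Sum>i\<in>wlists (index_range N) k. coef f i * (\<integral>z. W (fes j) z * W (fes i) z \<partial>m))"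
    by (simp add: integral_chaos[OF W_L2R] mult.commute)
  also have "\<dots> = fact k * (\<Sum>i\<in>wlists (index_range N) k. coef f i * (\<Prod>l<k. Q (fes j ! l) (inner (frak (i ! l)))))"
    by (rule sum_alpha_coef_W[OF fes_V]) (simp add: lj)
  also have "(\<Sum>i\<in>wlists (index_range N) k. coef f i * (\<Prod>l<k. Q (fes j ! l) (inner (frak (i ! l)))))
     = (\<Sum>i\<in>wlists (index_range N) k. if i = j then coef f j * s else 0)"
  proof (rule sum.cong)
    fix i assume i: "i \<in> wlists (index_range N) k"
    note li = wlists_length[OF i] and inz = zero_notin_wlists_index_range[OF i]
    have Q: "Q (fes j ! l) (inner (frak (i ! l))) = cov (frak (j ! l)) (frak (i ! l))" if "l < k" for l
      using that lj Q_inner[of "frak (j ! l)" "frak (i ! l)"] by simp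
    show "coef f i * (\<Prod>l<k. Q (fes j ! l) (inner (frak (i ! l)))) = (if i = j then coef f j * s else 0)"
    proof (cases "i = j")
      case True
      then show ?thesis using Q by (simp add: s_def)
    next
      case False
      then obtain l where l: "l < k" "i ! l \<noteq> j ! l" using li lj nth_equalityI by metis
      have "j ! l \<noteq> 0" "i ! l \<noteq> 0" using l(1) nz inz li lj by (metis nth_mem)+
      then have "Q (fes j ! l) (inner (frak (i ! l))) = 0" using Q[OF l(1)] cov_frak l(2) by metis
      then have "(\<Prod>l<k. Q (fes j ! l) (inner (frak (i ! l)))) = 0" using l(1) by (intro prod_zero) auto
      then show ?thesis using False by simp
    qed
  qed simp
  also have "\<dots> = coef f j * s" using j by (simp add: finite_wlists)
  finally have main: "(\<integral>z. chaos N k f z * W (fes j) z \<partial>m) = fact k * (coef f j * s)" .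
  have \<alpha>j: "coef f j = (\<integral>z. f z * W (fes j) z \<partial>m) / (fact k * s)"
    using alpha_coef_eq[OF f nz] by (simp add: lj s_def)
  show ?thesis
  proof (cases "s = 0")
    case False
    then show ?thesis unfolding main \<alpha>j by simp
  next
    \<comment> \<open>A vanishing variance leaves no denominator to cancel, but then the Wick
      polynomial itself is null, so both sides are 0.\<close>
    case True
    then obtain l where l: "l < k" "cov (frak (j ! l)) (frak (j ! l)) = 0" unfolding s_def by auto
    have "Psi (fes j) {#} (mset (fes j)) = 0"
    proof (rule Psi_eq_0_degenerate[where X="inner (frak (j ! l))"])
      show "inner (frak (j ! l)) \<in> set (fes j)" using l lj by auto
      fix c assume "c \<in># mset (fes j)"
      then obtain i where i: "i \<in> set j" "c = inner (frak i)" by auto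
      have "j ! l \<noteq> 0" "i \<noteq> 0" using l(1) lj nz i(1) by (metis nth_mem)+
      then show "Q (inner (frak (j ! l))) c = 0"
        using l(2) cov_frak[of "j ! l" i] Q_inner[of "frak (j ! l)" "frak i"] i(2) by (cases "i = j ! l") auto
    qed auto
    then have "(\<integral>z. W (fes j) z * W (fes j) z \<partial>m) = 0" using integral_wp_wp[OF fes_V fes_V, of j j] by simp
    then have "L2norm m (W (fes j)) = 0" by (simp add: L2norm_def power2_eq_square)
    then have ae: "AE z in m. W (fes j) z = 0" by (rule L2norm_eq_0_AE[OF W_L2R])
    have [measurable]: "f \<in> borel_measurable m" "W (fes j) \<in> borel_measurable m" using f W_L2R L2R_D by blast+
    have "(\<integral>z. f z * W (fes j) z \<partial>m) = (\<integral>z. 0 \<partial>m)" by (rule integral_cong_AE) (use ae in auto)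
    then show ?thesis unfolding main using True by simp
  qed
qed

lemma integral_proj_W:
  assumes f: "f \<in> L2R m" and j: "j \<in> wlists (index_range N) k" and k: "k \<le> N"
  shows "(\<integral>z. proj N f z * W (fes j) z \<partial>m) = (\<integral>z. f z * W (fes j) z \<partial>m)"
proof -
  have "(\<integral>z. chaos N k' f z * W (fes j) z \<partial>m) = (if k' = k then (\<integral>z. f z * W (fes j) z \<partial>m) else 0)" for k'
  proof (cases "k' = k")
    case True
    then show ?thesis using integral_chaos_W[OF f j] by simp
  next
    case False
    have "(\<integral>z. W (fes i) z * W (fes j) z \<partial>m) = 0" if "i \<in> wlists (index_range N) k'" for i
      using wlists_length[OF that] wlists_length[OF j] False by (intro W_orthogonal fes_V) auto
    then show ?thesis using False by (simp add: integral_chaos[OF W_L2R])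
  qed
  then show ?thesis unfolding integral_proj[OF W_L2R] using k by simp
qed

text \<open>The residual of a truncation is thus orthogonal to every truncation of at most the same
  order: \<open>proj\<close> acts as an orthogonal projection onto increasing spaces.\<close>

lemma integral_residual_proj:
  assumes f: "f \<in> L2R m" and MN: "M \<le> N"
  shows "(\<integral>z. f z * proj M h z \<partial>m) = (\<integral>z. proj N f z * proj M h z \<partial>m)"
proof -
  have *: "(\<integral>z. u z * proj M h z \<partial>m)
     = (\<Sum>k\<le>M. \<Sum>i\<in>wlists (index_range M) k. coef h i * (\<integral>z. u z * W (fes i) z \<partial>m))" if "u \<in> L2R m" for u
    using integral_proj[OF that, of M h] integral_chaos[OF that, of M _ h] by (simp add: mult.commute)
  show ?thesis unfolding *[OF f] *[OF proj_L2R]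
  proof (intro sum.cong refl arg_cong2[where f="(*)"])
    fix k i assume k: "k \<in> {..M}" and i: "i \<in> wlists (index_range M) k"
    have "i \<in> wlists (index_range N) k" using i wlists_mono[OF index_range_mono[OF MN]] by auto
    then show "(\<integral>z. f z * W (fes i) z \<partial>m) = (\<integral>z. proj N f z * W (fes i) z \<partial>m)"
      using integral_proj_W[OF f, of i N k] k MN by auto
  qed
qed

text \<open>By Bessel's inequality the squared norms increase to a finite limit, so the truncations
  are Cauchy; the difference between f and their limit is orthogonal to every Wick polynomial and
  vanishes by totality.\<close>

lemma proj_tendsto:
  assumes f: "f \<in> L2R m"
  shows "(\<lambda>N. L2norm m (\<lambda>z. f z - proj N f z)) \<longlonglongrightarrow> 0"
proof -
  define u where "u N = proj N f" for N
  have uR: "u N \<in> L2R m" for N unfolding u_def by (rule proj_L2R)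
  have uu: "(\<integral>z. u N z * u M z \<partial>m) = (L2norm m (u M))\<^sup>2" if "M \<le> N" for M N
    using integral_residual_proj[OF f that, of f] integral_residual_proj[OF f order_refl, of M f]
    unfolding u_def L2norm_power2 by (simp add: power2_eq_square)
  have diff: "(L2norm m (\<lambda>z. u N z - u M z))\<^sup>2 = (L2norm m (u N))\<^sup>2 - (L2norm m (u M))\<^sup>2" if "M \<le> N" for M N
  proof -
    have i: "integrable m (\<lambda>z. u a z * u b z)" for a b by (rule L2R_mult_integrable[OF uR uR])
    have "(L2norm m (\<lambda>z. u N z - u M z))\<^sup>2 = (\<integral>z. u N z * u N z - 2 * (u N z * u M z) + u M z * u M z \<partial>m)"
      unfolding L2norm_power2 by (simp add: power2_eq_square algebra_simps)
    also have "\<dots> = (\<integral>z. u N z * u N z \<partial>m) - 2 * (\<integral>z. u N z * u M z \<partial>m) + (\<integral>z. u M z * u M z \<partial>m)"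
      using i by simp
    also have "\<dots> = (L2norm m (u N))\<^sup>2 - 2 * (L2norm m (u M))\<^sup>2 + (L2norm m (u M))\<^sup>2"
      by (simp only: uu[OF that] uu[OF order_refl])
    finally show ?thesis by simp
  qed
  have bound: "(L2norm m (u N))\<^sup>2 \<le> (L2norm m f)\<^sup>2" for N
  proof -
    have fu: "(\<integral>z. f z * u N z \<partial>m) = (L2norm m (u N))\<^sup>2"
      using integral_residual_proj[OF f order_refl, of N f] uu[of N N] by (simp add: u_def)
    have "(\<integral>z. (f z - u N z)\<^sup>2 \<partial>m) = (\<integral>z. (f z)\<^sup>2 - 2 * (f z * u N z) + (u N z)\<^sup>2 \<partial>m)"
      by (simp add: power2_diff mult.assoc algebra_simps)
    also have "\<dots> = (L2norm m f)\<^sup>2 - 2 * (L2norm m (u N))\<^sup>2 + (L2norm m (u N))\<^sup>2"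
      using L2R_D(2)[OF f] L2R_D(2)[OF uR] L2R_mult_integrable[OF f uR] fu by (simp add: L2norm_power2)
    finally have eq: "(\<integral>z. (f z - u N z)\<^sup>2 \<partial>m) = (L2norm m f)\<^sup>2 - 2 * (L2norm m (u N))\<^sup>2 + (L2norm m (u N))\<^sup>2" .
    have "0 \<le> (\<integral>z. (f z - u N z)\<^sup>2 \<partial>m)" by simp
    then show ?thesis unfolding eq by simp
  qed
  have "incseq (\<lambda>N. (L2norm m (u N))\<^sup>2)"
  proof (rule incseq_SucI)
    fix N
    show "(L2norm m (u N))\<^sup>2 \<le> (L2norm m (u (Suc N)))\<^sup>2"
      using diff[of N "Suc N"] zero_le_power2[of "L2norm m (\<lambda>z. u (Suc N) z - u N z)"] by simp
  qed
  then obtain L where "(\<lambda>N. (L2norm m (u N))\<^sup>2) \<longlonglongrightarrow> L"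
    using bound by (elim incseq_convergent[where B="(L2norm m f)\<^sup>2"]) simp_all
  then have "convergent (\<lambda>N. (L2norm m (u N))\<^sup>2)" by (rule convergentI)
  then have C: "Cauchy (\<lambda>N. (L2norm m (u N))\<^sup>2)" by (rule convergent_Cauchy)
  obtain h where h: "h \<in> L2R m" "(\<lambda>n. L2norm m (\<lambda>x. u n x - h x)) \<longlonglongrightarrow> 0"
  proof (rule P.L2_complete[OF uR])
    fix \<epsilon> :: real assume \<epsilon>: "\<epsilon> > 0"
    then have "\<epsilon>\<^sup>2 > 0" by simp
    then obtain N where N: "\<And>i j. i \<ge> N \<Longrightarrow> j \<ge> N \<Longrightarrow> dist ((L2norm m (u i))\<^sup>2) ((L2norm m (u j))\<^sup>2) < \<epsilon>\<^sup>2"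
      using C unfolding Cauchy_def by metis
    have 1: "L2norm m (\<lambda>x. u i x - u j x) < \<epsilon>" if "i \<ge> j" "j \<ge> N" for i j
    proof -
      have "(L2norm m (\<lambda>x. u i x - u j x))\<^sup>2 < \<epsilon>\<^sup>2"
        using diff[OF that(1)] N[of i j] that by (simp add: dist_real_def)
      then show ?thesis using \<epsilon> by (simp add: power2_less_imp_less)
    qed
    show "\<exists>N. \<forall>i\<ge>N. \<forall>j\<ge>N. L2norm m (\<lambda>x. u i x - u j x) < \<epsilon>"
    proof (intro exI[of _ N] allI impI)
      fix i j assume "N \<le> i" "N \<le> j"
      then show "L2norm m (\<lambda>x. u i x - u j x) < \<epsilon>"
        using 1[of i j] 1[of j i] L2norm_minus_commute[of m "u i" "u j"] by (cases "j \<le> i") auto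
    qed
  qed
  have "AE z in m. f z - h z = 0"
  proof (rule wick_total[OF L2R_diff[OF f h(1)]])
    fix "is" :: "int list" assume nz: "0 \<notin> set is"
    obtain N0 where N0: "is \<in> wlists (index_range N0) (length is)" using wlists_index_range_exhaust[OF nz] .
    have ev: "(\<integral>z. f z * W (fes is) z \<partial>m) = (\<integral>z. u N z * W (fes is) z \<partial>m)" if "N \<ge> max N0 (length is)" for N
    proof -
      have "is \<in> wlists (index_range N) (length is)" using N0 wlists_mono[OF index_range_mono[of N0 N]] that by auto
      then show ?thesis using integral_proj_W[OF f, of "is" N "length is"] that by (simp add: u_def)
    qed
    have bnd: "\<bar>\<integral>z. (f z - h z) * W (fes is) z \<partial>m\<bar> \<le> L2norm m (\<lambda>x. u N x - h x) * L2norm m (W (fes is))"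
      if "N \<ge> max N0 (length is)" for N
    proof -
      have i: "integrable m (\<lambda>z. g z * W (fes is) z)" if "g \<in> L2R m" for g
        by (rule L2R_mult_integrable[OF that W_L2R])
      have "(\<integral>z. (f z - h z) * W (fes is) z \<partial>m) = (\<integral>z. (u N z - h z) * W (fes is) z \<partial>m)"
        using ev[OF that] i[OF f] i[OF h(1)] i[OF uR] by (simp add: left_diff_distrib)
      then show ?thesis using L2_Cauchy_Schwarz[OF L2R_diff[OF uR h(1)] W_L2R] by simp
    qed
    have lim: "(\<lambda>N. L2norm m (\<lambda>x. u N x - h x) * L2norm m (W (fes is))) \<longlonglongrightarrow> 0"
      using tendsto_mult_left_zero[OF h(2)] .
    have "\<bar>\<integral>z. (f z - h z) * W (fes is) z \<partial>m\<bar> \<le> 0"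
      by (rule LIMSEQ_le_const[OF lim]) (use bnd in blast)
    then show "(\<integral>z. (f z - h z) * W (fes is) z \<partial>m) = 0" by simp
  qed
  then have ae: "AE z in m. f z = h z" by simp
  have "L2norm m (\<lambda>z. f z - proj N f z) = L2norm m (\<lambda>x. u N x - h x)" for N
  proof -
    have [measurable]: "f \<in> borel_measurable m" "h \<in> borel_measurable m" "u N \<in> borel_measurable m"
      using f h(1) uR L2R_D by blast+
    have "(\<integral>z. (f z - u N z)\<^sup>2 \<partial>m) = (\<integral>z. (u N z - h z)\<^sup>2 \<partial>m)"
      by (rule integral_cong_AE) (use ae in \<open>auto simp: power2_commute\<close>)
    then show ?thesis by (simp add: L2norm_def u_def)
  qed
  then show ?thesis using h(2) by simp
qed

text \<open>Invariance of the measure makes composition with \<open>T ^^ n\<close> an L2 isometry,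
  so truncation errors pass through it unchanged.\<close>

lemma integral_proj_Tn_tendsto:
  assumes f: "f \<in> L2R m" and g: "g \<in> L2R m"
  shows "(\<lambda>N. \<integral>z. proj N f ((T ^^ n) z) * proj N g z \<partial>m) \<longlonglongrightarrow> (\<integral>z. f ((T ^^ n) z) * g z \<partial>m)"
proof (rule Lim_transform2[where f="\<lambda>N. \<integral>z. f ((T ^^ n) z) * g z \<partial>m"])
  define d where "d N h = L2norm m (\<lambda>z. h z - proj N h z)" for N h
  have d: "(\<lambda>N. d N f) \<longlonglongrightarrow> 0" "(\<lambda>N. d N g) \<longlonglongrightarrow> 0"
    unfolding d_def using proj_tendsto f g by auto
  have lim: "(\<lambda>N. L2norm m f * d N g + d N f * (L2norm m g + d N g)) \<longlonglongrightarrow> L2norm m f * 0 + 0 * (L2norm m g + 0)"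
    by (intro tendsto_intros d)
  show "(\<lambda>N. (\<integral>z. f ((T ^^ n) z) * g z \<partial>m) - (\<integral>z. proj N f ((T ^^ n) z) * proj N g z \<partial>m)) \<longlonglongrightarrow> 0"
  proof (rule Lim_null_comparison[OF _ lim[simplified]], rule always_eventually, rule allI)
    fix N
    note pf = proj_L2R[of N f] and pg = proj_L2R[of N g]
    note fd = L2R_diff[OF f pf] and gd = L2R_diff[OF g pg]
    have i: "integrable m (\<lambda>z. a ((T ^^ n) z) * b z)" if "a \<in> L2R m" "b \<in> L2R m" for a b
      by (rule L2R_mult_integrable[OF Tn_L2R[OF that(1)] that(2)])
    have cs: "\<bar>\<integral>z. a ((T ^^ n) z) * b z \<partial>m\<bar> \<le> L2norm m a * L2norm m b" if "a \<in> L2R m" "b \<in> L2R m" for a b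
      using L2_Cauchy_Schwarz[OF Tn_L2R[OF that(1), of n] that(2)] Tn_L2norm[OF that(1), of n] by simp
    have "(\<integral>z. f ((T ^^ n) z) * g z \<partial>m) - (\<integral>z. proj N f ((T ^^ n) z) * proj N g z \<partial>m)
      = (\<integral>z. f ((T ^^ n) z) * (g z - proj N g z) \<partial>m) + (\<integral>z. (f ((T ^^ n) z) - proj N f ((T ^^ n) z)) * proj N g z \<partial>m)"
      using i[OF f g] i[OF f pg] i[OF pf pg] by (simp add: right_diff_distrib left_diff_distrib)
    then have 1: "\<bar>(\<integral>z. f ((T ^^ n) z) * g z \<partial>m) - (\<integral>z. proj N f ((T ^^ n) z) * proj N g z \<partial>m)\<bar>
      \<le> L2norm m f * d N g + d N f * L2norm m (proj N g)"
      using cs[OF f gd] cs[OF fd pg] unfolding d_def by linarith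
    have "L2norm m (\<lambda>z. (proj N g z - g z) + g z) \<le> L2norm m (\<lambda>z. proj N g z - g z) + L2norm m g"
      by (rule L2norm_triangle[OF L2R_diff[OF pg g] g])
    then have "L2norm m (proj N g) \<le> L2norm m g + d N g"
      unfolding d_def L2norm_minus_commute[of m g] diff_add_cancel by linarith
    then have "d N f * L2norm m (proj N g) \<le> d N f * (L2norm m g + d N g)"
      by (rule mult_left_mono) (simp add: d_def)
    with 1 show "norm ((\<integral>z. f ((T ^^ n) z) * g z \<partial>m) - (\<integral>z. proj N f ((T ^^ n) z) * proj N g z \<partial>m))
       \<le> L2norm m f * d N g + d N f * (L2norm m g + d N g)"
      by (simp only: real_norm_def)
  qed
qed simp

section \<open>Correlations of the truncated expansions\<close>

text \<open>The pairing of the two coefficient tensors through the k-th tensor power of the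
  covariance, cut off at N. The k! is kept apart because \<open>Ynorm\<close> is going to absorb
  it.\<close>

definition chaos_corr :: "nat \<Rightarrow> nat \<Rightarrow> nat \<Rightarrow> ('h \<Rightarrow> real) \<Rightarrow> ('h \<Rightarrow> real) \<Rightarrow> real" where
  "chaos_corr n N k f g = (\<Sum>i\<in>wlists (index_range N) k. \<Sum>j\<in>wlists (index_range N) k.
      coef f i * coef g j * (\<Prod>l<k. cov (adj n (frak (i ! l))) (frak (j ! l))))"

text \<open>Composition with \<open>T ^^ n\<close> keeps the degree, so different degrees stay
  orthogonal; in equal degree the symmetric coefficients of g absorb the sum over pairings.\<close>

lemma integral_chaos_chaos_Tn:
  "(\<integral>z. chaos N k f ((T ^^ n) z) * chaos N k' g z \<partial>m) = (if k = k' then fact k * chaos_corr n N k f g else 0)"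
proof -
  let ?X = "\<lambda>i. map (\<lambda>i. inner (adj n (frak i))) i"
  have XV: "set (?X i) \<subseteq> V" for i by auto
  have XR: "W (?X i) \<in> L2R m" for i by (rule fin_moments_L2R[OF wp_fin_moments[OF XV]])
  have eq: "(\<integral>z. chaos N k f ((T ^^ n) z) * chaos N k' g z \<partial>m)
     = (\<Sum>i\<in>wlists (index_range N) k. coef f i * (\<Sum>j\<in>wlists (index_range N) k'. coef g j * (\<integral>z. W (?X i) z * W (fes j) z \<partial>m)))"
  proof -
    have "(\<integral>z. chaos N k f ((T ^^ n) z) * chaos N k' g z \<partial>m)
      = (\<integral>z. (\<Sum>i\<in>wlists (index_range N) k. coef f i * (chaos N k' g z * W (?X i) z)) \<partial>m)"
      by (simp add: chaos_def[of N k] W_Tn sum_distrib_left sum_distrib_right mult_ac)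
    also have "\<dots> = (\<Sum>i\<in>wlists (index_range N) k. coef f i * (\<integral>z. chaos N k' g z * W (?X i) z \<partial>m))"
      by (subst Bochner_Integration.integral_sum)
         (auto intro!: integrable_mult_right L2R_mult_integrable chaos_L2R XR)
    finally show ?thesis by (simp add: integral_chaos[OF XR] mult.commute)
  qed
  show ?thesis
  proof (cases "k = k'")
    case False
    have "(\<integral>z. W (?X i) z * W (fes j) z \<partial>m) = 0" if "i \<in> wlists (index_range N) k" "j \<in> wlists (index_range N) k'" for i j
      using wlists_length[OF that(1)] wlists_length[OF that(2)] False by (intro W_orthogonal fes_V XV) auto
    then show ?thesis unfolding eq using False by simp
  next
    case True
    have "(\<Sum>j\<in>wlists (index_range N) k. coef g j * (\<integral>z. W (?X i) z * W (fes j) z \<partial>m))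
      = fact k * (\<Sum>j\<in>wlists (index_range N) k. coef g j * (\<Prod>l<k. cov (adj n (frak (i ! l))) (frak (j ! l))))"
      if i: "i \<in> wlists (index_range N) k" for i
    proof -
      have "(\<Prod>l<k. Q (?X i ! l) (inner (frak (j ! l)))) = (\<Prod>l<k. cov (adj n (frak (i ! l))) (frak (j ! l)))" for j
        using wlists_length[OF i] Q_inner by (intro prod.cong) auto
      then show ?thesis using sum_alpha_coef_W[OF XV[of i], where g=g and N=N and k=k] wlists_length[OF i] by simp
    qed
    then show ?thesis unfolding eq using True
      by (simp add: chaos_corr_def sum_distrib_left mult_ac)
  qed
qed

lemma integral_proj_proj_Tn:
  "(\<integral>z. proj N f ((T ^^ n) z) * proj N g z \<partial>m) = (\<Sum>k\<le>N. fact k * chaos_corr n N k f g)"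
proof -
  have i: "integrable m (\<lambda>z. chaos N k f ((T ^^ n) z) * chaos N k' g z)" for k k'
    by (rule L2R_mult_integrable[OF Tn_L2R[OF chaos_L2R] chaos_L2R])
  have "(\<integral>z. proj N f ((T ^^ n) z) * proj N g z \<partial>m)
     = (\<integral>z. (\<Sum>k\<le>N. \<Sum>k'\<le>N. chaos N k f ((T ^^ n) z) * chaos N k' g z) \<partial>m)"
    by (simp add: proj_def sum_product)
  also have "\<dots> = (\<Sum>k\<le>N. \<Sum>k'\<le>N. (\<integral>z. chaos N k f ((T ^^ n) z) * chaos N k' g z \<partial>m))"
    by (simp add: Bochner_Integration.integral_sum Bochner_Integration.integrable_sum i)
  also have "\<dots> = (\<Sum>k\<le>N. fact k * chaos_corr n N k f g)"
    by (rule sum.cong) (auto simp: integral_chaos_chaos_Tn)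
  finally show ?thesis .
qed

text \<open>The term of degree 0 is exactly what the correlation subtracts, which leaves a sum
  starting at degree 1 and hence a free factor of the small quantity.\<close>

lemma chaos_corr_0: "f \<in> L2R m \<Longrightarrow> g \<in> L2R m \<Longrightarrow> chaos_corr n N 0 f g = (\<integral>z. f z \<partial>m) * (\<integral>z. g z \<partial>m)"
  using alpha_coef_eq[of f "[]"] alpha_coef_eq[of g "[]"] by (simp add: chaos_corr_def mom_def P.prob_space)

subsection \<open>Decay of correlations\<close>

text \<open>Crude by a factor of 2, which is offset by the 1/2 in the weights of the
  discretisation.\<close>

lemma norm_cscale_le: "norm (cscale J a x) \<le> 2 * cmod a * norm x"
proof -
  have "norm (cscale J a x) \<le> \<bar>Re a\<bar> * norm x + \<bar>Im a\<bar> * norm x"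
    unfolding cscale_def by (rule norm_triangle_le) simp
  also have "\<dots> \<le> cmod a * norm x + cmod a * norm x"
    by (intro add_mono mult_right_mono abs_Re_le_cmod abs_Im_le_cmod) auto
  finally show ?thesis by (simp add: mult_ac)
qed

text \<open>A complex rank-one form becomes two real ones, for a pair of vectors and for the images
  under J; this doubles the number of terms in the expansion of the covariance.\<close>

lemma Re_cscale_cinner:
  "Re (c * (cinner J x a * cnj (cinner J y b))) = inner x (cscale J c a) * inner y b + inner x (J (cscale J c a)) * inner y (J b)"
proof -
  have "Re (c * (cinner J x a * cnj (cinner J y b))) = Re (cinner J x (cscale J c a) * cnj (cinner J y b))"
    by (simp only: cinner_cscale mult.assoc)
  also have "\<dots> = inner x (cscale J c a) * inner y b + inner (J x) (cscale J c a) * inner (J y) b"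
    by (rule Re_cinner_cnj)
  finally show ?thesis by (simp add: inner_J_right)
qed

lemma cinner_diff_right: "cinner J x (a - b) = cinner J x a - cinner J x b"
  by (simp add: complex_eq_iff Im_cinner inner_diff_right)

text \<open>Finite-rank approximations of nuclear norm \<open>O(n\<^sup>-\<^sup>\<alpha>)\<close>: on each of \<open>n\<close> arcs the oscillating factor sums
  to zero, so that the eigenvector field may be replaced by its increments on the arcs.\<close>

lemma cov_adj_discrete:
  obtains c where "c > 0"
    "\<And>n. n \<ge> 1 \<Longrightarrow> \<exists>(S :: nat \<Rightarrow> (nat \<times> nat) set) u v.
       (\<forall>q. finite (S q)) \<and> (\<forall>q. (\<Sum>s\<in>S q. norm (u q s) * norm (v q s)) \<le> c / real n powr \<alpha>) \<and>
       (\<forall>x y. (\<lambda>q. \<Sum>s\<in>S q. inner x (u q s) * inner y (v q s)) \<longlonglongrightarrow> cov (adj n x) y)"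
proof -
  obtain M where M: "M > 0" "\<And>l. l \<in> sphere 0 1 \<Longrightarrow> norm (E l) \<le> M" using E_bounded by metis
  obtain C where C: "C > 0" "\<And>t t'. t \<in> {0..<2*pi} \<Longrightarrow> t' \<in> {0..<2*pi} \<Longrightarrow> norm (E (cis t) - E (cis t')) \<le> C * \<bar>t - t'\<bar> powr \<alpha>"
    using hold unfolding holderian_def by blast
  \<comment> \<open>The 4 counts the families of rank-one terms below. Each of them contributes at
    most \<delta> M, where \<delta> = C (2 pi / n)^\<alpha> bounds the increments of E on one
    arc.\<close>
  define K where "K = 4 * C * (2*pi) powr \<alpha> * M"
  have K: "K > 0" using M C by (simp add: K_def)
  show ?thesis
  proof (rule that[OF K])
    fix n :: nat assume n: "n \<ge> 1"
    define \<delta> where "\<delta> = C * (2*pi / real n) powr \<alpha>"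
    \<comment> \<open>Each of the n arcs carries q + 2 sample points. Taking a multiple of n makes
      the oscillating factor run through all roots of unity of order q + 2 on each arc, and the
      offset 2 ensures that these sum to 0.\<close>
    define N where "N q = n * (q + 2)" for q
    define th where "th q s = 2 * pi * real s / real (N q)" for q s
    define a where "a q s = E (cis (th q s))" for q s
    \<comment> \<open>The sample at the left end of the arc containing s; integer division finds the
      arc.\<close>
    define b where "b q s = E (cis (th q ((s div (q + 2)) * (q + 2))))" for q s
    \<comment> \<open>The oscillating factor times the quadrature weight; the 2 comes from
      \<open>cov_R_form\<close>.\<close>
    define w where "w q s = cis (real n * th q s) / complex_of_real (2 * real (N q))" for q s
    \<comment> \<open>The labels j = 0, 1 carry the term with the increment \<open>a - b\<close> in
      the first slot, j = 2, 3 the term with it in the second slot; odd j is the companion under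
      J.\<close>
    define u where "u q p = (case p of (s, j) \<Rightarrow>
        if j = 0 then cscale J (w q s) (a q s - b q s) else if j = 1 then J (cscale J (w q s) (a q s - b q s))
        else if j = 2 then cscale J (w q s) (b q s) else J (cscale J (w q s) (b q s)))" for q and p :: "nat \<times> nat"
    define v where "v q p = (case p of (s, j) \<Rightarrow>
        if j = 0 then a q s else if j = 1 then J (a q s)
        else if j = 2 then a q s - b q s else J (a q s - b q s))" for q and p :: "nat \<times> nat"
    define S where "S q = {..<N q} \<times> {..<4::nat}" for q
    have N: "N q > 0" for q using n by (simp add: N_def)
    have th: "th q s \<in> {0..<2*pi}" if "s < N q" for q s
      using that N[of q] by (auto simp: th_def field_simps)
    have na: "norm (a q s) \<le> M" "norm (b q s) \<le> M" for q s by (auto simp: a_def b_def intro: M(2))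
    have blk: "(s div (q + 2)) * (q + 2) \<le> s" "s < (s div (q + 2)) * (q + 2) + (q + 2)" for s q :: nat
      using div_times_less_eq_dividend[of s "q + 2"] dividend_less_div_times[of "q + 2" s] by auto
    have nab: "norm (a q s - b q s) \<le> \<delta>" if s: "s < N q" for q s
    proof -
      let ?s' = "(s div (q + 2)) * (q + 2)"
      have s': "?s' < N q" using blk(1)[of s q] s by linarith
      have "th q s - th q ?s' = 2 * pi * (real s - real ?s') / real (N q)"
        by (simp add: th_def diff_divide_distrib right_diff_distrib)
      also have "\<bar>\<dots>\<bar> \<le> 2 * pi * real (q + 2) / real (N q)"
      proof -
        have "\<bar>real s - real ?s'\<bar> \<le> real (q + 2)" using blk[of s q] by linarith
        then have "2 * pi * \<bar>real s - real ?s'\<bar> \<le> 2 * pi * real (q + 2)" by (rule mult_left_mono) simp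
        then show ?thesis by (simp only: abs_divide abs_mult abs_of_nat abs_numeral abs_of_pos[OF pi_gt_zero] divide_right_mono of_nat_0_le_iff)
      qed
      also have "2 * pi * real (q + 2) / real (N q) = 2 * pi / real n"
      proof -
        have "2 * pi * x / (real n * x) = 2 * pi / real n" if "x > 0" for x :: real using that n by simp
        then show ?thesis by (simp only: N_def of_nat_mult)
      qed
      finally have "\<bar>th q s - th q ?s'\<bar> powr \<alpha> \<le> (2 * pi / real n) powr \<alpha>" using \<alpha> by (intro powr_mono2) auto
      then have "C * \<bar>th q s - th q ?s'\<bar> powr \<alpha> \<le> \<delta>" using C(1) by (simp add: \<delta>_def)
      then show ?thesis using C(2)[OF th[OF s] th[OF s']] by (simp add: a_def b_def)
    qed
    have nw: "cmod (w q s) = 1 / (2 * real (N q))" for q s by (simp add: w_def norm_divide)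
    have \<delta>0: "\<delta> \<ge> 0" using C(1) by (simp add: \<delta>_def)
    have nuv: "norm (u q (s, j)) * norm (v q (s, j)) \<le> \<delta> * M / real (N q)" if s: "s < N q" for q s j
    proof -
      have 1: "norm (cscale J (w q s) (a q s - b q s)) \<le> \<delta> / real (N q)"
        using norm_cscale_le[of "w q s" "a q s - b q s"] nab[OF s] N[of q] by (simp add: nw field_simps)
      have 2: "norm (cscale J (w q s) (b q s)) \<le> M / real (N q)"
        using norm_cscale_le[of "w q s" "b q s"] na(2)[of q s] N[of q] by (simp add: nw field_simps)
      have "norm (cscale J (w q s) (a q s - b q s)) * norm (a q s) \<le> (\<delta> / real (N q)) * M"
        using \<delta>0 N[of q] by (intro mult_mono 1 na) auto
      moreover have "norm (cscale J (w q s) (b q s)) * norm (a q s - b q s) \<le> (M / real (N q)) * \<delta>"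
        using M(1) N[of q] by (intro mult_mono 2 nab[OF s]) auto
      ultimately show ?thesis by (auto simp: u_def v_def mult_ac)
    qed
    have sum_bound: "(\<Sum>s\<in>S q. norm (u q s) * norm (v q s)) \<le> K / real n powr \<alpha>" for q
    proof -
      have "(\<Sum>s\<in>S q. norm (u q s) * norm (v q s)) \<le> (\<Sum>s\<in>S q. \<delta> * M / real (N q))"
        by (rule sum_mono) (auto simp: S_def intro: nuv)
      also have "\<dots> = 4 * \<delta> * M" using N[of q] by (simp add: S_def)
      also have "\<dots> = K / real n powr \<alpha>" using n by (simp add: K_def \<delta>_def powr_divide)
      finally show ?thesis .
    qed
    have conv: "(\<lambda>q. \<Sum>s\<in>S q. inner x (u q s) * inner y (v q s)) \<longlonglongrightarrow> cov (adj n x) y" for x y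
    proof -
      define h where "h a b = cinner J x a * cnj (cinner J y b)" for a b
      define F where "F t = cis t ^ n * cinner J x (E (cis t)) * cnj (cinner J y (E (cis t)))" for t
      have "continuous_on {0..<2*pi} F"
        unfolding F_def[abs_def] by (intro continuous_intros cinner_continuous E_cis_continuous)
      moreover have "norm (F t) \<le> (2 * norm x * M) * (2 * norm y * M)" for t
      proof -
        have "cmod (cinner J z (E (cis t))) \<le> 2 * norm z * M" for z
          by (rule order_trans[OF norm_cinner]) (intro mult_left_mono M(2), auto)
        then have "cmod (cinner J x (E (cis t))) * cmod (cinner J y (E (cis t))) \<le> (2 * norm x * M) * (2 * norm y * M)"
          using M(1) by (intro mult_mono) auto
        then show ?thesis unfolding F_def by (simp only: norm_mult norm_power norm_cis power_one mult_1 complex_mod_cnj)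
      qed
      ultimately have "(\<lambda>N. (\<Sum>s<N. F (2*pi * real s / real N)) / of_nat N) \<longlonglongrightarrow>
          (\<integral>t. F t \<partial>lebesgue_on {0..<2*pi}) / of_real (2*pi)"
        by (intro riemann_sum_tendsto) auto
      moreover have "filterlim N at_top sequentially"
        by (rule filterlim_subseq) (use n in \<open>auto simp: N_def strict_mono_def\<close>)
      ultimately have "(\<lambda>q. (\<Sum>s<N q. F (2*pi * real s / real (N q))) / of_nat (N q)) \<longlonglongrightarrow>
          (\<integral>t. F t \<partial>lebesgue_on {0..<2*pi}) / of_real (2*pi)"
        by (rule filterlim_compose)
      then have "(\<lambda>q. Re ((\<Sum>s<N q. F (th q s)) / of_nat (N q)) / 2) \<longlonglongrightarrow>
          Re ((\<integral>t. F t \<partial>lebesgue_on {0..<2*pi}) / of_real (2*pi)) / 2"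
        unfolding th_def by (rule tendsto_divide[OF tendsto_Re tendsto_const]) simp
      also have "Re ((\<integral>t. F t \<partial>lebesgue_on {0..<2*pi}) / of_real (2*pi)) / 2 = cov (adj n x) y"
        by (simp add: cov_adj circ_integral_def F_def)
      also have "(\<lambda>q. Re ((\<Sum>s<N q. F (th q s)) / of_nat (N q)) / 2) = (\<lambda>q. \<Sum>s\<in>S q. inner x (u q s) * inner y (v q s))"
      proof
        fix q
        \<comment> \<open>On one arc b is constant while the oscillating factors form a full set of
          roots of unity, so the term with b in both slots drops out of the sum.\<close>
        have zero: "(\<Sum>s<N q. w q s * h (b q s) (b q s)) = 0"
        proof -
          have "(\<Sum>r<q+2. w q (p * (q+2) + r) * h (b q (p * (q+2) + r)) (b q (p * (q+2) + r))) = 0" for p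
          proof -
            have wr: "w q (p * (q+2) + r) = cis (2*pi * real r / real (q+2)) / complex_of_real (2 * real (N q))" for r
            proof -
              have "real n * th q (p * (q+2) + r) = 2 * pi * real r / real (q+2) + 2 * pi * real p"
              proof -
                have "real n * (2 * pi * (real p * x + real r) / (real n * x)) = 2 * pi * real r / x + 2 * pi * real p" if "x > 0" for x :: real
                  using that n by (simp add: field_simps)
                from this[of "real (q + 2)"] show ?thesis by (simp only: th_def N_def of_nat_mult of_nat_add)
              qed
              moreover have "cis (2 * pi * real p) = 1" by (rule cis_multiple_2pi) auto
              ultimately show ?thesis by (simp add: w_def cis_mult[symmetric])
            qed
            have br: "b q (p * (q+2) + r) = b q (p * (q+2))" if "r < q + 2" for r
            proof -
              have d: "(p * k + r) div k = p" if "r < k" for r k :: nat using that by simp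
              have "(p * (q+2) + r) div (q+2) = p" "(p * (q+2)) div (q+2) = p" using d[OF that] d[of 0 "q+2"] by simp_all
              then show ?thesis by (simp only: b_def)
            qed
            have "(\<Sum>r<q+2. w q (p * (q+2) + r) * h (b q (p * (q+2) + r)) (b q (p * (q+2) + r)))
              = (\<Sum>r<q+2. cis (2*pi * real r / real (q+2)) * (h (b q (p * (q+2))) (b q (p * (q+2))) / complex_of_real (2 * real (N q))))"
              by (rule sum.cong) (simp_all only: wr br lessThan_iff, simp)
            also have "\<dots> = 0" using sum_cis_block[of "q+2"] by (simp only: sum_distrib_right[symmetric]) simp
            finally show ?thesis .
          qed
          then show ?thesis unfolding N_def sum_lessThan_mult by simp
        qed
        \<comment> \<open>Apart from the term that has just been shown to cancel, every term
          contains an increment \<open>a - b\<close>, which is where the Hoelder bound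
          applies.\<close>
        have Fterm: "F (th q s) / of_nat (N q) / 2 = w q s * h (a q s - b q s) (a q s) + w q s * h (b q s) (a q s - b q s) + w q s * h (b q s) (b q s)" for s
        proof -
          have "F (th q s) / of_nat (N q) / 2 = w q s * h (a q s) (a q s)"
            by (simp add: F_def w_def h_def a_def Complex.DeMoivre mult_ac)
          also have "h (a q s) (a q s) = h (a q s - b q s) (a q s) + h (b q s) (a q s - b q s) + h (b q s) (b q s)"
            by (simp add: h_def cinner_diff_right algebra_simps)
          finally show ?thesis by (simp add: distrib_left)
        qed
        have "(\<Sum>s<N q. F (th q s)) / of_nat (N q) / 2 = (\<Sum>s<N q. F (th q s) / of_nat (N q) / 2)"
          by (simp add: sum_divide_distrib)
        also have "\<dots> = (\<Sum>s<N q. w q s * h (a q s - b q s) (a q s) + w q s * h (b q s) (a q s - b q s))"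
          using zero by (simp only: Fterm sum.distrib) simp
        finally have "Re ((\<Sum>s<N q. F (th q s)) / of_nat (N q) / 2)
          = Re (\<Sum>s<N q. w q s * h (a q s - b q s) (a q s) + w q s * h (b q s) (a q s - b q s))" by (rule arg_cong)
        also have "\<dots> = (\<Sum>s<N q. Re (w q s * h (a q s - b q s) (a q s)) + Re (w q s * h (b q s) (a q s - b q s)))"
          by simp
        also have "\<dots> = (\<Sum>s<N q. \<Sum>j<4. inner x (u q (s, j)) * inner y (v q (s, j)))"
        proof (rule sum.cong)
          fix s
          have "{..<4::nat} = {0, 1, 2, 3}" by auto
          then show "Re (w q s * h (a q s - b q s) (a q s)) + Re (w q s * h (b q s) (a q s - b q s))
            = (\<Sum>j<4. inner x (u q (s, j)) * inner y (v q (s, j)))"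
            by (simp only: h_def Re_cscale_cinner) (simp add: u_def v_def)
        qed simp
        also have "\<dots> = (\<Sum>s\<in>S q. inner x (u q s) * inner y (v q s))"
          by (simp add: S_def sum.cartesian_product split_def)
        finally show "Re ((\<Sum>s<N q. F (th q s)) / of_nat (N q)) / 2 = (\<Sum>s\<in>S q. inner x (u q s) * inner y (v q s))"
          by simp
      qed
      finally show ?thesis .
    qed
    show "\<exists>(S :: nat \<Rightarrow> (nat \<times> nat) set) u v.
       (\<forall>q. finite (S q)) \<and> (\<forall>q. (\<Sum>s\<in>S q. norm (u q s) * norm (v q s)) \<le> K / real n powr \<alpha>) \<and>
       (\<forall>x y. (\<lambda>q. \<Sum>s\<in>S q. inner x (u q s) * inner y (v q s)) \<longlonglongrightarrow> cov (adj n x) y)"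
      using sum_bound conv by (intro exI[of _ S] exI[of _ u] exI[of _ v]) (auto simp: S_def)
  qed
qed

section \<open>Multilinear forms on truncated coordinate vectors\<close>

lemma idx_wlists: "wlists (index_range N) k \<subseteq> idx k"
  using zero_notin_wlists_index_range by (auto simp: idx_def wlists_def)

text \<open>The coordinates of u in the real orthonormal system \<open>frak\<close>, set to 0
  outside the truncation so that they are an admissible argument of \<open>Bform\<close>.\<close>

definition fin_vec :: "nat \<Rightarrow> 'h \<Rightarrow> int \<Rightarrow> real" where
  "fin_vec N u i = (if i \<in> index_range N then inner (frak i) u else 0)"

lemma fin_vec_sq: "(\<lambda>i. (fin_vec N u i)\<^sup>2) summable_on UNIV" "(\<Sum>\<^sub>\<infinity>i. (fin_vec N u i)\<^sup>2) = (\<Sum>i\<in>index_range N. (inner (frak i) u)\<^sup>2)"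
proof -
  have "(\<lambda>i. (fin_vec N u i)\<^sup>2) summable_on UNIV \<longleftrightarrow> (\<lambda>i. (inner (frak i) u)\<^sup>2) summable_on (index_range N)"
    by (rule summable_on_cong_neutral) (auto simp: fin_vec_def)
  then show "(\<lambda>i. (fin_vec N u i)\<^sup>2) summable_on UNIV" by simp
  have "(\<Sum>\<^sub>\<infinity>i. (fin_vec N u i)\<^sup>2) = (\<Sum>\<^sub>\<infinity>i\<in>index_range N. (inner (frak i) u)\<^sup>2)"
    by (rule infsum_cong_neutral) (auto simp: fin_vec_def)
  then show "(\<Sum>\<^sub>\<infinity>i. (fin_vec N u i)\<^sup>2) = (\<Sum>i\<in>index_range N. (inner (frak i) u)\<^sup>2)" by simp
qed

lemma fin_vec_l2Z: "fin_vec N u \<in> l2Z"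
  using fin_vec_sq(1) by (simp add: l2Z_def fin_vec_def)

text \<open>Bessel's inequality for the real orthonormal system formed by the basis vectors and
  their images under J.\<close>

lemma fin_vec_norm: "l2Z_norm (fin_vec N u) \<le> norm u"
proof -
  define p where "p = (\<Sum>i\<in>index_range N. inner (frak i) u *\<^sub>R frak i)"
  have nz: "i \<noteq> 0" if "i \<in> index_range N" for i using that by (auto simp: index_range_def)
  have pu: "inner p u = (\<Sum>i\<in>index_range N. (inner (frak i) u)\<^sup>2)"
    by (simp add: p_def inner_sum_left power2_eq_square)
  have pp: "inner p p = (\<Sum>i\<in>index_range N. (inner (frak i) u)\<^sup>2)"
  proof -
    have "inner p (frak j) = inner (frak j) u" if j: "j \<in> index_range N" for j
    proof -
      have "inner p (frak j) = (\<Sum>i\<in>index_range N. if i = j then inner (frak j) u else 0)"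
        unfolding p_def inner_sum_left by (rule sum.cong) (use nz j in \<open>auto simp: inner_frak\<close>)
      then show ?thesis using j by simp
    qed
    then have "inner p (\<Sum>i\<in>index_range N. inner (frak i) u *\<^sub>R frak i) = (\<Sum>i\<in>index_range N. (inner (frak i) u)\<^sup>2)"
      by (simp add: inner_sum_right power2_eq_square)
    then show ?thesis by (simp add: p_def[symmetric])
  qed
  have "0 \<le> inner (u - p) (u - p)" by simp
  also have "inner (u - p) (u - p) = inner u u - 2 * inner p u + inner p p"
    by (simp add: inner_diff_left inner_diff_right inner_commute)
  finally have "(\<Sum>i\<in>index_range N. (inner (frak i) u)\<^sup>2) \<le> inner u u" using pu pp by simp
  then show ?thesis
    unfolding l2Z_norm_def fin_vec_sq(2) norm_eq_sqrt_inner by (rule real_sqrt_le_mono)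
qed

text \<open>Finite support turns the infinite sum into the finite one that appears when the
  approximated covariance is multiplied out.\<close>

lemma Bform_fin_vec:
  "Bform J e m f k (\<lambda>l. fin_vec N (u l)) = (\<Sum>i\<in>wlists (index_range N) k. coef f i * (\<Prod>l<k. inner (frak (i ! l)) (u l)))"
proof -
  have "Bform J e m f k (\<lambda>l. fin_vec N (u l))
    = (\<Sum>\<^sub>\<infinity>i\<in>wlists (index_range N) k. coef f i * (\<Prod>l<k. inner (frak (i ! l)) (u l)))"
    unfolding Bform_def
  proof (rule infsum_cong_neutral)
    fix i assume i: "i \<in> idx k - wlists (index_range N) k"
    then have "length i = k" "\<not> set i \<subseteq> index_range N" by (auto simp: idx_def wlists_def)
    then obtain l where l: "l < k" "i ! l \<notin> index_range N" by (metis in_set_conv_nth subsetI)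
    then have "(\<Prod>j<k. fin_vec N (u j) (i ! j)) = 0"
      by (intro prod_zero) (auto simp: fin_vec_def intro!: bexI[of _ l])
    then show "Bterm J e m f k (\<lambda>l. fin_vec N (u l)) i = 0" by (simp add: Bterm_def)
  next
    fix i assume "i \<in> wlists (index_range N) k - idx k"
    then show "coef f i * (\<Prod>l<k. inner (frak (i ! l)) (u l)) = 0" using idx_wlists by blast
  next
    fix i assume "i \<in> idx k \<inter> wlists (index_range N) k"
    then have "i ! l \<in> index_range N" if "l < k" for l using that by (auto simp: wlists_def)
    then show "Bterm J e m f k (\<lambda>l. fin_vec N (u l)) i = coef f i * (\<Prod>l<k. inner (frak (i ! l)) (u l))"
      by (simp add: Bterm_def fin_vec_def)
  qed
  then show ?thesis by (simp add: finite_wlists)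
qed

lemma l2Z_norm_scale: "l2Z_norm (\<lambda>i. c * x i) = \<bar>c\<bar> * l2Z_norm x"
  by (simp add: l2Z_norm_def power_mult_distrib infsum_cmult_right' real_sqrt_mult)

lemma l2Z_norm_nonneg: "0 \<le> l2Z_norm x"
  by (simp add: l2Z_norm_def infsum_nonneg)

lemma Bnorm_bdd:
  assumes "Bbounded J e m f k"
  shows "bdd_above ((\<lambda>x. \<bar>Bform J e m f k x\<bar>) ` {x. \<forall>j<k. x j \<in> l2Z \<and> l2Z_norm (x j) = 1})"
proof -
  obtain C where C: "\<And>x. (\<forall>j<k. x j \<in> l2Z) \<Longrightarrow> \<bar>Bform J e m f k x\<bar> \<le> C * (\<Prod>j<k. l2Z_norm (x j))"
    using assms unfolding Bbounded_def by blast
  show ?thesis by (rule bdd_aboveI[of _ C]) (use C in force)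
qed

text \<open>Homogeneity reduces to unit vectors, over which \<open>Bnorm\<close> is a supremum; an
  argument of norm 0 cannot be normalised and is handled by the boundedness constant
  instead.\<close>

lemma Bform_le_Bnorm:
  assumes B: "Bbounded J e m f k" and x: "\<And>j. j < k \<Longrightarrow> x j \<in> l2Z"
  shows "\<bar>Bform J e m f k x\<bar> \<le> Bnorm J e m f k * (\<Prod>j<k. l2Z_norm (x j))"
proof (cases "\<exists>j<k. l2Z_norm (x j) = 0")
  case True
  obtain C where C: "\<And>x. (\<forall>j<k. x j \<in> l2Z) \<Longrightarrow> \<bar>Bform J e m f k x\<bar> \<le> C * (\<Prod>j<k. l2Z_norm (x j))"
    using B unfolding Bbounded_def by blast
  have P0: "(\<Prod>j<k. l2Z_norm (x j)) = 0" using True by (intro prod_zero) auto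
  have "\<bar>Bform J e m f k x\<bar> \<le> C * (\<Prod>j<k. l2Z_norm (x j))" by (rule C) (use x in blast)
  then show ?thesis unfolding P0 by simp
next
  case False
  define a where "a j = l2Z_norm (x j)" for j
  have a: "a j > 0" if "j < k" for j using False that l2Z_norm_nonneg[of "x j"] by (auto simp: a_def less_le)
  define y where "y j i = (1 / a j) * x j i" for j i
  have y: "y j \<in> l2Z \<and> l2Z_norm (y j) = 1" if "j < k" for j
  proof
    have "(\<lambda>i. (x j i)\<^sup>2) summable_on UNIV" using x[OF that] by (simp add: l2Z_def)
    then have "(\<lambda>i. (1 / a j)\<^sup>2 * (x j i)\<^sup>2) summable_on UNIV" by (rule summable_on_cmult_right)
    then show "y j \<in> l2Z" using x[OF that] by (simp add: l2Z_def y_def power_mult_distrib power_divide)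
    show "l2Z_norm (y j) = 1"
      using a[OF that] l2Z_norm_scale[of "1 / a j" "x j"] by (simp add: y_def[abs_def] a_def)
  qed
  have "Bterm J e m f k y = (\<lambda>is. (\<Prod>j<k. 1 / a j) * Bterm J e m f k x is)"
    unfolding fun_eq_iff Bterm_def y_def by (simp only: prod.distrib) (simp add: mult_ac)
  then have By: "Bform J e m f k y = (\<Prod>j<k. 1 / a j) * Bform J e m f k x"
    unfolding Bform_def by (simp only: infsum_cmult_right')
  have P: "(\<Prod>j<k. a j) > 0" using a by (intro prod_pos) auto
  have "Bform J e m f k x = (\<Prod>j<k. a j) * Bform J e m f k y"
  proof -
    have "(\<Prod>j<k. a j) * (\<Prod>j<k. 1 / a j) = (\<Prod>j<k. a j * (1 / a j))" by (simp only: prod.distrib)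
    also have "\<dots> = 1" using a by (intro prod.neutral) (auto simp: less_imp_neq[symmetric])
    finally show ?thesis unfolding By by (simp only: mult.assoc[symmetric])
  qed
  then have "\<bar>Bform J e m f k x\<bar> = (\<Prod>j<k. a j) * \<bar>Bform J e m f k y\<bar>" using P by (simp add: abs_mult)
  also have "\<bar>Bform J e m f k y\<bar> \<le> Bnorm J e m f k"
    unfolding Bnorm_def by (rule cSUP_upper[OF _ Bnorm_bdd[OF B]]) (use y in auto)
  finally show ?thesis using P by (simp add: a_def mult.commute mult_left_mono)
qed

text \<open>A unit vector has to be exhibited, because nonnegative terms say nothing about a
  supremum over an empty set.\<close>

lemma Bnorm_nonneg:
  assumes B: "Bbounded J e m f k" shows "0 \<le> Bnorm J e m f k"
proof -
  define d :: "int \<Rightarrow> real" where "d i = (if i = 1 then 1 else 0)" for i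
  have "(\<lambda>i. (d i)\<^sup>2) summable_on UNIV \<longleftrightarrow> (\<lambda>i. 1::real) summable_on {1::int}"
    by (rule summable_on_cong_neutral) (auto simp: d_def)
  moreover have "(\<Sum>\<^sub>\<infinity>i. (d i)\<^sup>2) = (\<Sum>\<^sub>\<infinity>i\<in>{1::int}. 1)"
    by (rule infsum_cong_neutral) (auto simp: d_def)
  ultimately have "d \<in> l2Z" "l2Z_norm d = 1" by (auto simp: l2Z_def l2Z_norm_def d_def)
  then show ?thesis
    using Bform_le_Bnorm[OF B, of "\<lambda>_. d"] by simp
qed

text \<open>Inserting a finite-rank approximation of the covariance and multiplying out the k-fold
  product decouples the two tensors: every term is a value of the form of f times a value of the
  form of g. The products of norms sum to the k-th power of the nuclear bound, so neither the rank
  nor N enters the estimate.\<close>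

lemma chaos_corr_bound:
  obtains c where "c > 0"
    "\<And>n N k f g. n \<ge> 1 \<Longrightarrow> Bbounded J e m f k \<Longrightarrow> Bbounded J e m g k \<Longrightarrow>
      \<bar>chaos_corr n N k f g\<bar> \<le> (c / real n powr \<alpha>) ^ k * Bnorm J e m f k * Bnorm J e m g k"
proof -
  show ?thesis
  proof (rule cov_adj_discrete)
    fix c :: real
    assume c: "c > 0"
      "\<And>n. n \<ge> 1 \<Longrightarrow> \<exists>(S :: nat \<Rightarrow> (nat \<times> nat) set) u v.
       (\<forall>q. finite (S q)) \<and> (\<forall>q. (\<Sum>s\<in>S q. norm (u q s) * norm (v q s)) \<le> c / real n powr \<alpha>) \<and>
       (\<forall>x y. (\<lambda>q. \<Sum>s\<in>S q. inner x (u q s) * inner y (v q s)) \<longlonglongrightarrow> cov (adj n x) y)"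
    show thesis
  proof (rule that[OF c(1)])
    fix n N k :: nat and f g
    assume n: "n \<ge> 1" and f: "Bbounded J e m f k" and g: "Bbounded J e m g k"
    obtain S :: "nat \<Rightarrow> (nat \<times> nat) set" and u v where S: "\<And>q. finite (S q)"
      and uv: "\<And>q. (\<Sum>s\<in>S q. norm (u q s) * norm (v q s)) \<le> c / real n powr \<alpha>"
      and conv: "\<And>x y. (\<lambda>q. \<Sum>s\<in>S q. inner x (u q s) * inner y (v q s)) \<longlonglongrightarrow> cov (adj n x) y"
      using c(2)[OF n] by blast
    let ?A = "wlists (index_range N) k"
    let ?a = "coef f" and ?b = "coef g"
    \<comment> \<open>\<open>chaos_corr\<close> with the covariance replaced by its q-th
      approximation. For fixed N and k all sums are finite, so the limit in q can be taken term by
      term.\<close>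
    define D where "D q = (\<Sum>i\<in>?A. \<Sum>j\<in>?A. ?a i * ?b j * (\<Prod>l<k. \<Sum>s\<in>S q. inner (frak (i ! l)) (u q s) * inner (frak (j ! l)) (v q s)))" for q
    have "D \<longlonglongrightarrow> chaos_corr n N k f g"
      unfolding D_def[abs_def] chaos_corr_def by (intro tendsto_sum tendsto_mult tendsto_const tendsto_prod conv)
    then have lim: "(\<lambda>q. \<bar>D q\<bar>) \<longlonglongrightarrow> \<bar>chaos_corr n N k f g\<bar>" by (rule tendsto_rabs)
    have "\<bar>D q\<bar> \<le> (c / real n powr \<alpha>) ^ k * Bnorm J e m f k * Bnorm J e m g k" for q
    proof -
      have "D q = (\<Sum>i\<in>?A. \<Sum>j\<in>?A. \<Sum>ss\<in>wlists (S q) k.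
          (?a i * (\<Prod>l<k. inner (frak (i ! l)) (u q (ss ! l)))) * (?b j * (\<Prod>l<k. inner (frak (j ! l)) (v q (ss ! l)))))"
        unfolding D_def
      proof (intro sum.cong refl)
        fix i j
        have "(\<Prod>l<k. \<Sum>s\<in>S q. inner (frak (i ! l)) (u q s) * inner (frak (j ! l)) (v q s))
           = (\<Sum>ss\<in>wlists (S q) k. \<Prod>l<k. inner (frak (i ! l)) (u q (ss ! l)) * inner (frak (j ! l)) (v q (ss ! l)))"
          by (rule prod_sum_wlists[OF S])
        then show "?a i * ?b j * (\<Prod>l<k. \<Sum>s\<in>S q. inner (frak (i ! l)) (u q s) * inner (frak (j ! l)) (v q s))
          = (\<Sum>ss\<in>wlists (S q) k. (?a i * (\<Prod>l<k. inner (frak (i ! l)) (u q (ss ! l)))) * (?b j * (\<Prod>l<k. inner (frak (j ! l)) (v q (ss ! l)))))"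
          by (simp add: sum_distrib_left prod.distrib mult_ac)
      qed
      also have "\<dots> = (\<Sum>ss\<in>wlists (S q) k. \<Sum>i\<in>?A. \<Sum>j\<in>?A.
          (?a i * (\<Prod>l<k. inner (frak (i ! l)) (u q (ss ! l)))) * (?b j * (\<Prod>l<k. inner (frak (j ! l)) (v q (ss ! l)))))"
        by (rule trans[OF sum.cong[OF refl sum.swap] sum.swap])
      also have "\<dots> = (\<Sum>ss\<in>wlists (S q) k.
          Bform J e m f k (\<lambda>l. fin_vec N (u q (ss ! l))) * Bform J e m g k (\<lambda>l. fin_vec N (v q (ss ! l))))"
        by (simp only: Bform_fin_vec sum_product)
      finally have D: "D q = (\<Sum>ss\<in>wlists (S q) k.
          Bform J e m f k (\<lambda>l. fin_vec N (u q (ss ! l))) * Bform J e m g k (\<lambda>l. fin_vec N (v q (ss ! l))))" .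
      have one: "\<bar>Bform J e m h k (\<lambda>l. fin_vec N (w l))\<bar> \<le> Bnorm J e m h k * (\<Prod>l<k. norm (w l))" if "Bbounded J e m h k" for h w
      proof -
        have "\<bar>Bform J e m h k (\<lambda>l. fin_vec N (w l))\<bar> \<le> Bnorm J e m h k * (\<Prod>l<k. l2Z_norm (fin_vec N (w l)))"
          by (rule Bform_le_Bnorm[OF that]) (rule fin_vec_l2Z)
        also have "\<dots> \<le> Bnorm J e m h k * (\<Prod>l<k. norm (w l))"
          by (intro mult_left_mono prod_mono conjI fin_vec_norm l2Z_norm_nonneg Bnorm_nonneg that)
        finally show ?thesis .
      qed
      have "\<bar>D q\<bar> \<le> (\<Sum>ss\<in>wlists (S q) k.
          \<bar>Bform J e m f k (\<lambda>l. fin_vec N (u q (ss ! l))) * Bform J e m g k (\<lambda>l. fin_vec N (v q (ss ! l)))\<bar>)"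
        unfolding D by (rule sum_abs)
      also have "\<dots> \<le> (\<Sum>ss\<in>wlists (S q) k. (Bnorm J e m f k * Bnorm J e m g k) * (\<Prod>l<k. norm (u q (ss ! l)) * norm (v q (ss ! l))))"
      proof (rule sum_mono)
        fix ss
        have "\<bar>Bform J e m f k (\<lambda>l. fin_vec N (u q (ss ! l)))\<bar> * \<bar>Bform J e m g k (\<lambda>l. fin_vec N (v q (ss ! l)))\<bar>
          \<le> (Bnorm J e m f k * (\<Prod>l<k. norm (u q (ss ! l)))) * (Bnorm J e m g k * (\<Prod>l<k. norm (v q (ss ! l))))"
          by (intro mult_mono one f g mult_nonneg_nonneg Bnorm_nonneg prod_nonneg) auto
        then show "\<bar>Bform J e m f k (\<lambda>l. fin_vec N (u q (ss ! l))) * Bform J e m g k (\<lambda>l. fin_vec N (v q (ss ! l)))\<bar>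
          \<le> (Bnorm J e m f k * Bnorm J e m g k) * (\<Prod>l<k. norm (u q (ss ! l)) * norm (v q (ss ! l)))"
          by (simp add: abs_mult prod.distrib mult_ac)
      qed
      also have "\<dots> = (Bnorm J e m f k * Bnorm J e m g k) * (\<Prod>l<k. \<Sum>s\<in>S q. norm (u q s) * norm (v q s))"
        by (simp only: sum_distrib_left[symmetric] prod_sum_wlists[OF S[of q], where k=k and h="\<lambda>l s. norm (u q s) * norm (v q s)"])
      also have "\<dots> \<le> (Bnorm J e m f k * Bnorm J e m g k) * (c / real n powr \<alpha>) ^ k"
      proof (rule mult_left_mono)
        have "(\<Sum>s\<in>S q. norm (u q s) * norm (v q s)) ^ k \<le> (c / real n powr \<alpha>) ^ k"
          by (rule power_mono[OF uv]) (simp add: sum_nonneg)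
        then show "(\<Prod>l<k. \<Sum>s\<in>S q. norm (u q s) * norm (v q s)) \<le> (c / real n powr \<alpha>) ^ k" by simp
      qed (simp add: Bnorm_nonneg f g)
      finally show ?thesis by (simp add: mult_ac)
    qed
    then show "\<bar>chaos_corr n N k f g\<bar> \<le> (c / real n powr \<alpha>) ^ k * Bnorm J e m f k * Bnorm J e m g k"
      by (intro LIMSEQ_le_const2[OF lim]) auto
  qed
  qed
qed

section \<open>Comparison of norms and the final estimate\<close>

lemma Xnorm_ge:
  assumes f: "f \<in> Xspace J e m" shows "L2norm m f \<le> Xnorm J e m f" "Bnorm J e m f k \<le> Xnorm J e m f"
proof -
  have s: "summable (\<lambda>k. (Bnorm J e m f k)\<^sup>2)" using f by (simp add: Xspace_def)
  have "0 \<le> (\<Sum>k. (Bnorm J e m f k)\<^sup>2)" by (rule suminf_nonneg[OF s]) simp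
  then show "L2norm m f \<le> Xnorm J e m f" unfolding Xnorm_def by (intro real_le_rsqrt) simp
  have "(\<Sum>i\<in>{k}. (Bnorm J e m f i)\<^sup>2) \<le> (\<Sum>k. (Bnorm J e m f k)\<^sup>2)"
    by (rule sum_le_suminf[OF s]) auto
  then show "Bnorm J e m f k \<le> Xnorm J e m f" unfolding Xnorm_def by (intro real_le_rsqrt) (simp add: add_increasing)
qed

lemma Ynorm_ge:
  assumes g: "g \<in> Yspace J e m" shows "L2norm m g \<le> Ynorm J e m g" "fact k * Bnorm J e m g k \<le> Ynorm J e m g"
proof -
  have bdd: "bdd_above (range (\<lambda>k. fact k * Bnorm J e m g k))" using g by (simp add: Yspace_def)
  have B: "Bbounded J e m g k" for k using g by (simp add: Yspace_def)
  have le: "fact k * Bnorm J e m g k \<le> (SUP k. fact k * Bnorm J e m g k)" for k by (rule cSUP_upper[OF _ bdd]) simp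
  have "0 \<le> fact 0 * Bnorm J e m g 0" using Bnorm_nonneg[OF B] by simp
  then have "0 \<le> (SUP k. fact k * Bnorm J e m g k)" using le[of 0] by linarith
  then show "L2norm m g \<le> Ynorm J e m g" by (simp add: Ynorm_def)
  show "fact k * Bnorm J e m g k \<le> Ynorm J e m g" using le[of k] by (simp add: Ynorm_def add_increasing)
qed

lemma correlation_bound:
  assumes f: "f \<in> L2R m" and g: "g \<in> L2R m"
  shows "\<bar>correlation m T n f g\<bar> \<le> 2 * (L2norm m f * L2norm m g)"
proof -
  have one: "(\<lambda>z. 1) \<in> L2R m" by (simp add: L2R_def)
  have i: "\<bar>\<integral>z. h z \<partial>m\<bar> \<le> L2norm m h" if "h \<in> L2R m" for h
    using L2_Cauchy_Schwarz[OF that one] by (simp add: L2norm_def P.prob_space)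
  have "\<bar>\<integral>z. f ((T ^^ n) z) * g z \<partial>m\<bar> \<le> L2norm m f * L2norm m g"
    using L2_Cauchy_Schwarz[OF Tn_L2R[OF f, of n] g] Tn_L2norm[OF f, of n] by simp
  moreover have "\<bar>(\<integral>z. f z \<partial>m) * (\<integral>z. g z \<partial>m)\<bar> \<le> L2norm m f * L2norm m g"
    unfolding abs_mult by (intro mult_mono i f g) auto
  ultimately show ?thesis unfolding correlation_def by linarith
qed

text \<open>The factor k! goes to the form of g, where \<open>Ynorm\<close> bounds the product. One
  factor \<rho> is kept and the remaining powers are dominated by a geometric series of ratio 1/2,
  whose sum is the constant 2.\<close>

lemma correlation_chaos_bound:
  assumes f: "f \<in> Xspace J e m" and g: "g \<in> Yspace J e m" and \<rho>: "0 \<le> \<rho>" "\<rho> \<le> 1 / 2"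
    and C: "\<And>N k. \<bar>chaos_corr n N k f g\<bar> \<le> \<rho> ^ k * Bnorm J e m f k * Bnorm J e m g k"
  shows "\<bar>correlation m T n f g\<bar> \<le> 2 * \<rho> * Xnorm J e m f * Ynorm J e m g"
proof -
  have fR: "f \<in> L2R m" and gR: "g \<in> L2R m" using f g by (auto simp: Xspace_def Yspace_def)
  have fB: "Bbounded J e m f k" and gB: "Bbounded J e m g k" for k using f g by (auto simp: Xspace_def Yspace_def)
  let ?X = "Xnorm J e m f" and ?Y = "Ynorm J e m g"
  have X0: "0 \<le> ?X" using Xnorm_ge(1)[OF f] L2norm_nonneg order_trans by blast
  have Y0: "0 \<le> ?Y" using Ynorm_ge(1)[OF g] L2norm_nonneg order_trans by blast
  define D where "D N = (\<integral>z. proj N f ((T ^^ n) z) * proj N g z \<partial>m) - (\<integral>z. f z \<partial>m) * (\<integral>z. g z \<partial>m)" for N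
  have "D \<longlonglongrightarrow> correlation m T n f g"
    unfolding D_def[abs_def] correlation_def by (intro tendsto_diff tendsto_const integral_proj_Tn_tendsto fR gR)
  then have lim: "(\<lambda>N. \<bar>D N\<bar>) \<longlonglongrightarrow> \<bar>correlation m T n f g\<bar>" by (rule tendsto_rabs)
  have "\<bar>D N\<bar> \<le> 2 * \<rho> * ?X * ?Y" for N
  proof -
    have "D N = (\<Sum>k<N. fact (Suc k) * chaos_corr n N (Suc k) f g)"
      unfolding D_def integral_proj_proj_Tn lessThan_Suc_atMost[symmetric] sum.lessThan_Suc_shift
      using chaos_corr_0[OF fR gR] by simp
    also have "\<bar>\<dots>\<bar> \<le> (\<Sum>k<N. \<rho> * ?X * ?Y * (1/2) ^ k)"
    proof (rule order_trans[OF sum_abs sum_mono])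
      fix k
      have "\<bar>fact (Suc k) * chaos_corr n N (Suc k) f g\<bar> = fact (Suc k) * \<bar>chaos_corr n N (Suc k) f g\<bar>" by (simp add: abs_mult del: fact_Suc)
      also have "\<dots> \<le> fact (Suc k) * (\<rho> ^ Suc k * Bnorm J e m f (Suc k) * Bnorm J e m g (Suc k))"
        by (intro mult_left_mono C) simp
      also have "\<dots> = \<rho> * \<rho> ^ k * Bnorm J e m f (Suc k) * (fact (Suc k) * Bnorm J e m g (Suc k))" by (simp add: mult_ac del: fact_Suc)
      also have "\<dots> \<le> \<rho> * (1/2) ^ k * ?X * ?Y"
        using \<rho> X0 by (intro mult_mono power_mono Xnorm_ge Ynorm_ge f g Bnorm_nonneg fB gB mult_nonneg_nonneg zero_le_power) auto
      finally show "\<bar>fact (Suc k) * chaos_corr n N (Suc k) f g\<bar> \<le> \<rho> * ?X * ?Y * (1/2) ^ k" by (simp add: mult_ac del: fact_Suc)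
    qed
    also have "\<dots> = \<rho> * ?X * ?Y * (\<Sum>k<N. (1/2) ^ k)" by (simp add: sum_distrib_left)
    also have "\<dots> \<le> \<rho> * ?X * ?Y * 2"
    proof (rule mult_left_mono)
      have "(\<Sum>k<N. (1/2::real) ^ k) \<le> (\<Sum>k. (1/2) ^ k)" by (rule sum_le_suminf) (auto intro: summable_geometric)
      then show "(\<Sum>k<N. (1/2::real) ^ k) \<le> 2" using suminf_geometric[of "1/2::real"] by simp
    qed (use \<rho> X0 Y0 in auto)
    finally show ?thesis by (simp add: mult_ac)
  qed
  then show ?thesis by (intro LIMSEQ_le_const2[OF lim]) auto
qed

lemma correlation_decay:
  "\<exists>C>0. \<forall>f\<in>Xspace J e m. \<forall>g\<in>Yspace J e m. \<forall>n::nat. n \<ge> 1 \<longrightarrow>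
     \<bar>correlation m T n f g\<bar> \<le> C / real n powr \<alpha> * Xnorm J e m f * Ynorm J e m g"
proof -
  obtain c where c: "c > 0"
    "\<And>n N k f g. n \<ge> 1 \<Longrightarrow> Bbounded J e m f k \<Longrightarrow> Bbounded J e m g k \<Longrightarrow>
      \<bar>chaos_corr n N k f g\<bar> \<le> (c / real n powr \<alpha>) ^ k * Bnorm J e m f k * Bnorm J e m g k"
    using chaos_corr_bound by metis
  show ?thesis
  \<comment> \<open>The factor 4 serves both cases: for \<rho> \<le> 1/2 the series gives 2 \<rho>,
    and for \<rho> > 1/2 the constant 2 of the crude bound is below 4 \<rho>.\<close>
  proof (intro exI[of _ "4 * c"] conjI ballI allI impI)
    fix f g and n :: nat assume f: "f \<in> Xspace J e m" and g: "g \<in> Yspace J e m" and n: "n \<ge> 1"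
    define \<rho> where "\<rho> = c / real n powr \<alpha>"
    have \<rho>0: "\<rho> \<ge> 0" using c(1) by (simp add: \<rho>_def)
    let ?X = "Xnorm J e m f" and ?Y = "Ynorm J e m g"
    have X0: "0 \<le> ?X" using Xnorm_ge(1)[OF f] L2norm_nonneg order_trans by blast
    have Y0: "0 \<le> ?Y" using Ynorm_ge(1)[OF g] L2norm_nonneg order_trans by blast
    have XY: "0 \<le> ?X * ?Y" using X0 Y0 by simp
    have "\<bar>correlation m T n f g\<bar> \<le> 4 * \<rho> * (?X * ?Y)"
    proof (cases "\<rho> \<le> 1 / 2")
      case True
      have "\<bar>correlation m T n f g\<bar> \<le> 2 * \<rho> * ?X * ?Y"
      proof (rule correlation_chaos_bound[OF f g \<rho>0 True])
        show "\<bar>chaos_corr n N k f g\<bar> \<le> \<rho> ^ k * Bnorm J e m f k * Bnorm J e m g k" for N k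
          unfolding \<rho>_def using f g by (intro c(2) n) (auto simp: Xspace_def Yspace_def)
      qed
      also have "\<dots> = 2 * \<rho> * (?X * ?Y)" by simp
      also have "\<dots> \<le> 4 * \<rho> * (?X * ?Y)" using \<rho>0 XY by (intro mult_right_mono) auto
      finally show ?thesis .
    next
      case False
      have "\<bar>correlation m T n f g\<bar> \<le> 2 * (L2norm m f * L2norm m g)"
        using f g by (intro correlation_bound) (auto simp: Xspace_def Yspace_def)
      also have "L2norm m f * L2norm m g \<le> ?X * ?Y"
        by (intro mult_mono Xnorm_ge Ynorm_ge f g X0 L2norm_nonneg)
      also have "2 * (?X * ?Y) \<le> 4 * \<rho> * (?X * ?Y)" using False XY by (intro mult_right_mono) auto
      finally show ?thesis by simp
    qed
    then show "\<bar>correlation m T n f g\<bar> \<le> 4 * c / real n powr \<alpha> * ?X * ?Y" by (simp add: \<rho>_def mult.assoc)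
  qed (use c in auto)
qed

end

theorem theorem5p19:
  fixes J T :: "'h::{real_inner,complete_space} \<Rightarrow> 'h"
    and E :: "complex \<Rightarrow> 'h"
    and \<alpha> :: real
    and m :: "'h measure"
    and e :: "nat \<Rightarrow> 'h"
  assumes "complex_structure J"
    and "separable_type TYPE('h)"
    and "infinite_dim TYPE('h)"
    and "bounded_linear T" and "\<forall>x. T (J x) = J (T x)"
    and "T_eigenvector_field J T E"
    and "mu_spanning J E"
    and "0 < \<alpha>" and "\<alpha> \<le> 1" and "holderian \<alpha> E"
    and "gaussian_measure J E m"
    and "R_eigenbasis J E e"
  shows "\<exists>C>0. \<forall>f\<in>Xspace J e m. \<forall>g\<in>Yspace J e m. \<forall>n::nat. n \<ge> 1 \<longrightarrow>
           \<bar>correlation m T n f g\<bar> \<le> C / real n powr \<alpha> * Xnorm J e m f * Ynorm J e m g"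
proof -
  interpret hilbert_gauss J T E \<alpha> m e
    by (rule hilbert_gauss.intro) (use assms in simp_all)
  show ?thesis by (rule correlation_decay)
qed

end
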